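(* Let $n\ge 2$. For almost every (with respect to Lebesgue measure) selection of masses $(m_1,\dots,m_n)$ with $m_1>m_2>\dots>m_n>0$ and for every positive integer $k$ the following holds: for almost every (with respect to the hypersurface measure of $\mathcal{S}_0$) singular phase point $x_0=(q_0,v_0)\in\mathcal{S}_0$, if $x_k=T^k(x_0)$ happens to belong to $\mathcal{S}_0$, then $T^k(\mathcal{S}_0)$ and $\mathcal{S}_0$ are transversal at $x_k$.
   Context: The falling ball system with masses $m_1,\dots,m_n$: $n\ge 2$ point particles with masses $m_1,\dots,m_n$, positions $0\le q_1\le q_2\le\dots\le q_n$ and velocities $v_1,\dots,v_n$ move on the vertical half line $\{q \mid q\ge 0\}$ under constant gravitational acceleration $-1$. Between collisions $\dot q_i=v_i$, $\dot v_i=-1$. The lowest particle collides elastically with the floor: when $q_1=0$, $v_1^+=-v_1^-$. Neighbouring particles collide elastically: when $q_i=q_{i+1}$, $v_i^+=\gamma_i v_i^-+(1-\gamma_i)v_{i+1}^-$ and $v_{i+1}^+=(1+\gamma_i)v_i^--\gamma_i v_{i+1}^-$, where $\gamma_i=\frac{m_i-m_{i+1}}{m_i+m_{i+1}}$ and the superscripts $-$ and $+$ denote the values just before and just after the collision. The total energy $H=\sum_{i=1}^n\left(m_iq_i+\frac12 m_iv_i^2\right)$ is fixed by $H=1$. The phase space $M$ is the set of all $(q,v)$ with $0\le q_1\le\dots\le q_n$ and $H=1$, and $\{\psi^t\}$ is the resulting Hamiltonian flow with collisions, preserving the finite Liouville measure $\mu$. $\partial Q$ is the set of configurations $q$ (with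 $0\le q_1\le\dots\le q_n$) at which a collision takes place, i.e. $q_1=0$ or $q_i=q_{i+1}$ for some $1\le i\le n-1$. $\partial M=\{(q,v)\in M \mid q\in\partial Q\}$, where the pre-collision phase point $(q,v^-)$ is identified with the post-collision phase point $(q,v^+)$. The billiard map $T:\partial M\to\partial M$ is the Poincaré section map of the flow, sending a phase point at a collision to the phase point at the next collision; it preserves the finite measure $\nu$ on $\partial M$ obtained by projecting $\mu$ along the flow onto $\partial M$. $\mathcal{S}_0\subset\partial M$ is the set of singular phase points, i.e. of those $(q,v)\in\partial M$ at which a multiple collision takes place: at least two of the equations $q_1=0$, $q_1=q_2$, $\dots$, $q_{n-1}=q_n$ hold. It is a (piecewise smooth) hypersurface of $\partial M$, defined purely in terms of the $q$ coordinates, and is equipped with its hypersurface measure. For $x_0=(q_0,v_0)\in\mathcal{S}_0$ the velocity is understood to be a post-collision (outgoing) velocity, so that the forward iterates $T^k$ of points of $\mathcal{S}_0$ near $x_0$ are determined by the motion following the singular collision; if $x_k\in\mathcal{S}_0$, it is regarded as the phase point on arrival at the multiple collision. Two hypersurfaces of $\partial M$ are transversal at a common point if their tangent spaces at that point together span the tangent space of $\partial M$. *)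

theory Defs
  imports "HOL-Analysis.Analysis"
begin

text \<open>
  The particles are indexed by an arbitrary finite linearly ordered type \<open>'n\<close>, lowest particle
  first, so that \<open>n = CARD('n)\<close>. A phase point is a pair \<open>(q, v)\<close> of positions and velocities,
  and \<open>m\<close> is always the vector of masses.
\<close>

type_synonym 'n phase = "(real^'n) \<times> (real^'n)"

definition lowest :: "'n::{finite,linorder} \<Rightarrow> bool" where
  "lowest i \<longleftrightarrow> (\<forall>j. i \<le> j)"

definition below :: "'n::{finite,linorder} \<Rightarrow> 'n" where
  "below i = Max {j. j < i}"

text \<open>
  The \<open>n\<close> collision equations \<open>q\<^sub>1 = 0\<close>, \<open>q\<^sub>1 = q\<^sub>2\<close>, \dots, \<open>q\<^bsub>n-1\<^esub> = q\<^sub>n\<close> are indexed by the upper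
  particle involved: equation \<open>i\<close> reads \<open>gap q i = 0\<close>.
\<close>

definition gap :: "real^'n::{finite,linorder} \<Rightarrow> 'n \<Rightarrow> real" where
  "gap q i = (if lowest i then q $ i else q $ i - q $ below i)"

definition config :: "(real^'n::{finite,linorder}) set" where
  "config = {q. (\<forall>i. 0 \<le> q $ i) \<and> (\<forall>i j. i \<le> j \<longrightarrow> q $ i \<le> q $ j)}"

definition config_boundary :: "(real^'n::{finite,linorder}) set" where
  "config_boundary = {q \<in> config. \<exists>i. gap q i = 0}"

definition energy :: "real^'n::finite \<Rightarrow> 'n phase \<Rightarrow> real" where
  "energy m x = (\<Sum>i\<in>UNIV. m $ i * fst x $ i + m $ i * (snd x $ i)\<^sup>2 / 2)"

definition phase_space :: "real^'n::{finite,linorder} \<Rightarrow> 'n phase set" where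
  "phase_space m = {x. fst x \<in> config \<and> energy m x = 1}"

definition free_flow :: "real \<Rightarrow> 'n::finite phase \<Rightarrow> 'n phase" where
  "free_flow t x = (\<chi> i. fst x $ i + t * snd x $ i - t\<^sup>2 / 2, \<chi> i. snd x $ i - t)"

text \<open>The elastic collision associated with equation \<open>i\<close>.\<close>

definition collision ::
    "real^'n::{finite,linorder} \<Rightarrow> 'n \<Rightarrow> real^'n::{finite,linorder} \<Rightarrow> real^'n::{finite,linorder}" where
  "collision m i v =
    (if lowest i then (\<chi> j. if j = i then - v $ i else v $ j)
     else let p = below i; \<gamma> = (m $ p - m $ i) / (m $ p + m $ i)
          in \<chi> j. if j = p then \<gamma> * v $ p + (1 - \<gamma>) * v $ i
                  else if j = i then (1 + \<gamma>) * v $ p - \<gamma> * v $ i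
                  else v $ j)"

definition face :: "real^'n::{finite,linorder} \<Rightarrow> 'n \<Rightarrow> 'n phase set" where
  "face m i = {x \<in> phase_space m. gap (fst x) i = 0}"

text \<open>
  The identification of pre- and post-collision phase points. It is imposed only where exactly one
  collision equation holds, since otherwise the outcome of the collision is not determined in
  general; a multiple collision leaves a phase point unidentified with any other.
\<close>

definition identified :: "real^'n::{finite,linorder} \<Rightarrow> 'n phase \<Rightarrow> 'n phase \<Rightarrow> bool" where
  "identified m x y \<longleftrightarrow> y = x \<or>
     (\<exists>i. {j. gap (fst x) j = 0} = {i} \<and> y = (fst x, collision m i (snd x)))"

text \<open>
  \<open>next_collision x y\<close>: the motion that leaves the collision point \<open>x\<close> with velocity \<open>snd x\<close> has its
  next collision on arrival at \<open>y\<close> (\<open>snd y\<close> being the velocity before that collision). There is no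
  such \<open>y\<close> unless \<open>snd x\<close> is strictly outgoing for every collision equation that holds at \<open>x\<close>.
\<close>

definition next_collision :: "'n::{finite,linorder} phase \<Rightarrow> 'n phase \<Rightarrow> bool" where
  "next_collision x y \<longleftrightarrow>
     (\<exists>t>0. y = free_flow t x \<and> fst y \<in> config_boundary \<and>
            (\<forall>s\<in>{0<..<t}. fst (free_flow s x) \<in> config - config_boundary))"

text \<open>
  The billiard map \<open>T\<close> as the graph of a partial map, its values being represented by arriving
  phase points. It is defined at singular phase points with outgoing velocity (the motion after the
  singular collision), but not at singular phase points on arrival; hence an orbit of \<open>T\<close> stops when
  it arrives at a multiple collision.
\<close>

definition billiard_map :: "real^'n::{finite,linorder} \<Rightarrow> 'n phase \<Rightarrow> 'n phase \<Rightarrow> bool" where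
  "billiard_map m x y \<longleftrightarrow>
     x \<in> (\<Union>i. face m i) \<and> (\<exists>x'. identified m x x' \<and> next_collision x' y)"

lemma next_collision_unique:
  assumes "next_collision x y" "next_collision x z"
  shows "y = z"
proof -
  obtain t where t: "t > 0" "y = free_flow t x" "fst y \<in> config_boundary"
    "\<And>s. s \<in> {0<..<t} \<Longrightarrow> fst (free_flow s x) \<in> config - config_boundary"
    using assms(1) unfolding next_collision_def by blast
  obtain u where u: "u > 0" "z = free_flow u x" "fst z \<in> config_boundary"
    "\<And>s. s \<in> {0<..<u} \<Longrightarrow> fst (free_flow s x) \<in> config - config_boundary"
    using assms(2) unfolding next_collision_def by blast
  have "\<not> t < u" "\<not> u < t" using t u by auto
  then show ?thesis using t u by simp
qed

lemma below_neq:
  assumes "\<not> lowest i" shows "below i \<noteq> i"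
proof -
  have "{j. j < i} \<noteq> {}" using assms unfolding lowest_def by (auto simp: not_le)
  then have "below i \<in> {j. j < i}" unfolding below_def by (intro Max_in) auto
  then show ?thesis by auto
qed

lemma gap_nonneg: "q \<in> config \<Longrightarrow> 0 \<le> gap q i"
proof (cases "lowest i")
  case False
  assume q: "q \<in> config"
  have "{j. j < i} \<noteq> {}" using False unfolding lowest_def by (auto simp: not_le)
  then have "below i \<in> {j. j < i}" unfolding below_def by (intro Max_in) auto
  then show ?thesis using q False unfolding gap_def config_def by auto
qed (auto simp: gap_def config_def)

lemma next_collision_outgoing:
  assumes "next_collision x y" "gap (fst x) i = 0"
  shows "gap (snd x) i > 0"
proof (rule ccontr)
  assume neg: "\<not> gap (snd x) i > 0"
  obtain t where t: "t > 0"
    "\<And>s. s \<in> {0<..<t} \<Longrightarrow> fst (free_flow s x) \<in> config - config_boundary"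
    using assms(1) unfolding next_collision_def by blast
  define s where "s = t / 2"
  have s: "s > 0" "fst (free_flow s x) \<in> config - config_boundary"
    using t by (auto simp: s_def)
  then have "gap (fst (free_flow s x)) i > 0"
    using gap_nonneg[of "fst (free_flow s x)" i] unfolding config_boundary_def
    by (auto simp: order_less_le)
  moreover have "gap (fst (free_flow s x)) i
      = gap (fst x) i + s * gap (snd x) i - (if lowest i then s\<^sup>2 / 2 else 0)"
    by (simp add: gap_def free_flow_def algebra_simps)
  moreover have "s * gap (snd x) i \<le> 0"
    using neg s by (simp add: mult_nonneg_nonpos)
  moreover have "0 \<le> (if lowest i then s\<^sup>2 / 2 else 0)" by simp
  ultimately show False using assms(2) by linarith
qed

lemma gap_collision: "gap (collision m i v) i = - gap v i"
  using below_neq[of i] by (auto simp: gap_def collision_def Let_def algebra_simps)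

lemma billiard_map_unique:
  assumes "billiard_map m x y" "billiard_map m x z"
  shows "y = z"
proof -
  obtain x1 x2 where h: "identified m x x1" "next_collision x1 y"
      "identified m x x2" "next_collision x2 z"
    using assms unfolding billiard_map_def by blast
  have no: False if "next_collision x u" "gap (fst x) i = 0"
      "next_collision (fst x, collision m i (snd x)) w" for u w i
    using next_collision_outgoing[OF that(1,2)] next_collision_outgoing[OF that(3), of i] that(2)
    by (simp add: gap_collision)
  have single: "gap (fst x) i = 0" if "{j. gap (fst x) j = 0} = {i}" for i
    using that by blast
  have "x1 = x2"
    using h(1) unfolding identified_def
  proof (elim disjE exE conjE)
    assume x1: "x1 = x"
    show ?thesis
      using h(3) unfolding identified_def
    proof (elim disjE exE conjE)
      fix i assume "{j. gap (fst x) j = 0} = {i}" "x2 = (fst x, collision m i (snd x))"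
      then show ?thesis using no[of y i z] single h x1 by simp
    qed (simp add: x1)
  next
    fix i assume i: "{j. gap (fst x) j = 0} = {i}" "x1 = (fst x, collision m i (snd x))"
    show ?thesis
      using h(3) unfolding identified_def
    proof (elim disjE exE conjE)
      assume "x2 = x"
      then show ?thesis using no[of z i y] single i h by simp
    next
      fix k assume "{j. gap (fst x) j = 0} = {k}" "x2 = (fst x, collision m k (snd x))"
      then show ?thesis using i by simp
    qed
  qed
  then show ?thesis using h next_collision_unique by blast
qed

definition billiard_image ::
    "real^'n::{finite,linorder} \<Rightarrow> nat \<Rightarrow> 'n phase set \<Rightarrow> 'n phase set" where
  "billiard_image m k A = {y. \<exists>x\<in>A. (billiard_map m ^^ k) x y}"

text \<open>
  The singular set is a union of smooth pieces, one for each pair of collision equations. Each of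
  them is a hypersurface in the two faces of \<open>\<partial>M\<close> that meet along it.
\<close>

definition singular_piece :: "real^'n::{finite,linorder} \<Rightarrow> 'n \<Rightarrow> 'n \<Rightarrow> 'n phase set" where
  "singular_piece m i j = face m i \<inter> face m j"

definition singular_set :: "real^'n::{finite,linorder} \<Rightarrow> 'n phase set" where
  "singular_set m = (\<Union>(i, j)\<in>{(i, j). i \<noteq> j}. singular_piece m i j)"

definition outgoing :: "'n::{finite,linorder} phase \<Rightarrow> bool" where
  "outgoing x \<longleftrightarrow> (\<forall>i. gap (fst x) i = 0 \<longrightarrow> 0 \<le> gap (snd x) i)"

text \<open>
  The \<open>d\<close>-dimensional Hausdorff (outer) measure, without normalising constant. On a piecewise smooth
  \<open>d\<close>-dimensional set it is a constant multiple of the surface measure.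
\<close>

definition hausdorff_measure :: "nat \<Rightarrow> 'a::metric_space set \<Rightarrow> ennreal" where
  "hausdorff_measure d A =
     (SUP \<delta>\<in>{0::real<..}.
        INF C\<in>{C :: nat \<Rightarrow> 'a set. A \<subseteq> (\<Union>k. C k) \<and> (\<forall>k. bounded (C k) \<and> diameter (C k) \<le> \<delta>)}.
          \<Sum>k. ennreal (diameter (C k) ^ d))"

text \<open>
  Tangent vectors are velocities of one-sided curves because the sets in question are
  submanifolds with boundary or corners; taking the span gives the full tangent space there.
\<close>

definition tangent_space :: "'a::real_normed_vector set \<Rightarrow> 'a \<Rightarrow> 'a set" where
  "tangent_space A x =
     span {w. \<exists>c. c 0 = x \<and> (\<forall>t\<in>{0..1}. c t \<in> A) \<and>
                  (c has_vector_derivative w) (at 0 within {0..1::real})}"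

definition transversal_at ::
    "'a::real_normed_vector set \<Rightarrow> 'a set \<Rightarrow> 'a set \<Rightarrow> 'a \<Rightarrow> bool" where
  "transversal_at N A B x \<longleftrightarrow> x \<in> A \<inter> B \<and>
     span (tangent_space A x \<union> tangent_space B x) = tangent_space N x"

text \<open>
  Transversality of \<open>T\<^sup>k(S\<^sub>0)\<close>, near the image \<open>y\<close> of \<open>x\<close>, and \<open>S\<^sub>0\<close> at \<open>y\<close>. Since \<open>y\<close> lies on several
  faces of \<open>\<partial>M\<close>, the condition is required in each of those faces, and for all smooth pieces of
  \<open>S\<^sub>0\<close> through \<open>x\<close> and through \<open>y\<close>. At almost every point of \<open>S\<^sub>0\<close> there is just one such piece.
\<close>

definition transversal_image ::
    "real^'n::{finite,linorder} \<Rightarrow> nat \<Rightarrow> 'n phase \<Rightarrow> 'n phase \<Rightarrow> bool" where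
  "transversal_image m k x y \<longleftrightarrow>
     (\<forall>a b i j. a \<noteq> b \<and> x \<in> singular_piece m a b \<and> i \<noteq> j \<and> y \<in> singular_piece m i j \<longrightarrow>
        transversal_at (face m i)
          (billiard_image m k (singular_piece m a b) \<inter> face m i) (singular_piece m i j) y)"

end

theory Submission
  imports Defs "HOL-Computational_Algebra.Polynomial"
begin

text \<open>
  For almost all masses the points of \<open>S\<^sub>0\<close> that return to \<open>S\<^sub>0\<close> form a null set of \<open>S\<^sub>0\<close>, so that
  transversality at the remaining returns holds vacuously.

  Extrapolate the motion freely back to time \<open>0\<close>. Then a collision of two particles acts by one and
  the same matrix on positions and velocities, and a collision with the floor is given by the root
  \<open>V\<close> of \<open>V\<^sup>2 = v\<^sub>1\<^sup>2 + 2 q\<^sub>1\<close>. For a fixed order of the collisions a return to \<open>S\<^sub>0\<close> is therefore an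
  algebraic equation, and elimination of the roots turns it into \<open>P(\<gamma>, x) = 0\<close> with a polynomial \<open>P\<close>
  in the collision coefficients and the initial point. It suffices that \<open>P\<close> does not vanish
  identically on the starting piece of \<open>S\<^sub>0\<close>, for then it vanishes on a null set of initial points,
  for almost all masses.

  Keep the masses of the particles above the first and let \<open>\<gamma>\<^sub>1\<close> tend to infinity (the first
  particle then has a negative mass). If \<open>P\<close> vanished on an open set, all of the starting
  piece would be mapped into the final one; as the motion is symplectic, the characteristic direction
  of the starting piece within the energy surface would have to be mapped to that of the final piece
  (focusing). But as \<open>\<gamma>\<^sub>1\<close> grows, every collision of the two lowest particles draws all phase points
  and tangent vectors towards one and the same direction, and this excludes focusing for every order
  of collisions that occurs for some positive masses.
\<close>

section \<open>Free-fall coordinates\<close>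

text \<open>One point with \<open>P\<close> nonzero serves twice. At that fixed point
  \<open>P\<close> is a rational function of the masses, hence nonzero for almost all of them; for
  each such choice of masses it is a nonzero polynomial in the phase point. Since these facts do not
  see signs, the point may be sought at a negative lowest mass, where the dynamics can be
  controlled, although no physical orbit exists there. The price is that eliminating a root
  multiplies over both of its signs. The witness must therefore keep all radicands positive and
  avoid a zero of the return equation for every choice of signs, not only for the physical one. In
  the limit a stage with \<open>r\<close> floor hits multiplies states and tangent vectors alike by
  \<open>1 + 2 r s - u\<close>, where \<open>s\<close> is a sign and \<open>u\<close> an entry of an
  upper isometry, and this factor is nonzero for both signs. The limit says nothing about a
  characteristic direction that the lowest pair never touches. Such a direction moves by isometries
  of the upper particles alone, and there focusing is excluded by comparison with an actual
  orbit.\<close>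

type_synonym 'n rvec = "(real, 'n) vec"

definition lo :: "'n::{finite,linorder}" where "lo = Min UNIV"

text \<open>The fallback value makes \<open>sec \<noteq> lo\<close> say that there are at least two
  particles.\<close>

definition sec :: "'n::{finite,linorder}" where
  "sec = (if UNIV = {lo :: 'n} then lo else Min (UNIV - {lo}))"

lemma lo_le [simp]: "lo \<le> (i::'n::{finite,linorder})"
  by (simp add: lo_def)

lemma lowest_iff: "lowest i \<longleftrightarrow> i = lo"
  unfolding lowest_def by (metis lo_le order_antisym)

lemma lo_less_iff: "lo < i \<longleftrightarrow> i \<noteq> (lo::'n::{finite,linorder})"
  by (metis lo_le order_le_imp_less_or_eq less_irrefl)

lemma below_less: "i \<noteq> lo \<Longrightarrow> below i < (i::'n::{finite,linorder})"
proof -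
  assume "i \<noteq> lo"
  then have "{j. j < i} \<noteq> {}" using lo_less_iff by auto
  then have "below i \<in> {j. j < i}" unfolding below_def by (intro Max_in) auto
  then show ?thesis by auto
qed

lemma less_imp_le_below: "j < i \<Longrightarrow> j \<le> below (i::'n::{finite,linorder})"
  unfolding below_def by (intro Max_ge) auto

lemma sec_le: "i \<noteq> lo \<Longrightarrow> sec \<le> (i::'n::{finite,linorder})"
  by (auto simp: sec_def)

lemma sec_neq_lo: "i \<noteq> (lo::'n::{finite,linorder}) \<Longrightarrow> (sec::'n) \<noteq> lo"
proof -
  assume i: "i \<noteq> (lo::'n)"
  then have "UNIV \<noteq> {lo :: 'n}" by blast
  moreover have "Min (UNIV - {lo::'n}) \<in> UNIV - {lo}" using i by (intro Min_in) auto
  ultimately show ?thesis by (auto simp: sec_def)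
qed

lemma below_sec: "(sec::'n::{finite,linorder}) \<noteq> lo \<Longrightarrow> below (sec::'n) = lo"
proof (rule ccontr)
  assume s: "(sec::'n) \<noteq> lo" and "below (sec::'n) \<noteq> lo"
  then show False using below_less[OF s] sec_le[of "below (sec::'n)"] by auto
qed

lemma sec_le_below: "sec < i \<Longrightarrow> sec \<le> below (i::'n::{finite,linorder})"
  by (rule less_imp_le_below)

text \<open>The coefficient is a free parameter rather than a quotient of masses: it becomes a
  polynomial variable, and it takes values above 1, which no positive masses realise.\<close>

definition bump :: "real \<Rightarrow> 'n::{finite,linorder} \<Rightarrow> 'n rvec \<Rightarrow> 'n rvec" where
  "bump g i v = (\<chi> j. if j = below i then g * v $ below i + (1 - g) * v $ i
                  else if j = i then (1 + g) * v $ below i - g * v $ i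
                  else v $ j)"

definition gam :: "'n::{finite,linorder} rvec \<Rightarrow> 'n \<Rightarrow> real" where
  "gam m i = (m $ below i - m $ i) / (m $ below i + m $ i)"

lemma collision_eq_bump: "i \<noteq> lo \<Longrightarrow> collision m i v = bump (gam m i) i v"
  by (simp add: collision_def lowest_iff bump_def gam_def Let_def)

lemma linear_bump: "linear (bump g i)"
  by (rule linearI) (auto simp: bump_def vec_eq_iff algebra_simps)

text \<open>The mass product. Masses of both signs occur, so it may be indefinite.\<close>

definition ip :: "'n rvec \<Rightarrow> 'n rvec \<Rightarrow> 'n::finite rvec \<Rightarrow> real" where
  "ip M x y = (\<Sum>k\<in>UNIV. M $ k * x $ k * y $ k)"

text \<open>Total momentum when applied to velocities, potential energy when applied to
  positions.\<close>

definition mom :: "'n rvec \<Rightarrow> 'n::finite rvec \<Rightarrow> real" where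
  "mom M x = (\<Sum>k\<in>UNIV. M $ k * x $ k)"

lemma sum_two:
  fixes h :: "'n::finite \<Rightarrow> real"
  assumes "a \<noteq> b"
  shows "(\<Sum>k\<in>UNIV. h k) = h a + h b + (\<Sum>k\<in>UNIV - {a,b}. h k)"
proof -
  have "(\<Sum>k\<in>UNIV. h k) = h a + (\<Sum>k\<in>UNIV - {a}. h k)" by (simp add: sum.remove)
  also have "(\<Sum>k\<in>UNIV - {a}. h k) = h b + (\<Sum>k\<in>UNIV - {a} - {b}. h k)"
    using assms by (subst sum.remove[of _ b]) auto
  also have "UNIV - {a} - {b} = UNIV - {a,b}" by auto
  finally show ?thesis by simp
qed

lemma bump_ip:
  assumes i: "i \<noteq> (lo::'n::{finite,linorder})" and M: "M $ below i + M $ i \<noteq> 0"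
  shows "ip M (bump (gam M i) i x) (bump (gam M i) i y) = ip M x y"
proof -
  have ne: "below i \<noteq> i" using below_less[OF i] by auto
  define g where "g = gam M i"
  define s where "s = M $ below i + M $ i"
  have s: "s \<noteq> 0" using M by (simp add: s_def)
  \<comment> \<open>Through the total mass and the coefficient both masses become polynomials, and
    the identity holds whatever their signs.\<close>
  have a: "M $ below i = s * (1 + g) / 2" and b: "M $ i = s * (1 - g) / 2"
    using M by (auto simp: s_def g_def gam_def field_simps)
  have "ip M (bump g i x) (bump g i y) = ip M x y"
    unfolding ip_def sum_two[OF ne]
    using ne by (simp add: bump_def a b) (simp add: field_simps)
  then show ?thesis by (simp add: g_def)
qed

lemma bump_mom:
  assumes i: "i \<noteq> (lo::'n::{finite,linorder})" and M: "M $ below i + M $ i \<noteq> 0"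
  shows "mom M (bump (gam M i) i x) = mom M x"
proof -
  have ne: "below i \<noteq> i" using below_less[OF i] by auto
  define g where "g = gam M i"
  define s where "s = M $ below i + M $ i"
  have s: "s \<noteq> 0" using M by (simp add: s_def)
  have a: "M $ below i = s * (1 + g) / 2" and b: "M $ i = s * (1 - g) / 2"
    using M by (auto simp: s_def g_def gam_def field_simps)
  have "mom M (bump g i x) = mom M x"
    unfolding mom_def sum_two[OF ne]
    using ne by (simp add: bump_def a b) (simp add: field_simps)
  then show ?thesis by (simp add: g_def)
qed

text \<open>The normal of the collision wall \<open>a\<close> in the mass product: pairing with it
  is the functional \<open>gap\<close> at \<open>a\<close> (\<open>ip_nv\<close>).\<close>

definition nv :: "'n rvec \<Rightarrow> 'n \<Rightarrow> 'n::{finite,linorder} rvec" where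
  "nv M a = (if a = lo then axis a (1 / M $ a) else axis a (1 / M $ a) - axis (below a) (1 / M $ below a))"

lemma gap_eq: "gap q i = (if i = lo then q $ i else q $ i - q $ below i)"
  by (simp add: gap_def lowest_iff)

lemma sum_axis: "(\<Sum>k\<in>UNIV. f k * axis a c $ k) = f a * (c::real)"
  by (simp add: axis_def if_distrib cong: if_cong)

lemma ip_axis: "ip M (axis a c) x = M $ a * c * x $ a"
proof -
  have "ip M (axis a c) x = (\<Sum>k\<in>UNIV. (M $ k * x $ k) * axis a c $ k)"
    by (simp add: ip_def mult_ac)
  then show ?thesis by (simp add: sum_axis)
qed

lemma ip_diff: "ip M (x - y) z = ip M x z - ip M y z"
  and ip_add: "ip M (x + y) z = ip M x z + ip M y z"
  and ip_scale: "ip M (c *\<^sub>R x) z = c * ip M x z"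
  and ip_diff_right: "ip M z (x - y) = ip M z x - ip M z y"
  and ip_add_right: "ip M z (x + y) = ip M z x + ip M z y"
  and ip_scale_right: "ip M z (c *\<^sub>R x) = c * ip M z x"
  by (simp_all add: ip_def algebra_simps sum.distrib sum_subtractf sum_distrib_left)

lemma ip_commute: "ip M x y = ip M y x"
  by (simp add: ip_def mult_ac)

lemma mom_diff: "mom M (x - y) = mom M x - mom M y"
  and mom_add: "mom M (x + y) = mom M x + mom M y"
  and mom_scale: "mom M (c *\<^sub>R x) = c * mom M x"
  by (simp_all add: mom_def algebra_simps sum.distrib sum_subtractf sum_distrib_left)

lemma mom_axis: "mom M (axis a c) = M $ a * c"
  by (simp add: mom_def sum_axis)

lemma ip_nv: "(\<And>k. M $ k \<noteq> 0) \<Longrightarrow> ip M (nv M a) x = gap x a"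
  by (simp add: nv_def gap_eq ip_diff ip_axis)

lemma mom_nv: "(\<And>k. M $ k \<noteq> 0) \<Longrightarrow> mom M (nv M a) = (if a = lo then 1 else 0)"
  by (simp add: nv_def mom_diff mom_axis)

lemma linear_gap: "linear (\<lambda>q. gap q i)"
  by (rule linearI) (auto simp: gap_eq algebra_simps)

text \<open>The effect of hitting the floor at time \<open>snd s $ lo + w\<close>, that is, with velocity \<open>- w\<close>, in
  positions and velocities extrapolated to time \<open>0\<close>. Hits in a row add up, since \<open>w\<^sup>2 = rad s\<close> is conserved.\<close>

definition kick :: "real \<Rightarrow> 'n::{finite,linorder} phase \<Rightarrow> 'n phase" where
  "kick w s = (fst s - axis lo (2 * w * (snd s $ lo + w)), snd s + axis lo (2 * w))"

definition rad :: "'n::{finite,linorder} phase \<Rightarrow> real" where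
  "rad s = (snd s $ lo)\<^sup>2 + 2 * fst s $ lo"

lemma rad_kick: "rad (kick w s) = rad s"
  by (simp add: rad_def kick_def power2_eq_square algebra_simps)

definition ups :: "'n rvec \<Rightarrow> 'n list \<Rightarrow> 'n::{finite,linorder} rvec \<Rightarrow> 'n rvec" where
  "ups g vs = fold (\<lambda>i. bump (g $ i) i) vs"

text \<open>A stage is what happens between two collisions of the two lowest particles: a number of hits of
  the floor and a list of collisions above \<open>sec\<close>. Only the order of the latter matters, because they
  commute with the former.\<close>

type_synonym 'n stage = "nat \<times> 'n list"

text \<open>The root \<open>V\<close> is an argument and may have either sign, because the
  elimination treats it as an unknown.\<close>

definition seg :: "'n rvec \<Rightarrow> 'n stage \<Rightarrow> real \<Rightarrow> 'n::{finite,linorder} phase \<Rightarrow> 'n phase" where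
  "seg g \<sigma> V s = map_prod (ups g (snd \<sigma>)) (ups g (snd \<sigma>)) (kick (real (fst \<sigma>) * V) s)"

definition bump2 :: "'n rvec \<Rightarrow> 'n::{finite,linorder} phase \<Rightarrow> 'n phase" where
  "bump2 g s = map_prod (bump (g $ sec) sec) (bump (g $ sec) sec) s"

text \<open>\<open>pre\<close> is the state after \<open>k\<close> collisions of the lowest pair,
  \<open>st\<close> the state after the stage that follows them. Roots and states are not yet tied
  to each other; \<open>tower\<close> does that.\<close>

primrec pre :: "'n rvec \<Rightarrow> (nat \<Rightarrow> 'n stage) \<Rightarrow> (nat \<Rightarrow> real) \<Rightarrow> 'n::{finite,linorder} phase \<Rightarrow> nat \<Rightarrow> 'n phase" where
  "pre g w V x 0 = x"
| "pre g w V x (Suc k) = bump2 g (seg g (w k) (V k) (pre g w V x k))"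

definition st :: "'n rvec \<Rightarrow> (nat \<Rightarrow> 'n stage) \<Rightarrow> (nat \<Rightarrow> real) \<Rightarrow> 'n::{finite,linorder} phase \<Rightarrow> nat \<Rightarrow> 'n phase" where
  "st g w V x k = seg g (w k) (V k) (pre g w V x k)"

lemma linear_ups: "linear (ups g vs)"
proof (induction vs)
  case Nil then show ?case by (simp add: ups_def linear_id[unfolded id_def])
next
  case (Cons i vs)
  have "ups g (i # vs) = ups g vs \<circ> bump (g $ i) i" by (simp add: ups_def fun_eq_iff)
  then show ?case using linear_compose[OF linear_bump Cons.IH, of "g $ i" i] by metis
qed

lemma ups_append: "ups g (vs @ us) x = ups g us (ups g vs x)"
  by (simp add: ups_def)

text \<open>A letter above \<open>sec\<close> moves \<open>i\<close> and \<open>below i\<close>, and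
  \<open>below i\<close> is still at least \<open>sec\<close>. This is why such collisions commute
  with hits of the floor.\<close>

lemma ups_lo:
  assumes "\<forall>i\<in>set vs. (sec::'n::{finite,linorder}) < i"
  shows "ups g vs x $ (lo::'n) = x $ lo"
  using assms
proof (induction vs arbitrary: x)
  case Nil then show ?case by (simp add: ups_def)
next
  case (Cons i vs)
  then have i: "sec < i" by simp
  have "i \<noteq> lo" using i by (metis lo_le not_le)
  moreover have "below i \<noteq> lo"
    using sec_le_below[OF i] sec_neq_lo[OF \<open>i \<noteq> lo\<close>] by (metis lo_le order_antisym)
  ultimately have "bump (g $ i) i x $ lo = x $ lo" by (simp add: bump_def)
  then show ?case using Cons by (simp add: ups_def)
qed

lemma ups_axis_lo:
  assumes "\<forall>i\<in>set vs. (sec::'n::{finite,linorder}) < i"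
  shows "ups g vs (axis (lo::'n) c) = axis lo c"
  using assms
proof (induction vs)
  case Nil then show ?case by (simp add: ups_def)
next
  case (Cons i vs)
  then have i: "sec < i" by simp
  have "i \<noteq> lo" using i by (metis lo_le not_le)
  moreover have "below i \<noteq> lo"
    using sec_le_below[OF i] sec_neq_lo[OF \<open>i \<noteq> lo\<close>] by (metis lo_le order_antisym)
  ultimately have "bump (g $ i) i (axis lo c) = axis lo c"
    by (auto simp: bump_def axis_def vec_eq_iff)
  then show ?case using Cons by (simp add: ups_def)
qed

lemma ups_ip:
  assumes "\<forall>i\<in>set vs. (sec::'n::{finite,linorder}) < i" "\<And>i. i > sec \<Longrightarrow> M $ below i + M $ i \<noteq> 0"
    "\<And>i. i > sec \<Longrightarrow> g $ i = gam M i"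
  shows "ip M (ups g vs x) (ups g vs y) = ip M x y" "mom M (ups g vs x) = mom M x"
proof -
  have *: "ip M (ups g vs x) (ups g vs y) = ip M x y \<and> mom M (ups g vs x) = mom M x"
    using assms(1)
  proof (induction vs arbitrary: x y)
    case Nil then show ?case by (simp add: ups_def)
  next
    case (Cons i vs)
    then have i: "sec < i" by simp
    have "i \<noteq> lo" using i by (metis lo_le not_le)
    then show ?case using Cons bump_ip[of i M x y] bump_mom[of i M x] assms(2,3)[OF i]
      by (simp add: ups_def)
  qed
  show "ip M (ups g vs x) (ups g vs y) = ip M x y" "mom M (ups g vs x) = mom M x" using * by auto
qed

lemma ups_cong:
  assumes "\<forall>i\<in>set vs. g $ i = h $ i"
  shows "ups g vs x = ups h vs x"
  using assms by (induction vs arbitrary: x) (simp_all add: ups_def)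

section \<open>Elimination of the square roots\<close>

text \<open>The arguments are the collision coefficients, the initial phase point and the square roots.\<close>

type_synonym 'n pfun = "'n rvec \<Rightarrow> 'n phase \<Rightarrow> (nat \<Rightarrow> real) \<Rightarrow> real"

inductive_set pol :: "nat \<Rightarrow> 'n::{finite,linorder} pfun set" for l where
  const: "(\<lambda>g x V. c) \<in> pol l"
| coef: "(\<lambda>g x V. g $ i) \<in> pol l"
| pos: "(\<lambda>g x V. fst x $ i) \<in> pol l"
| vel: "(\<lambda>g x V. snd x $ i) \<in> pol l"
| root: "k < l \<Longrightarrow> (\<lambda>g x V. V k) \<in> pol l"
| add: "f \<in> pol l \<Longrightarrow> h \<in> pol l \<Longrightarrow> (\<lambda>g x V. f g x V + h g x V) \<in> pol l"
| mult: "f \<in> pol l \<Longrightarrow> h \<in> pol l \<Longrightarrow> (\<lambda>g x V. f g x V * h g x V) \<in> pol l"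

lemma pol_mono: "f \<in> pol l \<Longrightarrow> l \<le> l' \<Longrightarrow> f \<in> pol l'"
  by (induction rule: pol.induct) (auto intro: pol.intros)

lemma pol_uminus: "f \<in> pol l \<Longrightarrow> (\<lambda>g x V. - f g x V) \<in> pol l"
  using pol.mult[OF pol.const[of "-1"], of f l] by simp

lemma pol_diff: "f \<in> pol l \<Longrightarrow> h \<in> pol l \<Longrightarrow> (\<lambda>g x V. f g x V - h g x V) \<in> pol l"
  using pol.add[OF _ pol_uminus, of f l h] by simp

lemma pol_power2: "f \<in> pol l \<Longrightarrow> (\<lambda>g x V. (f g x V)\<^sup>2) \<in> pol l"
  using pol.mult[of f l f] by (simp add: power2_eq_square)

lemmas pol_intros = pol.const pol.coef pol.pos pol.vel pol.root pol.add pol.mult pol_uminus pol_diff pol_power2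

lemma pol_cong_roots:
  "f \<in> pol l \<Longrightarrow> (\<And>k. k < l \<Longrightarrow> V k = V' k) \<Longrightarrow> f g x V = f g x V'"
  by (induction rule: pol.induct) auto

text \<open>Division with remainder by the quadratic equation of the last root: its square is
  replaced by \<open>R\<close>.\<close>

lemma pol_reduce:
  assumes "f \<in> pol (Suc l)" and R: "R \<in> pol l"
  shows "\<exists>a\<in>pol l. \<exists>b\<in>pol l. \<forall>g x V. (V l)\<^sup>2 = R g x V \<longrightarrow> f g x V = a g x V + b g x V * V l"
  using assms(1)
proof (induction rule: pol.induct)
  case (const c)
  show ?case
    by (rule bexI[OF _ pol.const[of c]], rule bexI[OF _ pol.const[of 0]]) simp
next
  case (coef i)
  show ?case
    by (rule bexI[OF _ pol.coef[of i]], rule bexI[OF _ pol.const[of 0]]) simp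
next
  case (pos i)
  show ?case
    by (rule bexI[OF _ pol.pos[of i]], rule bexI[OF _ pol.const[of 0]]) simp
next
  case (vel i)
  show ?case
    by (rule bexI[OF _ pol.vel[of i]], rule bexI[OF _ pol.const[of 0]]) simp
next
  case (root k)
  show ?case
  proof (cases "k = l")
    case True
    then show ?thesis
      by (intro bexI[OF _ pol.const[of 0]] bexI[OF _ pol.const[of 1]]) simp
  next
    case False
    then have k: "k < l" using root by simp
    show ?thesis
      by (rule bexI[OF _ pol.root[OF k]], rule bexI[OF _ pol.const[of 0]]) simp
  qed
next
  case (add f h)
  then obtain a b a' b' where m: "a \<in> pol l" "b \<in> pol l" "a' \<in> pol l" "b' \<in> pol l"
    and e: "\<forall>g x V. (V l)\<^sup>2 = R g x V \<longrightarrow> f g x V = a g x V + b g x V * V l"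
      "\<forall>g x V. (V l)\<^sup>2 = R g x V \<longrightarrow> h g x V = a' g x V + b' g x V * V l"
    by blast
  show ?case
    by (rule bexI[OF _ pol.add[OF m(1,3)]], rule bexI[OF _ pol.add[OF m(2,4)]])
      (use e in \<open>simp add: algebra_simps\<close>)
next
  case (mult f h)
  then obtain a b a' b' where m: "a \<in> pol l" "b \<in> pol l" "a' \<in> pol l" "b' \<in> pol l"
    and e: "\<forall>g x V. (V l)\<^sup>2 = R g x V \<longrightarrow> f g x V = a g x V + b g x V * V l"
      "\<forall>g x V. (V l)\<^sup>2 = R g x V \<longrightarrow> h g x V = a' g x V + b' g x V * V l"
    by blast
  have "(a g x V + b g x V * V l) * (a' g x V + b' g x V * V l)
      = a g x V * a' g x V + R g x V * (b g x V * b' g x V)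
        + (a g x V * b' g x V + b g x V * a' g x V) * V l"
    if "(V l)\<^sup>2 = R g x V" for g x V
    unfolding that[symmetric] by (simp add: power2_eq_square algebra_simps)
  with e show ?case
    by (intro bexI[OF _ pol.add[OF pol.mult[OF m(1,3)] pol.mult[OF R pol.mult[OF m(2,4)]]]]
        bexI[OF _ pol.add[OF pol.mult[OF m(1,4)] pol.mult[OF m(2,3)]]]) simp
qed

text \<open>Norm trick: a root \<open>V\<close> with \<open>V\<^sup>2 = R\<close> is eliminated from \<open>a + b V\<close> by passing to \<open>a\<^sup>2 - b\<^sup>2 R\<close>,
  the product over both choices of sign.\<close>

lemma pol_eliminate:
  assumes R: "\<And>k. R k \<in> pol k" and "f \<in> pol l" "l0 \<le> l"
  shows "\<exists>P\<in>pol l0.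
    (\<forall>g x V. (\<forall>k. l0 \<le> k \<and> k < l \<longrightarrow> (V k)\<^sup>2 = R k g x V) \<and> f g x V = 0 \<longrightarrow> P g x V = 0) \<and>
    (\<forall>g x V.
      (\<forall>V' n. l0 \<le> n \<and> n < l \<and> (\<forall>k<l0. V' k = V k) \<and> (\<forall>k. l0 \<le> k \<and> k < n \<longrightarrow> (V' k)\<^sup>2 = R k g x V')
         \<longrightarrow> 0 < R n g x V') \<and>
      (\<forall>V'. (\<forall>k<l0. V' k = V k) \<and> (\<forall>k. l0 \<le> k \<and> k < l \<longrightarrow> (V' k)\<^sup>2 = R k g x V') \<longrightarrow> f g x V' \<noteq> 0)
      \<longrightarrow> P g x V \<noteq> 0)"
  using assms(2,3)
proof (induction "l - l0" arbitrary: f l)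
  case 0
  then have [simp]: "l = l0" by simp
  show ?case using 0 by (intro bexI[of _ f]) auto
next
  case (Suc d)
  then obtain l' where l: "l = Suc l'" "l0 \<le> l'" by (cases l) auto
  obtain a b where ab: "a \<in> pol l'" "b \<in> pol l'"
    and fab: "\<And>g x V. (V l')\<^sup>2 = R l' g x V \<Longrightarrow> f g x V = a g x V + b g x V * V l'"
    using pol_reduce[OF Suc.prems(1)[unfolded l] R] by blast
  define h where "h = (\<lambda>g x V. (a g x V)\<^sup>2 - (b g x V)\<^sup>2 * R l' g x V)"
  have h: "h \<in> pol l'" unfolding h_def by (intro pol_intros ab R)
  have "d = l' - l0" using Suc.hyps(2) l by simp
  from Suc.hyps(1)[OF this h l(2)] obtain P where P: "P \<in> pol l0"
    and P1: "\<forall>g x V. (\<forall>k. l0 \<le> k \<and> k < l' \<longrightarrow> (V k)\<^sup>2 = R k g x V) \<and> h g x V = 0 \<longrightarrow> P g x V = 0"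
    and P2: "\<forall>g x V.
      (\<forall>V' n. l0 \<le> n \<and> n < l' \<and> (\<forall>k<l0. V' k = V k) \<and> (\<forall>k. l0 \<le> k \<and> k < n \<longrightarrow> (V' k)\<^sup>2 = R k g x V')
         \<longrightarrow> 0 < R n g x V') \<and>
      (\<forall>V'. (\<forall>k<l0. V' k = V k) \<and> (\<forall>k. l0 \<le> k \<and> k < l' \<longrightarrow> (V' k)\<^sup>2 = R k g x V') \<longrightarrow> h g x V' \<noteq> 0)
      \<longrightarrow> P g x V \<noteq> 0"
    by (elim bexE conjE) (rule that)
  show ?case
  proof (intro bexI[OF _ P] conjI allI impI; elim conjE)
    fix g x V
    assume V: "\<forall>k. l0 \<le> k \<and> k < l \<longrightarrow> (V k)\<^sup>2 = R k g x V" and f0: "f g x V = 0"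
    have Vl: "(V l')\<^sup>2 = R l' g x V" using V l by simp
    have "a g x V = - (b g x V * V l')" using fab[OF Vl] f0 by simp
    then have "h g x V = 0" by (simp add: h_def power_mult_distrib Vl)
    then show "P g x V = 0" using V l by (intro P1[rule_format]) auto
  next
    fix g x V
    assume pos: "\<forall>V' n. l0 \<le> n \<and> n < l \<and> (\<forall>k<l0. V' k = V k) \<and>
        (\<forall>k. l0 \<le> k \<and> k < n \<longrightarrow> (V' k)\<^sup>2 = R k g x V') \<longrightarrow> 0 < R n g x V'"
      and f: "\<forall>V'. (\<forall>k<l0. V' k = V k) \<and> (\<forall>k. l0 \<le> k \<and> k < l \<longrightarrow> (V' k)\<^sup>2 = R k g x V') \<longrightarrow> f g x V' \<noteq> 0"
    show "P g x V \<noteq> 0"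
    proof (rule P2[rule_format], intro conjI allI impI; elim conjE)
      fix V' n assume "l0 \<le> n" "n < l'" "\<forall>k<l0. V' k = V k" "\<forall>k. l0 \<le> k \<and> k < n \<longrightarrow> (V' k)\<^sup>2 = R k g x V'"
      then show "0 < R n g x V'" using pos l by simp
    next
      fix V' assume V': "\<forall>k<l0. V' k = V k" "\<forall>k. l0 \<le> k \<and> k < l' \<longrightarrow> (V' k)\<^sup>2 = R k g x V'"
      have Rp: "0 < R l' g x V'" using pos V' l by simp
      \<comment> \<open>\<open>U 1\<close> and \<open>U (-1)\<close> are the two continuations of
        the tower \<open>V'\<close>; the positive radicand makes both of them real, so the
        hypothesis on \<open>f\<close> covers both factors of the norm.\<close>
      define U where "U = (\<lambda>s::real. V'(l' := s * sqrt (R l' g x V')))"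
      have same: "u g x (U s) = u g x V'" if "u \<in> pol n" "n \<le> l'" for u n s
        using pol_cong_roots[OF that(1), of "U s" V'] that(2) by (auto simp: U_def)
      have fU: "f g x (U s) = a g x V' + b g x V' * (s * sqrt (R l' g x V'))" "f g x (U s) \<noteq> 0"
        if "s\<^sup>2 = 1" for s
      proof -
        have e: "(U s l')\<^sup>2 = R l' g x V'" using Rp that by (simp add: U_def power_mult_distrib)
        then show "f g x (U s) = a g x V' + b g x V' * (s * sqrt (R l' g x V'))"
          using fab[of "U s" g x] same[OF R] same[OF ab(1)] same[OF ab(2)] by (simp add: U_def)
        have "(U s k)\<^sup>2 = R k g x (U s)" if "l0 \<le> k" "k < l" for k
        proof (cases "k = l'")
          case True then show ?thesis using e same[OF R, of l' s] by simp
        next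
          case False
          then have "k < l'" using that l by simp
          then show ?thesis using V'(2) that same[OF R, of k s] by (simp add: U_def)
        qed
        moreover have "\<forall>k<l0. U s k = V k" using V'(1) l by (simp add: U_def)
        ultimately show "f g x (U s) \<noteq> 0" using f by blast
      qed
      have "h g x V' = f g x (U 1) * f g x (U (-1))"
        using Rp by (simp add: fU(1) h_def algebra_simps power2_eq_square)
      then show "h g x V' \<noteq> 0" using fU(2)[of 1] fU(2)[of "-1"] by simp
    qed
  qed
qed

lemma pol_bump:
  assumes "\<And>j. (\<lambda>g x V. v g x V $ j) \<in> pol l"
  shows "(\<lambda>g x V. bump (g $ i) i (v g x V) $ j) \<in> pol l"
proof -
  have "(\<lambda>g x V. bump (g $ i) i (v g x V) $ j) =
     (if j = below i then (\<lambda>g x V. g $ i * v g x V $ below i + (1 - g $ i) * v g x V $ i)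
      else if j = i then (\<lambda>g x V. (1 + g $ i) * v g x V $ below i - g $ i * v g x V $ i)
      else (\<lambda>g x V. v g x V $ j))"
    by (auto simp: bump_def)
  also have "\<dots> \<in> pol l"
    using assms by (auto intro!: pol_intros)
  finally show ?thesis .
qed

lemma pol_ups:
  assumes "\<And>j. (\<lambda>g x V. v g x V $ j) \<in> pol l"
  shows "(\<lambda>g x V. ups g vs (v g x V) $ j) \<in> pol l"
  using assms
proof (induction vs arbitrary: v)
  case Nil then show ?case by (simp add: ups_def)
next
  case (Cons i vs)
  have "(\<lambda>g x V. ups g vs (bump (g $ i) i (v g x V)) $ j) \<in> pol l"
    by (rule Cons.IH) (rule pol_bump[OF Cons.prems])
  then show ?case by (simp add: ups_def)
qed

lemma pol_axis:
  assumes "f \<in> pol l" shows "(\<lambda>g x V. axis i (f g x V) $ j) \<in> pol l"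
proof -
  have "(\<lambda>g x V. axis i (f g x V) $ j) = (if j = i then f else (\<lambda>g x V. 0))" by (auto simp: axis_def)
  then show ?thesis using assms by (auto intro: pol_intros)
qed

lemma pol_seg:
  assumes s: "\<And>j. (\<lambda>g x V. fst (s g x V) $ j) \<in> pol l" "\<And>j. (\<lambda>g x V. snd (s g x V) $ j) \<in> pol l"
    and W: "W \<in> pol l"
  shows "(\<lambda>g x V. fst (seg g \<sigma> (W g x V) (s g x V)) $ j) \<in> pol l"
    "(\<lambda>g x V. snd (seg g \<sigma> (W g x V) (s g x V)) $ j) \<in> pol l"
proof -
  have k: "(\<lambda>g x V. fst (kick (real (fst \<sigma>) * W g x V) (s g x V)) $ j) \<in> pol l"
    "(\<lambda>g x V. snd (kick (real (fst \<sigma>) * W g x V) (s g x V)) $ j) \<in> pol l" for j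
    unfolding kick_def fst_conv snd_conv vector_minus_component vector_add_component
    by (intro pol_intros pol_axis s W)+
  show "(\<lambda>g x V. fst (seg g \<sigma> (W g x V) (s g x V)) $ j) \<in> pol l"
    "(\<lambda>g x V. snd (seg g \<sigma> (W g x V) (s g x V)) $ j) \<in> pol l"
    unfolding seg_def fst_map_prod snd_map_prod by (intro pol_ups k)+
qed

lemma pol_pre:
  "(\<lambda>g x V. fst (pre g w V x k) $ j) \<in> pol k \<and> (\<lambda>g x V. snd (pre g w V x k) $ j) \<in> pol k"
proof (induction k arbitrary: j)
  case 0 then show ?case by (simp add: pol_intros)
next
  case (Suc k)
  have s: "(\<lambda>g x V. fst (pre g w V x k) $ j) \<in> pol (Suc k)" "(\<lambda>g x V. snd (pre g w V x k) $ j) \<in> pol (Suc k)" for j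
    using Suc pol_mono[of _ k "Suc k"] by auto
  have V: "(\<lambda>g x V. V k) \<in> pol (Suc k)" by (rule pol.root) simp
  show ?case
    unfolding pre.simps bump2_def fst_map_prod snd_map_prod
    by (intro conjI pol_bump pol_seg s V)
qed

lemma pol_rad: "(\<lambda>g x V. rad (pre g w V x k)) \<in> pol k"
  unfolding rad_def using pol_pre by (intro pol_intros) auto

lemma pol_st:
  "(\<lambda>g x V. fst (st g w V x k) $ j) \<in> pol (Suc k)" "(\<lambda>g x V. snd (st g w V x k) $ j) \<in> pol (Suc k)"
proof -
  have s: "(\<lambda>g x V. fst (pre g w V x k) $ j) \<in> pol (Suc k)" "(\<lambda>g x V. snd (pre g w V x k) $ j) \<in> pol (Suc k)" for j
    using pol_pre pol_mono[of _ k "Suc k"] by auto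
  have V: "(\<lambda>g x V. V k) \<in> pol (Suc k)" by (rule pol.root) simp
  show "(\<lambda>g x V. fst (st g w V x k) $ j) \<in> pol (Suc k)" "(\<lambda>g x V. snd (st g w V x k) $ j) \<in> pol (Suc k)"
    unfolding st_def by (intro pol_seg s V)+
qed

text \<open>For \<open>i = lo\<close> the final time is that of the arrival at the floor; otherwise it is eliminated
  from the two gap equations.\<close>

definition fin :: "'n \<Rightarrow> 'n \<Rightarrow> real \<Rightarrow> 'n::{finite,linorder} phase \<Rightarrow> real" where
  "fin i j V s = (if i = lo then gap (fst s) j + (snd s $ lo + V) * gap (snd s) j
     else gap (snd s) i * gap (fst s) j - gap (snd s) j * gap (fst s) i)"

lemma pol_gap:
  assumes "\<And>j. (\<lambda>g x V. v g x V $ j) \<in> pol l"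
  shows "(\<lambda>g x V. gap (v g x V) i) \<in> pol l"
proof -
  have "(\<lambda>g x V. gap (v g x V) i) = (if i = lo then (\<lambda>g x V. v g x V $ i)
     else (\<lambda>g x V. v g x V $ i - v g x V $ below i))"
    by (auto simp: gap_eq)
  then show ?thesis using assms by (auto intro: pol_intros)
qed

lemma pol_fin: "(\<lambda>g x V. fin i j (V c) (st g w V x c)) \<in> pol (Suc c)"
proof -
  have "(\<lambda>g x V. fin i j (V c) (st g w V x c)) =
    (if i = lo then (\<lambda>g x V. gap (fst (st g w V x c)) j + (snd (st g w V x c) $ lo + V c) * gap (snd (st g w V x c)) j)
     else (\<lambda>g x V. gap (snd (st g w V x c)) i * gap (fst (st g w V x c)) j
           - gap (snd (st g w V x c)) j * gap (fst (st g w V x c)) i))"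
    by (auto simp: fin_def)
  then show ?thesis by (auto intro!: pol_intros pol_gap pol_st)
qed

text \<open>For a start on the floor \<open>rad x\<close> is the square of
  \<open>snd x $ lo\<close>. The opposite root would count the start itself, at time 0, as an
  arrival at the floor, and with it \<open>fin\<close> could vanish on the whole starting piece;
  hence the sign of the first root is fixed.\<close>

definition tower :: "bool \<Rightarrow> 'n rvec \<Rightarrow> (nat \<Rightarrow> 'n stage) \<Rightarrow> (nat \<Rightarrow> real) \<Rightarrow> 'n::{finite,linorder} phase \<Rightarrow> nat \<Rightarrow> bool" where
  "tower onfl g w V x n \<longleftrightarrow> (\<forall>k<n. (V k)\<^sup>2 = rad (pre g w V x k)) \<and> (onfl \<longrightarrow> 0 < n \<longrightarrow> V 0 = snd x $ lo)"

text \<open>For a start on the floor the first root is kept during the elimination and then replaced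
  by the initial velocity, instead of being multiplied with its conjugate.\<close>

lemma final_polynomial:
  "\<exists>P\<in>pol 0.
    (\<forall>g x V. tower onfl g w V x (Suc c) \<and> fin i j (V c) (st g w V x c) = 0 \<longrightarrow> P g x (\<lambda>_. 0) = 0) \<and>
    (\<forall>g x. (onfl \<longrightarrow> fst x $ lo = 0) \<and>
       (\<forall>V n. n \<le> c \<and> tower onfl g w V x n \<longrightarrow> 0 < rad (pre g w V x n)) \<and>
       (\<forall>V. tower onfl g w V x (Suc c) \<longrightarrow> fin i j (V c) (st g w V x c) \<noteq> 0)
      \<longrightarrow> P g x (\<lambda>_. 0) \<noteq> 0)"
proof (cases onfl)
  case False
  from pol_eliminate[OF pol_rad[of w] pol_fin[of i j c w], of 0, OF le0] obtain P where P: "P \<in> pol 0"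
    and P1: "\<forall>g x V. (\<forall>k. 0 \<le> k \<and> k < Suc c \<longrightarrow> (V k)\<^sup>2 = rad (pre g w V x k)) \<and>
      fin i j (V c) (st g w V x c) = 0 \<longrightarrow> P g x V = 0"
    and P2: "\<forall>g x V. (\<forall>V' n. 0 \<le> n \<and> n < Suc c \<and> (\<forall>k<0. V' k = V k) \<and>
          (\<forall>k. 0 \<le> k \<and> k < n \<longrightarrow> (V' k)\<^sup>2 = rad (pre g w V' x k)) \<longrightarrow> 0 < rad (pre g w V' x n)) \<and>
      (\<forall>V'. (\<forall>k<0. V' k = V k) \<and> (\<forall>k. 0 \<le> k \<and> k < Suc c \<longrightarrow> (V' k)\<^sup>2 = rad (pre g w V' x k)) \<longrightarrow>
          fin i j (V' c) (st g w V' x c) \<noteq> 0) \<longrightarrow> P g x V \<noteq> 0"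
    by (elim bexE conjE) (rule that)
  have any: "P g x V = P g x (\<lambda>_. 0)" for g x V by (rule pol_cong_roots[OF P]) simp
  show ?thesis
  proof (intro bexI[OF _ P] conjI allI impI; elim conjE)
    fix g x V assume "tower onfl g w V x (Suc c)" "fin i j (V c) (st g w V x c) = 0"
    then have "P g x V = 0" by (intro P1[rule_format]) (auto simp: tower_def)
    then show "P g x (\<lambda>_. 0) = 0" using any by metis
  next
    fix g x
    assume "\<forall>V n. n \<le> c \<and> tower onfl g w V x n \<longrightarrow> 0 < rad (pre g w V x n)"
      "\<forall>V. tower onfl g w V x (Suc c) \<longrightarrow> fin i j (V c) (st g w V x c) \<noteq> 0"
    then show "P g x (\<lambda>_. 0) \<noteq> 0"
      using False by (intro P2[rule_format]) (auto simp: tower_def less_Suc_eq_le)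
  qed
next
  case True
  from pol_eliminate[OF pol_rad[of w] pol_fin[of i j c w], of 1, OF Suc_leI[OF zero_less_Suc, folded One_nat_def]] obtain P where P: "P \<in> pol 1"
    and P1: "\<forall>g x V. (\<forall>k. 1 \<le> k \<and> k < Suc c \<longrightarrow> (V k)\<^sup>2 = rad (pre g w V x k)) \<and>
      fin i j (V c) (st g w V x c) = 0 \<longrightarrow> P g x V = 0"
    and P2: "\<forall>g x V. (\<forall>V' n. 1 \<le> n \<and> n < Suc c \<and> (\<forall>k<1. V' k = V k) \<and>
          (\<forall>k. 1 \<le> k \<and> k < n \<longrightarrow> (V' k)\<^sup>2 = rad (pre g w V' x k)) \<longrightarrow> 0 < rad (pre g w V' x n)) \<and>
      (\<forall>V'. (\<forall>k<1. V' k = V k) \<and> (\<forall>k. 1 \<le> k \<and> k < Suc c \<longrightarrow> (V' k)\<^sup>2 = rad (pre g w V' x k)) \<longrightarrow>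
          fin i j (V' c) (st g w V' x c) \<noteq> 0) \<longrightarrow> P g x V \<noteq> 0"
    by (elim bexE conjE) (rule that)
  obtain a b where ab: "a \<in> pol 0" "b \<in> pol 0"
    and Pab: "\<And>g x V. (V 0)\<^sup>2 = rad x \<Longrightarrow> P g x V = a g x V + b g x V * V 0"
    using pol_reduce[OF P[unfolded One_nat_def] pol_rad[of w 0]] by auto
  \<comment> \<open>The remainder of \<open>P\<close> modulo the equation of the first root, with
    that root replaced by its known value.\<close>
  define Q where "Q = (\<lambda>g x (V::nat \<Rightarrow> real). a g x V + b g x V * (snd x $ lo))"
  have Q: "Q \<in> pol 0" unfolding Q_def by (intro pol_intros ab)
  have any: "Q g x V = Q g x (\<lambda>_. 0)" for g x V by (rule pol_cong_roots[OF Q]) simp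
  have PQ: "P g x V = Q g x (\<lambda>_. 0)" if "V 0 = snd x $ lo" "(V 0)\<^sup>2 = rad x" for g x V
    using Pab[of V x g, OF that(2)] that(1) any[of g x V] by (simp add: Q_def)
  show ?thesis
  proof (intro bexI[OF _ Q] conjI allI impI; elim conjE)
    fix g x V assume t: "tower onfl g w V x (Suc c)" and f: "fin i j (V c) (st g w V x c) = 0"
    have "V 0 = snd x $ lo" using t True by (simp add: tower_def)
    moreover have "(V 0)\<^sup>2 = rad x" using t by (auto simp: tower_def dest: spec[of _ 0])
    moreover have "P g x V = 0" using t f by (intro P1[rule_format]) (simp add: tower_def)
    ultimately show "Q g x (\<lambda>_. 0) = 0" using PQ by metis
  next
    fix g x
    assume z: "onfl \<longrightarrow> fst x $ lo = 0"
      and pos: "\<forall>V n. n \<le> c \<and> tower onfl g w V x n \<longrightarrow> 0 < rad (pre g w V x n)"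
      and f: "\<forall>V. tower onfl g w V x (Suc c) \<longrightarrow> fin i j (V c) (st g w V x c) \<noteq> 0"
    define V where "V = (\<lambda>k::nat. snd x $ lo)"
    have r: "(snd x $ lo)\<^sup>2 = rad x" using z True by (simp add: rad_def)
    have tw: "tower onfl g w V' x n \<longleftrightarrow> (\<forall>k. 1 \<le> k \<and> k < n \<longrightarrow> (V' k)\<^sup>2 = rad (pre g w V' x k))"
      if "V' 0 = snd x $ lo" for V' n
      unfolding tower_def using that r by (metis One_nat_def Suc_leI gr0I pre.simps(1))
    have "P g x V \<noteq> 0"
      using pos f tw by (intro P2[rule_format]) (auto simp: V_def less_Suc_eq_le)
    then show "Q g x (\<lambda>_. 0) \<noteq> 0" using PQ[of V x g] r by (simp add: V_def)
  qed
qed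

section \<open>Tangent maps and focusing\<close>

text \<open>The runs \<open>pre\<close>, \<open>st\<close> with the roots chosen by the signs \<open>\<epsilon>\<close>; below, \<open>dpre\<close> and \<open>dst\<close> are their
  derivatives in the initial point.\<close>

primrec bpre :: "'n rvec \<Rightarrow> (nat \<Rightarrow> 'n stage) \<Rightarrow> (nat \<Rightarrow> real) \<Rightarrow> 'n::{finite,linorder} phase \<Rightarrow> nat \<Rightarrow> 'n phase" where
  "bpre g w \<epsilon> x 0 = x"
| "bpre g w \<epsilon> x (Suc k) = bump2 g (seg g (w k) (\<epsilon> k * sqrt (rad (bpre g w \<epsilon> x k))) (bpre g w \<epsilon> x k))"

definition broot :: "'n rvec \<Rightarrow> (nat \<Rightarrow> 'n stage) \<Rightarrow> (nat \<Rightarrow> real) \<Rightarrow> 'n::{finite,linorder} phase \<Rightarrow> nat \<Rightarrow> real" where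
  "broot g w \<epsilon> x k = \<epsilon> k * sqrt (rad (bpre g w \<epsilon> x k))"

definition bst :: "'n rvec \<Rightarrow> (nat \<Rightarrow> 'n stage) \<Rightarrow> (nat \<Rightarrow> real) \<Rightarrow> 'n::{finite,linorder} phase \<Rightarrow> nat \<Rightarrow> 'n phase" where
  "bst g w \<epsilon> x k = seg g (w k) (broot g w \<epsilon> x k) (bpre g w \<epsilon> x k)"

lemma bpre_Suc: "bpre g w \<epsilon> x (Suc k) = bump2 g (bst g w \<epsilon> x k)"
  by (simp add: bst_def broot_def)

lemma pre_broot: "pre g w (broot g w \<epsilon> x) x k = bpre g w \<epsilon> x k"
  by (induction k) (simp_all add: broot_def)

lemma st_broot: "st g w (broot g w \<epsilon> x) x k = bst g w \<epsilon> x k"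
  by (simp add: st_def bst_def pre_broot)

text \<open>Every solution of the root equations is a run with some choice of signs, so that
  finitely many runs replace the quantification over all \<open>V\<close>. A zero root receives the
  sign 1.\<close>

lemma tower_signs:
  assumes "tower onfl g w V x n"
  defines "\<epsilon> \<equiv> \<lambda>k. if 0 \<le> V k then 1 else - 1"
  shows "k \<le> n \<Longrightarrow> pre g w V x k = bpre g w \<epsilon> x k" "k < n \<Longrightarrow> V k = broot g w \<epsilon> x k"
proof -
  have V: "V k = \<epsilon> k * sqrt (rad (pre g w V x k))" if "k < n" for k
  proof -
    have "rad (pre g w V x k) = (V k)\<^sup>2" using assms(1) that unfolding tower_def by simp
    then show ?thesis by (simp add: \<epsilon>_def)
  qed
  have P: "pre g w V x k = bpre g w \<epsilon> x k" if "k \<le> n" for k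
    using that
  proof (induction k)
    case (Suc k)
    then show ?case using V[of k] by simp
  qed simp
  show "k \<le> n \<Longrightarrow> pre g w V x k = bpre g w \<epsilon> x k" by (rule P)
  show "k < n \<Longrightarrow> V k = broot g w \<epsilon> x k" using V[of k] P[of k] by (simp add: broot_def)
qed

text \<open>Implicit differentiation of \<open>V\<^sup>2 = rad s\<close>.\<close>

definition droot :: "real \<Rightarrow> 'n::{finite,linorder} phase \<Rightarrow> 'n phase \<Rightarrow> real" where
  "droot V s d = (snd s $ lo * snd d $ lo + fst d $ lo) / V"

definition dkick :: "real \<Rightarrow> real \<Rightarrow> 'n::{finite,linorder} phase \<Rightarrow> 'n phase \<Rightarrow> 'n phase" where
  "dkick r V s d = (fst d - axis lo (2 * (r * droot V s d) * (snd s $ lo + r * V) + 2 * (r * V) * (snd d $ lo + r * droot V s d)),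
     snd d + axis lo (2 * (r * droot V s d)))"

definition dseg :: "'n rvec \<Rightarrow> 'n stage \<Rightarrow> real \<Rightarrow> 'n::{finite,linorder} phase \<Rightarrow> 'n phase \<Rightarrow> 'n phase" where
  "dseg g \<sigma> V s d = map_prod (ups g (snd \<sigma>)) (ups g (snd \<sigma>)) (dkick (real (fst \<sigma>)) V s d)"

primrec dpre :: "'n rvec \<Rightarrow> (nat \<Rightarrow> 'n stage) \<Rightarrow> (nat \<Rightarrow> real) \<Rightarrow> 'n::{finite,linorder} phase \<Rightarrow> 'n phase \<Rightarrow> nat \<Rightarrow> 'n phase" where
  "dpre g w \<epsilon> x d 0 = d"
| "dpre g w \<epsilon> x d (Suc k) = bump2 g (dseg g (w k) (broot g w \<epsilon> x k) (bpre g w \<epsilon> x k) (dpre g w \<epsilon> x d k))"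

definition dst :: "'n rvec \<Rightarrow> (nat \<Rightarrow> 'n stage) \<Rightarrow> (nat \<Rightarrow> real) \<Rightarrow> 'n::{finite,linorder} phase \<Rightarrow> 'n phase \<Rightarrow> nat \<Rightarrow> 'n phase" where
  "dst g w \<epsilon> x d k = dseg g (w k) (broot g w \<epsilon> x k) (bpre g w \<epsilon> x k) (dpre g w \<epsilon> x d k)"

lemma dpre_Suc: "dpre g w \<epsilon> x d (Suc k) = bump2 g (dst g w \<epsilon> x d k)"
  by (simp add: dst_def)

lemma axis_scale: "axis i (c::real) = c *\<^sub>R axis i 1"
  by (auto simp: axis_def vec_eq_iff)

lemma has_vector_derivative_pairI:
  assumes "(f has_vector_derivative f') (at x)" "(h has_vector_derivative h') (at x)"
  shows "((\<lambda>t. (f t, h t)) has_vector_derivative (f', h')) (at x)"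
  using has_derivative_Pair[OF assms[unfolded has_vector_derivative_def]]
  by (simp add: has_vector_derivative_def)

lemma has_vector_derivative_fst:
  "(f has_vector_derivative f') F \<Longrightarrow> ((\<lambda>t. fst (f t)) has_vector_derivative fst f') F"
  by (rule bounded_linear.has_vector_derivative[OF bounded_linear_fst])

lemma has_vector_derivative_snd:
  "(f has_vector_derivative f') F \<Longrightarrow> ((\<lambda>t. snd (f t)) has_vector_derivative snd f') F"
  by (rule bounded_linear.has_vector_derivative[OF bounded_linear_snd])

lemma has_vector_derivative_nth:
  "(f has_vector_derivative f') F \<Longrightarrow> ((\<lambda>t. f t $ i) has_real_derivative f' $ i) F"
  unfolding has_real_derivative_iff_has_vector_derivative
  by (rule bounded_linear.has_vector_derivative[OF bounded_linear_vec_nth])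

lemma has_vector_derivative_axis:
  "(f has_real_derivative f') F \<Longrightarrow> ((\<lambda>t. axis i (f t)) has_vector_derivative axis i f') F"
  unfolding has_real_derivative_iff_has_vector_derivative
  by (subst (1 2) axis_scale) (rule bounded_linear.has_vector_derivative[OF bounded_linear_scaleR_left])

lemma has_vector_derivative_linear:
  fixes L :: "'a::euclidean_space \<Rightarrow> 'b::real_normed_vector"
  shows "linear L \<Longrightarrow> (f has_vector_derivative f') F \<Longrightarrow> ((\<lambda>t. L (f t)) has_vector_derivative L f') F"
  using bounded_linear.has_vector_derivative[of L] linear_conv_bounded_linear by blast

lemma deriv_root:
  assumes s: "(s has_vector_derivative d) (at (0::real))" and pos: "0 < rad (s 0)" and \<epsilon>: "\<epsilon>\<^sup>2 = 1"
  shows "((\<lambda>t. \<epsilon> * sqrt (rad (s t))) has_real_derivative droot (\<epsilon> * sqrt (rad (s 0))) (s 0) d) (at 0)"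
proof -
  have f: "((\<lambda>t. fst (s t) $ lo) has_real_derivative fst d $ lo) (at 0)"
    and g: "((\<lambda>t. snd (s t) $ lo) has_real_derivative snd d $ lo) (at 0)"
    by (intro has_vector_derivative_nth has_vector_derivative_fst has_vector_derivative_snd s)+
  have r: "((\<lambda>t. rad (s t)) has_real_derivative 2 * (snd (s 0) $ lo * snd d $ lo + fst d $ lo)) (at 0)"
    unfolding rad_def by (rule derivative_eq_intros f g refl | simp)+
  have "((\<lambda>t. \<epsilon> * sqrt (rad (s t))) has_real_derivative
      \<epsilon> * (inverse (sqrt (rad (s 0))) / 2 * (2 * (snd (s 0) $ lo * snd d $ lo + fst d $ lo)))) (at 0)"
    by (intro DERIV_cmult DERIV_chain2[OF DERIV_real_sqrt[OF pos] r])
  moreover have "\<epsilon> = 1 \<or> \<epsilon> = - 1" using \<epsilon> by (auto simp: power2_eq_1_iff)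
  then have "\<epsilon> * (inverse (sqrt (rad (s 0))) / 2 * (2 * (snd (s 0) $ lo * snd d $ lo + fst d $ lo)))
      = droot (\<epsilon> * sqrt (rad (s 0))) (s 0) d"
    using pos by (elim disjE) (simp_all add: droot_def field_simps)
  ultimately show ?thesis by simp
qed

lemma deriv_seg:
  assumes s: "(s has_vector_derivative d) (at (0::real))" and pos: "0 < rad (s 0)" and \<epsilon>: "\<epsilon>\<^sup>2 = 1"
  shows "((\<lambda>t. seg g \<sigma> (\<epsilon> * sqrt (rad (s t))) (s t)) has_vector_derivative
      dseg g \<sigma> (\<epsilon> * sqrt (rad (s 0))) (s 0) d) (at 0)"
proof -
  define V where "V = (\<lambda>t. \<epsilon> * sqrt (rad (s t)))"
  have V: "(V has_real_derivative droot (V 0) (s 0) d) (at 0)"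
    unfolding V_def by (rule deriv_root[OF assms])
  have x: "((\<lambda>t. snd (s t) $ lo) has_real_derivative snd d $ lo) (at 0)"
    by (intro has_vector_derivative_nth has_vector_derivative_snd s)
  define r where "r = real (fst \<sigma>)"
  have k1: "((\<lambda>t. 2 * (r * V t) * (snd (s t) $ lo + r * V t)) has_real_derivative
     2 * (r * droot (V 0) (s 0) d) * (snd (s 0) $ lo + r * V 0) + 2 * (r * V 0) * (snd d $ lo + r * droot (V 0) (s 0) d)) (at 0)"
    by (rule derivative_eq_intros V x refl | simp add: algebra_simps)+
  have k2: "((\<lambda>t. 2 * (r * V t)) has_real_derivative 2 * (r * droot (V 0) (s 0) d)) (at 0)"
    by (rule derivative_eq_intros V refl | simp)+
  have "((\<lambda>t. kick (r * V t) (s t)) has_vector_derivative dkick r (V 0) (s 0) d) (at 0)"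
    unfolding kick_def dkick_def
    by (intro has_vector_derivative_pairI has_vector_derivative_diff has_vector_derivative_add
        has_vector_derivative_fst[OF s] has_vector_derivative_snd[OF s] has_vector_derivative_axis k1 k2)
  then have "((\<lambda>t. map_prod (ups g (snd \<sigma>)) (ups g (snd \<sigma>)) (kick (r * V t) (s t))) has_vector_derivative
      map_prod (ups g (snd \<sigma>)) (ups g (snd \<sigma>)) (dkick r (V 0) (s 0) d)) (at 0)"
    unfolding map_prod_def case_prod_beta
    by (intro has_vector_derivative_pairI has_vector_derivative_linear[OF linear_ups]
        has_vector_derivative_fst has_vector_derivative_snd)
  then show ?thesis by (simp add: seg_def dseg_def r_def V_def)
qed

lemma deriv_bump2:
  "(s has_vector_derivative d) (at x) \<Longrightarrow> ((\<lambda>t. bump2 g (s t)) has_vector_derivative bump2 g d) (at x)"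
  unfolding bump2_def map_prod_def case_prod_beta
  by (intro has_vector_derivative_pairI has_vector_derivative_linear[OF linear_bump]
        has_vector_derivative_fst has_vector_derivative_snd)

lemma deriv_bpre:
  assumes "\<And>k. k < n \<Longrightarrow> 0 < rad (bpre g w \<epsilon> x k)" "\<And>k. (\<epsilon> k)\<^sup>2 = 1"
  shows "((\<lambda>t. bpre g w \<epsilon> (x + t *\<^sub>R d) n) has_vector_derivative dpre g w \<epsilon> x d n) (at 0)"
  using assms(1)
proof (induction n)
  case 0
  show ?case by (auto intro!: derivative_eq_intros)
next
  case (Suc n)
  then have "((\<lambda>t. bpre g w \<epsilon> (x + t *\<^sub>R d) n) has_vector_derivative dpre g w \<epsilon> x d n) (at 0)" by simp
  from deriv_seg[OF this, of "\<epsilon> n" g "w n"] Suc.prems[of n] assms(2)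
  show ?case by (simp add: deriv_bump2 broot_def)
qed

lemma deriv_bst:
  assumes "\<And>k. k \<le> n \<Longrightarrow> 0 < rad (bpre g w \<epsilon> x k)" "\<And>k. (\<epsilon> k)\<^sup>2 = 1"
  shows "((\<lambda>t. bst g w \<epsilon> (x + t *\<^sub>R d) n) has_vector_derivative dst g w \<epsilon> x d n) (at 0)"
proof -
  have "((\<lambda>t. bpre g w \<epsilon> (x + t *\<^sub>R d) n) has_vector_derivative dpre g w \<epsilon> x d n) (at 0)"
    by (rule deriv_bpre) (use assms in auto)
  from deriv_seg[OF this, of "\<epsilon> n" g "w n"] assms
  show ?thesis by (simp add: bst_def dst_def broot_def)
qed

lemma linear_map_prod:
  assumes "linear f" "linear h" shows "linear (map_prod f h)"
  by (rule linearI) (auto simp: linear_add[OF assms(1)] linear_add[OF assms(2)]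
      linear_scale[OF assms(1)] linear_scale[OF assms(2)] map_prod_def split: prod.splits)

lemma linear_dkick: "linear (dkick r V s)"
proof (rule linearI)
  have e: "droot V s (x + y) = droot V s x + droot V s y" "droot V s (c *\<^sub>R x) = c * droot V s x" for x y c
    by (simp_all add: droot_def algebra_simps add_divide_distrib)
  show "dkick r V s (x + y) = dkick r V s x + dkick r V s y" for x y
    unfolding dkick_def e by (auto simp: vec_eq_iff axis_def algebra_simps)
  show "dkick r V s (c *\<^sub>R x) = c *\<^sub>R dkick r V s x" for x c
    unfolding dkick_def e by (auto simp: vec_eq_iff axis_def algebra_simps)
qed

lemma linear_dseg: "linear (dseg g \<sigma> V s)"
proof -
  have "dseg g \<sigma> V s = map_prod (ups g (snd \<sigma>)) (ups g (snd \<sigma>)) \<circ> dkick (real (fst \<sigma>)) V s"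
    by (simp add: dseg_def fun_eq_iff)
  then show ?thesis using linear_compose[OF linear_dkick linear_map_prod[OF linear_ups linear_ups]] by metis
qed

lemma linear_bump2: "linear (bump2 g)"
proof -
  have "bump2 g = map_prod (bump (g $ sec) sec) (bump (g $ sec) sec)" by (simp add: bump2_def fun_eq_iff)
  then show ?thesis using linear_map_prod[OF linear_bump linear_bump] by metis
qed

lemma linear_dpre: "linear (\<lambda>d. dpre g w \<epsilon> x d n)"
proof (induction n)
  case 0 then show ?case by (simp add: linear_id[unfolded id_def])
next
  case (Suc n)
  show ?case
    using linear_compose[OF linear_compose[OF Suc linear_dseg] linear_bump2] by (simp add: comp_def)
qed

lemma linear_dst: "linear (\<lambda>d. dst g w \<epsilon> x d n)"
  using linear_compose[OF linear_dpre linear_dseg] by (simp add: comp_def dst_def)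

section \<open>Invariance of the symplectic form and of the energy differential\<close>

definition symp :: "'n rvec \<Rightarrow> 'n phase \<Rightarrow> 'n::{finite,linorder} phase \<Rightarrow> real" where
  "symp M d d' = ip M (snd d) (fst d') - ip M (fst d) (snd d')"

text \<open>The differential of the energy with masses \<open>M\<close> at the state
  \<open>s\<close>.\<close>

definition den :: "'n rvec \<Rightarrow> 'n phase \<Rightarrow> 'n::{finite,linorder} phase \<Rightarrow> real" where
  "den M s d = ip M (snd s) (snd d) + mom M (fst d)"

lemma ip_axis_right: "ip M x (axis a c) = M $ a * c * x $ a"
  by (subst ip_commute) (rule ip_axis)

text \<open>The division by \<open>V\<close> disappears once \<open>fst d $ lo\<close> is expressed
  through \<open>droot\<close>; what remains is a polynomial identity.\<close>

lemma symp_dkick: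
  assumes "V \<noteq> 0"
  shows "symp M (dkick r V s d) (dkick r V s d') = symp M d d'"
proof -
  have "droot V s d * V = snd s $ lo * snd d $ lo + fst d $ lo" "droot V s d' * V = snd s $ lo * snd d' $ lo + fst d' $ lo"
    using assms by (simp_all add: droot_def)
  then have e: "fst d $ lo = droot V s d * V - snd s $ lo * snd d $ lo" "fst d' $ lo = droot V s d' * V - snd s $ lo * snd d' $ lo"
    by simp_all
  show ?thesis
    unfolding symp_def dkick_def fst_conv snd_conv ip_add ip_add_right ip_diff ip_diff_right ip_axis ip_axis_right
      vector_add_component vector_minus_component e
    by (simp add: axis_def e algebra_simps)
qed

lemma den_dkick:
  assumes "V \<noteq> 0"
  shows "den M (kick (r * V) s) (dkick r V s d) = den M s d"
proof -
  have "droot V s d * V = snd s $ lo * snd d $ lo + fst d $ lo"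
    using assms by (simp_all add: droot_def)
  then have e: "fst d $ lo = droot V s d * V - snd s $ lo * snd d $ lo"
    by simp_all
  show ?thesis
    unfolding den_def dkick_def kick_def fst_conv snd_conv ip_add ip_add_right ip_diff ip_diff_right ip_axis ip_axis_right
      mom_add mom_diff mom_axis vector_add_component vector_minus_component e
    by (simp add: axis_def algebra_simps)
qed

locale masses =
  fixes M g :: "'n::{finite,linorder} rvec"
  assumes M_nz: "M $ i \<noteq> 0"
    and M_sum: "i \<noteq> lo \<Longrightarrow> M $ below i + M $ i \<noteq> 0"
    and g_eq: "i \<noteq> lo \<Longrightarrow> g $ i = gam M i"
    and sec_lo: "(sec::'n) \<noteq> lo"
begin

lemma above_sec: "sec < i \<Longrightarrow> i \<noteq> (lo::'n)"
  by (metis lo_le not_le)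

lemma ups_ip_M:
  assumes "\<forall>i\<in>set vs. sec < i"
  shows "ip M (ups g vs x) (ups g vs y) = ip M x y" "mom M (ups g vs x) = mom M x"
  using ups_ip[OF assms, of M g] M_sum g_eq above_sec by auto

lemma symp_seg:
  assumes "\<forall>i\<in>set (snd \<sigma>). sec < i" "V \<noteq> 0"
  shows "symp M (dseg g \<sigma> V s d) (dseg g \<sigma> V s d') = symp M d d'"
    "den M (seg g \<sigma> V s) (dseg g \<sigma> V s d) = den M s d"
proof -
  have "symp M (dseg g \<sigma> V s d) (dseg g \<sigma> V s d') = symp M (dkick (real (fst \<sigma>)) V s d) (dkick (real (fst \<sigma>)) V s d')"
    by (simp add: dseg_def symp_def ups_ip_M[OF assms(1)])
  then show "symp M (dseg g \<sigma> V s d) (dseg g \<sigma> V s d') = symp M d d'" using symp_dkick[OF assms(2)] by simp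
  have "den M (seg g \<sigma> V s) (dseg g \<sigma> V s d) = den M (kick (real (fst \<sigma>) * V) s) (dkick (real (fst \<sigma>)) V s d)"
    by (simp add: dseg_def seg_def den_def ups_ip_M[OF assms(1)])
  then show "den M (seg g \<sigma> V s) (dseg g \<sigma> V s d) = den M s d" using den_dkick[OF assms(2)] by simp
qed

lemma symp_bump2: "symp M (bump2 g d) (bump2 g d') = symp M d d'" "den M (bump2 g s) (bump2 g d) = den M s d"
  using bump_ip[OF sec_lo M_sum[OF sec_lo]] bump_mom[OF sec_lo M_sum[OF sec_lo]] g_eq[OF sec_lo]
  by (simp_all add: bump2_def symp_def den_def)

definition regular :: "(nat \<Rightarrow> 'n stage) \<Rightarrow> (nat \<Rightarrow> real) \<Rightarrow> 'n phase \<Rightarrow> nat \<Rightarrow> bool" where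
  "regular w \<epsilon> x n \<longleftrightarrow> (\<forall>k\<le>n. 0 < rad (bpre g w \<epsilon> x k)) \<and> (\<forall>k. (\<epsilon> k)\<^sup>2 = 1) \<and> (\<forall>k. \<forall>i\<in>set (snd (w k)). sec < i)"

lemma broot_nz: "regular w \<epsilon> x n \<Longrightarrow> k \<le> n \<Longrightarrow> broot g w \<epsilon> x k \<noteq> 0"
proof -
  assume r: "regular w \<epsilon> x n" "k \<le> n"
  then have "\<epsilon> k \<noteq> 0" "0 < rad (bpre g w \<epsilon> x k)"
    unfolding regular_def by (metis zero_neq_one power_zero_numeral, blast)
  then show ?thesis by (simp add: broot_def)
qed

lemma symp_dpre:
  assumes "regular w \<epsilon> x n" "k \<le> n"
  shows "symp M (dpre g w \<epsilon> x d k) (dpre g w \<epsilon> x d' k) = symp M d d' \<and>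
    den M (bpre g w \<epsilon> x k) (dpre g w \<epsilon> x d k) = den M x d"
  using assms(2)
proof (induction k)
  case (Suc k)
  have w: "\<forall>i\<in>set (snd (w k)). sec < i" using assms(1) by (auto simp: regular_def)
  show ?case
    using Suc symp_seg[OF w broot_nz[OF assms(1), of k]]
    unfolding dpre_Suc bpre_Suc symp_bump2 unfolding dst_def bst_def by simp
qed simp

lemma symp_dst:
  assumes "regular w \<epsilon> x n"
  shows "symp M (dst g w \<epsilon> x d n) (dst g w \<epsilon> x d' n) = symp M d d'"
    "den M (bst g w \<epsilon> x n) (dst g w \<epsilon> x d n) = den M x d"
proof -
  have w: "\<forall>i\<in>set (snd (w n)). sec < i" using assms(1) by (auto simp: regular_def)
  show "symp M (dst g w \<epsilon> x d n) (dst g w \<epsilon> x d' n) = symp M d d'"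
    "den M (bst g w \<epsilon> x n) (dst g w \<epsilon> x d n) = den M x d"
    using symp_dpre[OF assms order_refl] symp_seg[OF w broot_nz[OF assms order_refl]]
    unfolding dst_def bst_def by simp_all
qed

end

section \<open>Conormals of a corner and characteristic directions\<close>

definition ev :: "'n \<Rightarrow> 'n::{finite,linorder} rvec" where
  "ev a = (\<chi> k. if a \<le> k then 1 else 0)"

lemma gap_ev: "gap (ev a) i = (if i = a then 1 else 0)"
proof (cases "i = lo")
  case True
  then show ?thesis using lo_le[of a] by (auto simp: gap_eq ev_def intro: order_antisym)
next
  case False
  have "a \<le> below i \<longleftrightarrow> a < i" using below_less[OF False] less_imp_le_below[of a i] by auto
  then show ?thesis using False by (auto simp: gap_eq ev_def)
qed

lemma span_pair: "span {x, y} = {a *\<^sub>R x + b *\<^sub>R y | a b. True}"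
  by (auto simp: span_insert algebra_simps)

lemma ip_zero_iff:
  assumes "\<And>i. M $ i \<noteq> 0" "\<And>y. ip M u y = 0" shows "u = 0"
proof -
  have "M $ i * u $ i = 0" for i using assms(2)[of "axis i 1"] by (simp add: ip_axis_right)
  then show ?thesis using assms(1) by (simp add: vec_eq_iff)
qed

lemma gap_linear: "gap (x + y) i = gap x i + gap y i" "gap (x - y) i = gap x i - gap y i"
  "gap (c *\<^sub>R x) i = c * gap x i" "gap 0 i = 0" "gap (- x) i = - gap x i"
  by (simp_all add: gap_eq algebra_simps)

context masses
begin

lemma conormal:
  assumes "a \<noteq> b" and u: "\<And>y. gap y a = 0 \<Longrightarrow> gap y b = 0 \<Longrightarrow> ip M u y = 0"
  shows "u = ip M u (ev a) *\<^sub>R nv M a + ip M u (ev b) *\<^sub>R nv M b"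
proof -
  have "ip M (u - (ip M u (ev a) *\<^sub>R nv M a + ip M u (ev b) *\<^sub>R nv M b)) y = 0" for y
  proof -
    \<comment> \<open>\<open>ev\<close> is the basis dual to the gaps, so subtracting these
      multiples brings an arbitrary \<open>y\<close> into the subspace of the hypothesis.\<close>
    have "ip M u (y - gap y a *\<^sub>R ev a - gap y b *\<^sub>R ev b) = 0"
      using assms(1) by (intro u) (simp_all add: gap_linear gap_ev)
    then show ?thesis
      by (simp add: ip_diff ip_add ip_scale ip_diff_right ip_add_right ip_scale_right ip_nv[OF M_nz] algebra_simps)
  qed
  from ip_zero_iff[OF M_nz this] show ?thesis by simp
qed

text \<open>A covector that annihilates the image of the tangent space \<open>{gap q a = gap q b = 0}\<close> and the
  energy is the image of the characteristic direction of that coisotropic subspace.\<close>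

lemma characteristic:
  assumes reg: "regular w \<epsilon> x n" and ab: "a \<noteq> b"
    and nz: "gap (snd x) a \<noteq> 0 \<or> gap (snd x) b \<noteq> 0"
    and ann: "\<And>\<eta>. gap (fst \<eta>) a = 0 \<Longrightarrow> gap (fst \<eta>) b = 0 \<Longrightarrow> symp M \<zeta> (dst g w \<epsilon> x \<eta> n) = 0"
    and en: "den M (bst g w \<epsilon> x n) \<zeta> = 0"
  shows "\<exists>c. \<zeta> = c *\<^sub>R dst g w \<epsilon> x (0, gap (snd x) a *\<^sub>R nv M b - gap (snd x) b *\<^sub>R nv M a) n"
proof -
  let ?S = "\<lambda>d. dst g w \<epsilon> x d n"
  \<comment> \<open>A linear map that preserves a nondegenerate form is injective, hence bijective;
    so the covector can be pulled back to the start.\<close>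
  have inj: "inj ?S"
  proof (rule linear_injective_0[OF linear_dst, THEN iffD2], intro allI impI)
    fix d assume "?S d = 0"
    then have "symp M (?S d) (?S d') = 0" for d' by (simp add: symp_def ip_def)
    then have s: "symp M d d' = 0" for d' using symp_dst[OF reg] by simp
    have "snd d = 0"
      by (rule ip_zero_iff[OF M_nz]) (use s[of "(y, 0)" for y] in \<open>simp add: symp_def ip_def\<close>)
    moreover have "fst d = 0"
      by (rule ip_zero_iff[OF M_nz]) (use s[of "(0, y)" for y] in \<open>simp add: symp_def ip_def\<close>)
    ultimately show "d = 0" by (simp add: prod_eq_iff)
  qed
  then have "surj ?S" using linear_inj_imp_surj[OF linear_dst] by blast
  then obtain \<delta> where \<delta>: "\<zeta> = ?S \<delta>" by (metis surjD)
  have s: "symp M \<delta> \<eta> = 0" if "gap (fst \<eta>) a = 0" "gap (fst \<eta>) b = 0" for \<eta>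
    using ann[OF that] symp_dst[OF reg] \<delta> by simp
  have f0: "fst \<delta> = 0"
    by (rule ip_zero_iff[OF M_nz]) (use s[of "(0, y)" for y] in \<open>simp add: symp_def ip_def gap_linear\<close>)
  define \<alpha> \<beta> where "\<alpha> = ip M (snd \<delta>) (ev a)" and "\<beta> = ip M (snd \<delta>) (ev b)"
  have u: "snd \<delta> = \<alpha> *\<^sub>R nv M a + \<beta> *\<^sub>R nv M b"
    unfolding \<alpha>_def \<beta>_def
    by (rule conormal[OF ab]) (use s[of "(y, 0)" for y] in \<open>simp add: symp_def ip_def\<close>)
  \<comment> \<open>The invariant energy differential leaves one linear relation between the two
    coefficients, hence a single direction.\<close>
  have "den M x \<delta> = 0" using symp_dst(2)[OF reg, of \<delta>] en \<delta> by simp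
  then have "ip M (snd \<delta>) (snd x) = 0" by (simp add: den_def f0 mom_def ip_commute)
  then have e: "\<alpha> * gap (snd x) a + \<beta> * gap (snd x) b = 0"
    by (simp add: u ip_add ip_scale ip_nv[OF M_nz])
  obtain c where c: "\<alpha> = - c * gap (snd x) b" "\<beta> = c * gap (snd x) a"
  proof (cases "gap (snd x) a = 0")
    case True
    then have "gap (snd x) b \<noteq> 0" "\<beta> = 0" using nz e by auto
    then show ?thesis using True by (intro that[of "- \<alpha> / gap (snd x) b"]) auto
  next
    case False
    then show ?thesis using e by (intro that[of "\<beta> / gap (snd x) a"]) (auto simp: field_simps)
  qed
  have "\<delta> = c *\<^sub>R (0, gap (snd x) a *\<^sub>R nv M b - gap (snd x) b *\<^sub>R nv M a)"
    using f0 u c by (simp add: prod_eq_iff algebra_simps)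
  moreover have "?S (c *\<^sub>R (0, gap (snd x) a *\<^sub>R nv M b - gap (snd x) b *\<^sub>R nv M a))
      = c *\<^sub>R ?S (0, gap (snd x) a *\<^sub>R nv M b - gap (snd x) b *\<^sub>R nv M a)"
    by (rule linear_scale[OF linear_dst])
  ultimately have "\<zeta> = c *\<^sub>R ?S (0, gap (snd x) a *\<^sub>R nv M b - gap (snd x) b *\<^sub>R nv M a)"
    using \<delta> by metis
  then show ?thesis by blast
qed

lemma rad_seg:
  assumes "\<forall>i\<in>set (snd \<sigma>). sec < i"
  shows "rad (seg g \<sigma> V s) = rad s"
  using rad_kick[of "real (fst \<sigma>) * V" s] ups_lo[OF assms] by (simp add: rad_def seg_def)

lemma rad_bst: "regular w \<epsilon> x n \<Longrightarrow> rad (bst g w \<epsilon> x n) = rad (bpre g w \<epsilon> x n)"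
  unfolding bst_def by (rule rad_seg) (auto simp: regular_def)

text \<open>The tangent vector \<open>d\<close> is the characteristic direction of the final piece: it changes only the
  velocities at the time \<open>t\<close> of the two final collisions.\<close>

definition focus :: "'n \<Rightarrow> 'n \<Rightarrow> real \<Rightarrow> 'n phase \<Rightarrow> 'n phase \<Rightarrow> bool" where
  "focus i j V s d \<longleftrightarrow> snd d \<in> span {nv M i, nv M j} \<and>
     (snd d = 0 \<or> (\<exists>t. fst d = - t *\<^sub>R snd d \<and> (i = lo \<longrightarrow> t = snd s $ lo + V) \<and>
        (i \<noteq> lo \<longrightarrow> gap (fst s) i = - t * gap (snd s) i \<and> gap (fst s) j = - t * gap (snd s) j)))"

lemma focus_scale:
  assumes "c \<noteq> 0" "focus i j V s (c *\<^sub>R d)" shows "focus i j V s d"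
proof -
  have "(1 / c) *\<^sub>R snd (c *\<^sub>R d) \<in> span {nv M i, nv M j}"
    using assms(2) by (intro span_scale) (simp add: focus_def)
  moreover have "fst d = - t *\<^sub>R snd d" if "fst (c *\<^sub>R d) = - t *\<^sub>R snd (c *\<^sub>R d)" for t
  proof -
    have "c *\<^sub>R fst d = c *\<^sub>R (- t *\<^sub>R snd d)" using that by (simp add: mult.commute)
    then show ?thesis using assms(1) by (simp only: scaleR_cancel_left) simp
  qed
  ultimately show ?thesis using assms unfolding focus_def by auto
qed

text \<open>\<open>characteristic\<close> makes \<open>\<zeta>\<close> a multiple of the transported
  direction; since \<open>\<zeta>\<close> is nonzero, the factor can be inverted.\<close>

lemma focusing_of_symp:
  assumes reg: "regular w \<epsilon> x n" and ab: "a \<noteq> b"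
    and nz: "gap (snd x) a \<noteq> 0 \<or> gap (snd x) b \<noteq> 0"
    and ann: "\<And>\<eta>. gap (fst \<eta>) a = 0 \<Longrightarrow> gap (fst \<eta>) b = 0 \<Longrightarrow> symp M \<zeta> (dst g w \<epsilon> x \<eta> n) = 0"
    and en: "den M (bst g w \<epsilon> x n) \<zeta> = 0" and "\<zeta> \<noteq> 0" and f: "focus i j V s \<zeta>"
  shows "focus i j V s (dst g w \<epsilon> x (0, gap (snd x) a *\<^sub>R nv M b - gap (snd x) b *\<^sub>R nv M a) n)"
proof -
  obtain c where c: "\<zeta> = c *\<^sub>R dst g w \<epsilon> x (0, gap (snd x) a *\<^sub>R nv M b - gap (snd x) b *\<^sub>R nv M a) n"
    using characteristic[OF reg ab nz ann en] by blast
  moreover have "c \<noteq> 0" using c \<open>\<zeta> \<noteq> 0\<close> by auto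
  ultimately show ?thesis using focus_scale f by metis
qed

lemma nv_nz: "nv M a \<noteq> 0"
  using ip_nv[OF M_nz, of a "ev a"] by (auto simp: gap_ev ip_def)

lemma nv_comb_zero: "i \<noteq> j \<Longrightarrow> \<alpha> *\<^sub>R nv M i + \<beta> *\<^sub>R nv M j = 0 \<Longrightarrow> \<alpha> = 0 \<and> \<beta> = 0"
proof -
  assume a: "i \<noteq> j" "\<alpha> *\<^sub>R nv M i + \<beta> *\<^sub>R nv M j = 0"
  have "ip M (\<alpha> *\<^sub>R nv M i + \<beta> *\<^sub>R nv M j) (ev k) = 0" for k unfolding a(2) by (simp add: ip_def)
  from this[of i] this[of j] show ?thesis using a(1) by (simp add: ip_add ip_scale ip_nv[OF M_nz] gap_ev)
qed

lemma has_real_derivative_gap: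
  assumes "(f has_vector_derivative f') F"
  shows "((\<lambda>t. gap (f t) i) has_real_derivative gap f' i) F"
  unfolding has_real_derivative_iff_has_vector_derivative
  by (rule has_vector_derivative_linear[OF linear_gap assms])

lemma zero_derivative:
  assumes "(f has_real_derivative D) (at 0)" "\<forall>\<^sub>F t in at (0::real). f t = 0" "f 0 = 0"
  shows "D = 0"
proof -
  have "\<forall>\<^sub>F t in nhds (0::real). f t = 0"
    using assms(2,3) by (auto simp: eventually_nhds_conv_at)
  then have "(f has_real_derivative D) (at 0) \<longleftrightarrow> ((\<lambda>_. 0) has_real_derivative D) (at 0)"
    by (intro DERIV_cong_ev) auto
  then show ?thesis using assms(1) DERIV_unique[of "\<lambda>_. 0" D 0 0] by simp
qed

text \<open>Outside the degenerate case the derivative of \<open>fin\<close>, multiplied by the root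
  if \<open>i = lo\<close>, is the pairing of the tangent map with an explicit vector
  \<open>(- t0 *\<^sub>R w', w')\<close>. This vector is annihilated by the energy differential and
  is characteristic for the final piece.\<close>

lemma focusing:
  assumes reg: "regular w \<epsilon> x n" and ab: "a \<noteq> b" and ij: "i < j"
    and nz: "gap (snd x) a \<noteq> 0 \<or> gap (snd x) b \<noteq> 0"
    and zero: "\<And>\<eta>. gap (fst \<eta>) a = 0 \<Longrightarrow> gap (fst \<eta>) b = 0 \<Longrightarrow>
      \<forall>\<^sub>F t in nhds 0. fin i j (broot g w \<epsilon> (x + t *\<^sub>R \<eta>) n) (bst g w \<epsilon> (x + t *\<^sub>R \<eta>) n) = 0 \<and>
        (deg \<longrightarrow> gap (snd (bst g w \<epsilon> (x + t *\<^sub>R \<eta>) n)) i = 0)"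
    and deg: "i \<noteq> lo \<Longrightarrow> deg \<or> gap (snd (bst g w \<epsilon> x n)) i \<noteq> 0 \<or> gap (snd (bst g w \<epsilon> x n)) j \<noteq> 0"
  shows "focus i j (broot g w \<epsilon> x n) (bst g w \<epsilon> x n)
    (dst g w \<epsilon> x (0, gap (snd x) a *\<^sub>R nv M b - gap (snd x) b *\<^sub>R nv M a) n)"
proof -
  let ?s = "bst g w \<epsilon> x n" and ?V = "broot g w \<epsilon> x n"
  have jlo: "j \<noteq> lo" using ij by (metis lo_le not_le)
  have D: "((\<lambda>t. bst g w \<epsilon> (x + t *\<^sub>R \<eta>) n) has_vector_derivative dst g w \<epsilon> x \<eta> n) (at 0)" for \<eta>
    by (rule deriv_bst) (use reg in \<open>auto simp: regular_def\<close>)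
  note DX = has_real_derivative_gap[OF has_vector_derivative_snd[OF D]]
  note DP = has_real_derivative_gap[OF has_vector_derivative_fst[OF D]]
  have F: "fin i j ?V ?s = 0" using zero[of 0, THEN eventually_nhds_x_imp_x] by (simp add: gap_linear)
  have ev0: "\<forall>\<^sub>F t in at 0. P t" if "\<forall>\<^sub>F t in nhds 0. P t" for P :: "real \<Rightarrow> bool"
    using that by (simp add: eventually_nhds_conv_at)
  show ?thesis
  proof (cases "i = lo")
    case True
    \<comment> \<open>At the arrival time \<open>t0\<close> the lowest particle has velocity
      \<open>- ?V\<close>; up to sign this is the characteristic combination of the two final
      normals.\<close>
    define w' where "w' = ?V *\<^sub>R nv M j + gap (snd ?s) j *\<^sub>R nv M lo"
    define t0 where "t0 = snd ?s $ lo + ?V"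
    have V0: "?V \<noteq> 0" using broot_nz[OF reg] by simp
    have w'nz: "w' \<noteq> 0" using nv_comb_zero[OF jlo, of ?V] V0 by (auto simp: w'_def)
    have pos: "0 < rad (bst g w \<epsilon> x n)" and \<epsilon>: "(\<epsilon> n)\<^sup>2 = 1"
      using reg rad_bst[OF reg] by (auto simp: regular_def)
    show ?thesis
    proof (rule focusing_of_symp[OF reg ab nz, of "(- t0 *\<^sub>R w', w')"])
      fix \<eta> :: "'n phase" assume \<eta>: "gap (fst \<eta>) a = 0" "gap (fst \<eta>) b = 0"
      define d where "d = dst g w \<epsilon> x \<eta> n"
      have rr: "rad (bst g w \<epsilon> y n) = rad (bpre g w \<epsilon> y n)" for y
        unfolding bst_def by (rule rad_seg) (use reg in \<open>auto simp: regular_def\<close>)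
      have Dr: "((\<lambda>t. broot g w \<epsilon> (x + t *\<^sub>R \<eta>) n) has_real_derivative droot ?V ?s d) (at 0)"
        using deriv_root[OF D[of \<eta>], of "\<epsilon> n"] pos \<epsilon> by (simp add: broot_def d_def rr)
      have Dl: "((\<lambda>t. snd (bst g w \<epsilon> (x + t *\<^sub>R \<eta>) n) $ lo) has_real_derivative snd d $ lo) (at 0)"
        unfolding d_def by (intro has_vector_derivative_nth has_vector_derivative_snd D)
      have "((\<lambda>t. gap (fst (bst g w \<epsilon> (x + t *\<^sub>R \<eta>) n)) j +
          (snd (bst g w \<epsilon> (x + t *\<^sub>R \<eta>) n) $ lo + broot g w \<epsilon> (x + t *\<^sub>R \<eta>) n) * gap (snd (bst g w \<epsilon> (x + t *\<^sub>R \<eta>) n)) j)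
          has_real_derivative gap (fst d) j + ((snd d $ lo + droot ?V ?s d) * gap (snd ?s) j + t0 * gap (snd d) j)) (at 0)"
        by (rule derivative_eq_intros Dr Dl DX DP refl | simp add: d_def t0_def algebra_simps)+
      then have "((\<lambda>t. fin i j (broot g w \<epsilon> (x + t *\<^sub>R \<eta>) n) (bst g w \<epsilon> (x + t *\<^sub>R \<eta>) n))
          has_real_derivative gap (fst d) j + ((snd d $ lo + droot ?V ?s d) * gap (snd ?s) j + t0 * gap (snd d) j)) (at 0)"
        by (simp add: fin_def True)
      from zero_derivative[OF this] have "gap (fst d) j + ((snd d $ lo + droot ?V ?s d) * gap (snd ?s) j + t0 * gap (snd d) j) = 0"
        using ev0[OF eventually_mono[OF zero[OF \<eta>]]] F by auto
      \<comment> \<open>Multiplication by the root clears the denominator of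
        \<open>droot\<close>.\<close>
      then have "?V * (gap (fst d) j + ((snd d $ lo + droot ?V ?s d) * gap (snd ?s) j + t0 * gap (snd d) j)) = 0" by simp
      moreover have "?V * droot ?V ?s d = snd ?s $ lo * snd d $ lo + fst d $ lo"
        using V0 by (simp add: droot_def)
      moreover have "?V * (gap (fst d) j + ((snd d $ lo + droot ?V ?s d) * gap (snd ?s) j + t0 * gap (snd d) j))
          = ?V * gap (fst d) j + (?V * snd d $ lo + ?V * droot ?V ?s d) * gap (snd ?s) j + ?V * t0 * gap (snd d) j"
        by (simp add: algebra_simps)
      ultimately have "?V * gap (fst d) j + (?V * snd d $ lo + (snd ?s $ lo * snd d $ lo + fst d $ lo)) * gap (snd ?s) j
          + ?V * t0 * gap (snd d) j = 0"
        by simp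
      then show "symp M (- t0 *\<^sub>R w', w') (dst g w \<epsilon> x \<eta> n) = 0"
        unfolding symp_def fst_conv snd_conv ip_scale w'_def ip_add ip_nv[OF M_nz] gap_eq[of _ lo] d_def
        by (simp add: t0_def algebra_simps)
    next
      have l: "ip M (snd ?s) (nv M k) = gap (snd ?s) k" for k using ip_commute ip_nv[OF M_nz] by metis
      show "den M ?s (- t0 *\<^sub>R w', w') = 0"
        unfolding den_def w'_def fst_conv snd_conv mom_scale mom_add mom_nv[OF M_nz] ip_add_right ip_scale_right l
        using jlo by (simp add: gap_eq[of _ lo] t0_def algebra_simps)
      show "(- t0 *\<^sub>R w', w') \<noteq> 0" using w'nz by (simp add: prod_eq_iff)
      have "w' = gap (snd ?s) j *\<^sub>R nv M i + ?V *\<^sub>R nv M j" by (simp add: w'_def True)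
      then have "w' \<in> span {nv M i, nv M j}" unfolding span_pair by blast
      then show "focus i j ?V ?s (- t0 *\<^sub>R w', w')" using True by (auto simp: focus_def t0_def scaleR_left_diff_distrib scaleR_left_distrib)
    qed
  next
    case False
    have nvs: "ip M (snd ?s) (nv M k) = gap (snd ?s) k" for k using ip_commute ip_nv[OF M_nz] by metis
    show ?thesis
    proof (cases "gap (snd ?s) i = 0 \<and> gap (snd ?s) j = 0")
      case True
      then have deg using deg False by auto
      show ?thesis
      \<comment> \<open>Both final gap velocities are zero, so they determine no arrival time. The
        velocity gap \<open>i\<close> vanishes along all admissible lines, and its differential
        supplies the covector instead.\<close>
      proof (rule focusing_of_symp[OF reg ab nz, of "(nv M i, 0)"])
        fix \<eta> :: "'n phase" assume \<eta>: "gap (fst \<eta>) a = 0" "gap (fst \<eta>) b = 0"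
        have "gap (snd (dst g w \<epsilon> x \<eta> n)) i = 0"
          using zero_derivative[OF DX] ev0[OF eventually_mono[OF zero[OF \<eta>]]] \<open>deg\<close> True by auto
        then show "symp M (nv M i, 0) (dst g w \<epsilon> x \<eta> n) = 0"
          by (simp add: symp_def ip_nv[OF M_nz]) (simp add: ip_def)
      next
        show "den M ?s (nv M i, 0) = 0" using False by (simp add: den_def mom_nv[OF M_nz]) (simp add: ip_def)
        show "(nv M i, 0) \<noteq> (0 :: 'n phase)" using nv_nz by (simp add: prod_eq_iff)
        show "focus i j ?V ?s (nv M i, 0)" by (simp add: focus_def span_zero)
      qed
    next
      case nz': False
      have D0: "gap (snd ?s) i * gap (fst ?s) j = gap (snd ?s) j * gap (fst ?s) i"
        using F False by (simp add: fin_def)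
      obtain t0 where t0: "gap (fst ?s) i = - t0 * gap (snd ?s) i" "gap (fst ?s) j = - t0 * gap (snd ?s) j"
      proof (cases "gap (snd ?s) i = 0")
        case True
        then have "gap (snd ?s) j \<noteq> 0" "gap (fst ?s) i = 0" using nz' D0 by auto
        then show ?thesis using True by (intro that[of "- gap (fst ?s) j / gap (snd ?s) j"]) auto
      next
        case False
        then show ?thesis using D0 by (intro that[of "- gap (fst ?s) i / gap (snd ?s) i"]) (auto simp: field_simps)
      qed
      define w' where "w' = gap (snd ?s) i *\<^sub>R nv M j - gap (snd ?s) j *\<^sub>R nv M i"
      have "w' \<noteq> 0"
        using nv_comb_zero[of j i "gap (snd ?s) i" "- gap (snd ?s) j"] nz' ij by (auto simp: w'_def)
      show ?thesis
      proof (rule focusing_of_symp[OF reg ab nz, of "(- t0 *\<^sub>R w', w')"])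
        fix \<eta> :: "'n phase" assume \<eta>: "gap (fst \<eta>) a = 0" "gap (fst \<eta>) b = 0"
        define d where "d = dst g w \<epsilon> x \<eta> n"
        have "((\<lambda>t. gap (snd (bst g w \<epsilon> (x + t *\<^sub>R \<eta>) n)) i * gap (fst (bst g w \<epsilon> (x + t *\<^sub>R \<eta>) n)) j -
            gap (snd (bst g w \<epsilon> (x + t *\<^sub>R \<eta>) n)) j * gap (fst (bst g w \<epsilon> (x + t *\<^sub>R \<eta>) n)) i) has_real_derivative
            gap (snd d) i * gap (fst ?s) j + gap (snd ?s) i * gap (fst d) j
            - (gap (snd d) j * gap (fst ?s) i + gap (snd ?s) j * gap (fst d) i)) (at 0)"
          by (rule derivative_eq_intros DX DP refl | simp add: d_def algebra_simps)+
        then have "((\<lambda>t. fin i j (broot g w \<epsilon> (x + t *\<^sub>R \<eta>) n) (bst g w \<epsilon> (x + t *\<^sub>R \<eta>) n)) has_real_derivative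
            gap (snd d) i * gap (fst ?s) j + gap (snd ?s) i * gap (fst d) j
            - (gap (snd d) j * gap (fst ?s) i + gap (snd ?s) j * gap (fst d) i)) (at 0)"
          using False by (simp add: fin_def)
        from zero_derivative[OF this] have "gap (snd d) i * gap (fst ?s) j + gap (snd ?s) i * gap (fst d) j
            - (gap (snd d) j * gap (fst ?s) i + gap (snd ?s) j * gap (fst d) i) = 0"
          using ev0[OF eventually_mono[OF zero[OF \<eta>]]] F by auto
        then show "symp M (- t0 *\<^sub>R w', w') (dst g w \<epsilon> x \<eta> n) = 0"
          unfolding t0 symp_def fst_conv snd_conv ip_scale w'_def ip_diff ip_nv[OF M_nz] d_def
          by (simp add: algebra_simps)
      next
        show "den M ?s (- t0 *\<^sub>R w', w') = 0"
          unfolding den_def w'_def fst_conv snd_conv mom_scale mom_diff mom_nv[OF M_nz] ip_diff_right ip_scale_right nvs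
          using jlo False by (simp add: algebra_simps)
        show "(- t0 *\<^sub>R w', w') \<noteq> 0" using \<open>w' \<noteq> 0\<close> by (simp add: prod_eq_iff)
        have "w' = (- gap (snd ?s) j) *\<^sub>R nv M i + gap (snd ?s) i *\<^sub>R nv M j" by (simp add: w'_def)
        then have "w' \<in> span {nv M i, nv M j}" unfolding span_pair by blast
        then show "focus i j ?V ?s (- t0 *\<^sub>R w', w')" using False t0 by (auto simp: focus_def)
      qed
    qed
  qed
qed

end

section \<open>A large coefficient of the lowest pair\<close>

text \<open>The scaling symmetry of free fall: time and velocities are multiplied by
  \<open>c\<close>, positions by the square of \<open>c\<close>, and the acceleration is
  unchanged.\<close>

definition scale :: "real \<Rightarrow> 'n::finite phase \<Rightarrow> 'n phase" where
  "scale c s = (c\<^sup>2 *\<^sub>R fst s, c *\<^sub>R snd s)"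

text \<open>The derivative of \<open>scale c\<close> times \<open>b / c\<close>; the second
  parameter normalises tangent vectors independently of the states.\<close>

definition dscale :: "real \<Rightarrow> real \<Rightarrow> 'n::finite phase \<Rightarrow> 'n phase" where
  "dscale c b d = ((c * b) *\<^sub>R fst d, b *\<^sub>R snd d)"

lemma axis_scaleR: "axis i (c * d) = c *\<^sub>R axis i (d::real)"
  by (auto simp: axis_def vec_eq_iff)

lemma scale_map_prod: "linear f \<Longrightarrow> scale c (map_prod f f s) = map_prod f f (scale c s)"
  by (simp add: scale_def map_prod_def split_beta linear_scale)

lemma dscale_map_prod: "linear f \<Longrightarrow> dscale c b (map_prod f f s) = map_prod f f (dscale c b s)"
  by (simp add: dscale_def map_prod_def split_beta linear_scale)

lemma scale_kick: "scale c (kick w s) = kick (c * w) (scale c s)"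
  by (auto simp: scale_def kick_def axis_scaleR[symmetric] scaleR_diff_right scaleR_add_right power2_eq_square algebra_simps)

lemma rad_scale: "rad (scale c s) = c\<^sup>2 * rad s"
  by (simp add: rad_def scale_def power2_eq_square algebra_simps)

lemma scale_seg: "scale c (seg g \<sigma> V s) = seg g \<sigma> (c * V) (scale c s)"
  by (simp add: seg_def scale_map_prod[OF linear_ups] scale_kick mult.left_commute)

lemma scale_bump2: "scale c (bump2 g s) = bump2 g (scale c s)"
  by (simp add: bump2_def scale_map_prod[OF linear_bump])

lemma dscale_bump2: "dscale c b (bump2 g s) = bump2 g (dscale c b s)"
  by (simp add: bump2_def dscale_map_prod[OF linear_bump])

lemma droot_scale: "c \<noteq> 0 \<Longrightarrow> droot (c * V) (scale c s) (dscale c b d) = b * droot V s d"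
proof -
  assume c: "c \<noteq> 0"
  have "snd (scale c s) $ lo * snd (dscale c b d) $ lo + fst (dscale c b d) $ lo
      = c * (b * (snd s $ lo * snd d $ lo + fst d $ lo))"
    by (simp add: scale_def dscale_def algebra_simps)
  then show ?thesis using c by (simp add: droot_def)
qed

lemma dscale_dkick: "c \<noteq> 0 \<Longrightarrow> dscale c b (dkick r V s d) = dkick r (c * V) (scale c s) (dscale c b d)"
  unfolding dkick_def droot_scale
  by (auto simp: scale_def dscale_def axis_scaleR[symmetric] scaleR_diff_right scaleR_add_right algebra_simps)

lemma dscale_dseg: "c \<noteq> 0 \<Longrightarrow> dscale c b (dseg g \<sigma> V s d) = dseg g \<sigma> (c * V) (scale c s) (dscale c b d)"
  by (simp add: dseg_def dscale_map_prod[OF linear_ups] dscale_dkick)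

lemma scale_scale: "scale c (scale c' s) = scale (c * c') s"
  by (simp add: scale_def power_mult_distrib)

lemma dscale_dscale: "dscale c b (dscale c' b' s) = dscale (c * c') (b * b') s"
  by (simp add: dscale_def mult_ac)

lemma scale_pre: "scale c (pre g w V x k) = pre g w (\<lambda>k. c * V k) (scale c x) k"
  by (induction k) (simp_all add: scale_bump2 scale_seg)

lemma tendsto_axis: "(f \<longlongrightarrow> l) F \<Longrightarrow> ((\<lambda>t. axis i (f t :: real)) \<longlongrightarrow> axis i l) F"
  by (subst (1 2) axis_scale) (intro tendsto_intros)

lemma tendsto_linear:
  fixes L :: "'a::euclidean_space \<Rightarrow> 'b::real_normed_vector"
  shows "linear L \<Longrightarrow> (f \<longlongrightarrow> l) F \<Longrightarrow> ((\<lambda>t. L (f t)) \<longlongrightarrow> L l) F"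
  using bounded_linear.tendsto[of L] linear_conv_bounded_linear by blast

lemma tendsto_rad: "(s \<longlongrightarrow> l) F \<Longrightarrow> ((\<lambda>t. rad (s t)) \<longlongrightarrow> rad l) F"
  unfolding rad_def by (intro tendsto_intros)

lemma tendsto_map_linear:
  fixes f :: "'n::finite rvec \<Rightarrow> 'n rvec"
  assumes "linear f" "(s \<longlongrightarrow> l) F"
  shows "((\<lambda>t. map_prod f f (s t)) \<longlongrightarrow> map_prod f f l) F"
  unfolding map_prod_def case_prod_beta
  by (intro tendsto_Pair tendsto_linear[OF assms(1)] tendsto_fst[OF assms(2)] tendsto_snd[OF assms(2)])

lemma tendsto_seg:
  assumes "(s \<longlongrightarrow> l) F" "(V \<longlongrightarrow> v) F"
  shows "((\<lambda>t. seg g \<sigma> (V t) (s t)) \<longlongrightarrow> seg g \<sigma> v l) F"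
  unfolding seg_def kick_def
  by (rule tendsto_map_linear[OF linear_ups]) (rule tendsto_Pair tendsto_diff tendsto_add tendsto_mult tendsto_divide tendsto_const tendsto_fst tendsto_snd tendsto_vec_nth tendsto_axis assms)+

lemma tendsto_dseg:
  assumes "(s \<longlongrightarrow> l) F" "(V \<longlongrightarrow> v) F" "(d \<longlongrightarrow> e) F" "v \<noteq> 0"
  shows "((\<lambda>t. dseg g \<sigma> (V t) (s t) (d t)) \<longlongrightarrow> dseg g \<sigma> v l e) F"
  unfolding dseg_def dkick_def droot_def
  by (rule tendsto_map_linear[OF linear_ups]) (rule tendsto_Pair tendsto_diff tendsto_add tendsto_mult tendsto_divide tendsto_const tendsto_fst tendsto_snd tendsto_vec_nth tendsto_axis assms)+

text \<open>Both moved components equal \<open>G\<close> times the velocity difference up to a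
  bounded term, so the matrix divided by \<open>G\<close> tends to a map of rank one.\<close>

lemma bump_large:
  assumes s: "(sec::'n::{finite,linorder}) \<noteq> lo" and G: "filterlim G at_top F" and v: "(v \<longlongrightarrow> l) F"
  shows "((\<lambda>t. (1 / G t) *\<^sub>R bump (G t) sec (v t :: 'n rvec)) \<longlongrightarrow> (l $ lo - l $ sec) *\<^sub>R (axis lo 1 + axis sec 1)) F"
proof (rule vec_tendstoI)
  fix j :: 'n
  have e: "((\<lambda>t. 1 / G t) \<longlongrightarrow> 0) F"
    using tendsto_inverse_0_at_top[OF G] by (simp add: divide_inverse)
  have G0: "\<forall>\<^sub>F t in F. G t \<noteq> 0"
    using filterlim_at_top_dense[THEN iffD1, OF G, rule_format, of 0] by (auto elim: eventually_mono)
  have vn: "((\<lambda>t. v t $ k) \<longlongrightarrow> l $ k) F" for k by (intro tendsto_intros v)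
  define f where "f = (\<lambda>t. if j = lo then (v t $ lo - v t $ sec) + 1 / G t * v t $ sec
     else if j = sec then (v t $ lo - v t $ sec) + 1 / G t * v t $ lo else 1 / G t * v t $ j)"
  have "(f \<longlongrightarrow> ((l $ lo - l $ sec) *\<^sub>R (axis lo 1 + axis sec 1)) $ j) F"
  proof -
    have "((\<lambda>t. (v t $ lo - v t $ sec) + 1 / G t * v t $ sec) \<longlongrightarrow> (l $ lo - l $ sec) + 0 * l $ sec) F"
      "((\<lambda>t. (v t $ lo - v t $ sec) + 1 / G t * v t $ lo) \<longlongrightarrow> (l $ lo - l $ sec) + 0 * l $ lo) F"
      "((\<lambda>t. 1 / G t * v t $ j) \<longlongrightarrow> 0 * l $ j) F"
      by (intro tendsto_intros vn e)+
    then show ?thesis using s by (auto simp: f_def axis_def)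
  qed
  moreover have "\<forall>\<^sub>F t in F. f t = ((1 / G t) *\<^sub>R bump (G t) sec (v t)) $ j"
    using G0 s by (auto elim!: eventually_mono simp: f_def bump_def below_sec[OF s] field_simps)
  ultimately show "((\<lambda>t. ((1 / G t) *\<^sub>R bump (G t) sec (v t)) $ j) \<longlongrightarrow>
      ((l $ lo - l $ sec) *\<^sub>R (axis lo 1 + axis sec 1)) $ j) F"
    by (rule Lim_transform_eventually)
qed

text \<open>The direction to which a collision of the lowest pair with large coefficient draws
  everything.\<close>

definition hv :: "'n::{finite,linorder} rvec" where "hv = axis lo 1 + axis sec 1"

text \<open>A bump grows like \<open>G\<close> whereas the positions are divided by the square of
  \<open>G\<close>; they vanish in the limit and only a velocity along \<open>hv\<close>
  survives.\<close>

lemma bump2_large: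
  assumes s: "(sec::'n::{finite,linorder}) \<noteq> lo" and G: "filterlim G at_top F" and gG: "\<And>t. g t $ sec = G t"
    and v: "(v \<longlongrightarrow> l) F"
  shows "((\<lambda>t. scale (1 / G t) (bump2 (g t) (v t :: 'n phase))) \<longlongrightarrow> (0, (snd l $ lo - snd l $ sec) *\<^sub>R hv)) F"
    "((\<lambda>t. dscale (1 / G t) (1 / G t) (bump2 (g t) (v t :: 'n phase))) \<longlongrightarrow> (0, (snd l $ lo - snd l $ sec) *\<^sub>R hv)) F"
proof -
  have e: "((\<lambda>t. 1 / G t) \<longlongrightarrow> 0) F"
    using tendsto_inverse_0_at_top[OF G] by (simp add: divide_inverse)
  have 1: "((\<lambda>t. (1 / G t) *\<^sub>R ((1 / G t) *\<^sub>R bump (G t) sec (fst (v t)))) \<longlongrightarrow> 0 *\<^sub>R ((fst l $ lo - fst l $ sec) *\<^sub>R hv)) F"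
    unfolding hv_def by (intro tendsto_scaleR e bump_large s G tendsto_fst v)
  have 2: "((\<lambda>t. (1 / G t) *\<^sub>R bump (G t) sec (snd (v t))) \<longlongrightarrow> (snd l $ lo - snd l $ sec) *\<^sub>R hv) F"
    unfolding hv_def by (intro bump_large s G tendsto_snd v)
  show "((\<lambda>t. scale (1 / G t) (bump2 (g t) (v t))) \<longlongrightarrow> (0, (snd l $ lo - snd l $ sec) *\<^sub>R hv)) F"
    "((\<lambda>t. dscale (1 / G t) (1 / G t) (bump2 (g t) (v t :: 'n phase))) \<longlongrightarrow> (0, (snd l $ lo - snd l $ sec) *\<^sub>R hv)) F"
    using tendsto_Pair[OF 1 2] gG
    by (simp_all add: scale_def dscale_def bump2_def power2_eq_square)
qed

definition gams :: "'n::{finite,linorder} rvec \<Rightarrow> 'n rvec" where "gams m = (\<chi> i. gam m i)"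

text \<open>The collision coefficients of \<open>m\<close> with the lowest one replaced by \<open>G\<close>; for \<open>G > 1\<close> they belong to
  a negative mass of the lowest particle.\<close>

definition gmod :: "real \<Rightarrow> 'n::{finite,linorder} rvec \<Rightarrow> 'n rvec" where
  "gmod G m = (\<chi> i. if i = sec then G else gam m i)"

text \<open>The value at \<open>lo\<close> solves \<open>(m1 - m2) / (m1 + m2) = G\<close> for the
  lowest mass \<open>m1\<close>.\<close>

definition mmod :: "real \<Rightarrow> 'n::{finite,linorder} rvec \<Rightarrow> 'n rvec" where
  "mmod G m = (\<chi> i. if i = lo then m $ sec * (1 + G) / (1 - G) else m $ i)"

lemma masses_mod:
  assumes m: "\<And>i. 0 < m $ i" and s: "(sec::'n::{finite,linorder}) \<noteq> lo" and G: "1 < G"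
  shows "masses (mmod G m) (gmod G (m :: 'n rvec))"
proof
  show "mmod G m $ i \<noteq> 0" for i using m[of i] m[of sec] G by (auto simp: mmod_def less_le)
  show "mmod G m $ below i + mmod G m $ i \<noteq> 0" if i: "i \<noteq> lo" for i
  proof (cases "i = sec")
    case True
    have "mmod G m $ below i + mmod G m $ i = 2 * m $ sec / (1 - G)"
      using True s G by (simp add: mmod_def below_sec[OF s] field_simps)
    then show ?thesis using m[of sec] G by simp
  next
    case False
    then have "sec < i" using sec_le[OF i] by simp
    then have "below i \<noteq> lo" using sec_le_below[of i] s by (metis lo_le order_antisym)
    then show ?thesis using i m[of i] m[of "below i"] by (simp add: mmod_def)
  qed
  show "gmod G m $ i = gam (mmod G m) i" if i: "i \<noteq> lo" for i
  proof (cases "i = sec")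
    case True
    have "mmod G m $ below i + mmod G m $ i = 2 * m $ sec / (1 - G)"
      "mmod G m $ below i - mmod G m $ i = 2 * G * m $ sec / (1 - G)"
      using True s G by (simp_all add: mmod_def below_sec[OF s] field_simps)
    then show ?thesis using True m[of sec] G by (simp add: gmod_def gam_def)
  next
    case False
    then have "sec < i" using sec_le[OF i] by simp
    then have "below i \<noteq> lo" using sec_le_below[of i] s by (metis lo_le order_antisym)
    then show ?thesis using i False by (simp add: gmod_def gam_def mmod_def)
  qed
  show "(sec::'n) \<noteq> lo" by (rule s)
qed

lemma ups_gmod: "\<forall>i\<in>set vs. sec < i \<Longrightarrow> ups (gmod G m) vs = ups (gams m) vs"
  by (rule ext, rule ups_cong) (auto simp: gmod_def gams_def)

lemma seg_gmod:
  "\<forall>i\<in>set (snd \<sigma>). sec < i \<Longrightarrow> seg (gmod G m) \<sigma> = seg (gams m) \<sigma>"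
  "\<forall>i\<in>set (snd \<sigma>). sec < i \<Longrightarrow> dseg (gmod G m) \<sigma> = dseg (gams m) \<sigma>"
  by (auto simp: fun_eq_iff seg_def dseg_def ups_gmod)

text \<open>A word is an isometry of the mass product, which is positive definite here; so the
  \<open>sec\<close> entry of the image of a unit vector is at most 1 in absolute value, with
  equality only for plus or minus that vector. Conservation of momentum excludes the minus
  sign.\<close>

lemma upper_unit:
  fixes m :: "'n::{finite,linorder} rvec"
  assumes m: "\<And>i. 0 < m $ i" and vs: "\<forall>i\<in>set vs. sec < i"
  defines "u \<equiv> ups (gams m) vs (axis sec 1)"
  shows "u $ sec \<le> 1" "- 1 < u $ sec" "u $ sec = 1 \<Longrightarrow> u = axis sec 1"
proof -
  have m2: "m $ below i + m $ i \<noteq> 0" for i using m[of i] m[of "below i"] by simp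
  have "ip m u u = ip m (axis sec 1) (axis sec 1)" "mom m u = mom m (axis sec 1)"
    unfolding u_def by (rule ups_ip[OF vs m2]; simp add: gams_def)+
  then have e: "ip m u u = m $ sec" "mom m u = m $ sec" by (simp_all add: ip_axis mom_axis)
  have sp: "ip m u u = m $ sec * (u $ sec)\<^sup>2 + (\<Sum>k\<in>UNIV - {sec}. m $ k * (u $ k)\<^sup>2)"
    by (simp add: ip_def sum.remove[of UNIV sec] power2_eq_square mult.assoc)
  have nn: "0 \<le> (\<Sum>k\<in>UNIV - {sec}. m $ k * (u $ k)\<^sup>2)" using m by (intro sum_nonneg) (simp add: less_imp_le)
  have "m $ sec * (u $ sec)\<^sup>2 \<le> m $ sec * 1" using e sp nn by simp
  then have sq: "(u $ sec)\<^sup>2 \<le> 1" using m[of sec] by (simp only: mult_le_cancel_left_pos)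
  then have ab: "\<bar>u $ sec\<bar> \<le> 1" by (simp add: abs_square_le_1)
  have one: "u = (u $ sec) *\<^sub>R axis sec 1" if "(u $ sec)\<^sup>2 = 1"
  proof -
    have "(\<Sum>k\<in>UNIV - {sec}. m $ k * (u $ k)\<^sup>2) = 0" using e sp that by simp
    then have "\<forall>k\<in>UNIV - {sec}. m $ k * (u $ k)\<^sup>2 = 0"
      using m by (subst (asm) sum_nonneg_eq_0_iff) (auto simp: less_imp_le)
    then have "u $ k = 0" if "k \<noteq> sec" for k using that m[of k] by (auto simp: less_le)
    then show ?thesis by (auto simp: vec_eq_iff axis_def)
  qed
  show "u $ sec \<le> 1" using ab by simp
  show "u $ sec = 1 \<Longrightarrow> u = axis sec 1" using one by simp
  have "u $ sec \<noteq> - 1"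
  proof
    assume "u $ sec = - 1"
    then have "u = - axis sec 1" using one by simp
    then have "mom m u = - m $ sec" by (simp add: mom_def sum_axis sum_negf)
    then show False using e m[of sec] by simp
  qed
  then show "- 1 < u $ sec" using ab by simp
qed

text \<open>Here \<open>0 \<le> 1 - u $ sec < 2\<close>, so that the even number \<open>2 r s\<close> can only cancel it if both are zero.\<close>

lemma amplification_nz:
  fixes m :: "'n::{finite,linorder} rvec" and r :: nat
  assumes m: "\<And>i. 0 < m $ i" and vs: "\<forall>i\<in>set vs. sec < i" and s: "s\<^sup>2 = (1::real)"
    and r: "r \<noteq> 0 \<or> ups (gams m) vs (axis sec 1) \<noteq> axis sec 1"
  shows "1 + 2 * real r * s - ups (gams m) vs (axis sec 1) $ sec \<noteq> 0"
proof -
  note u = upper_unit[OF m vs]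
  consider "r = 0" | "r \<ge> 1" "s = 1" | "r \<ge> 1" "s = - 1"
    using s by (cases "r = 0") (auto simp: power2_eq_1_iff Suc_le_eq)
  then show ?thesis
  proof cases
    case 1 then show ?thesis using u r by auto
  next
    case 2 then show ?thesis using u by auto
  next
    case 3
    then have "real r \<ge> 1" by simp
    then show ?thesis using 3 u(2) by simp
  qed
qed

lemma ups_linear_simps:
  "ups g vs (x + y) = ups g vs x + ups g vs y" "ups g vs (c *\<^sub>R x) = c *\<^sub>R ups g vs x" "ups g vs 0 = 0"
  using linear_ups[of g vs] by (auto simp: linear_add linear_scale linear_0)

text \<open>The momentum of all particles but the lowest. It does not involve the varying lowest
  mass and is conserved by words, so it survives the limit.\<close>

definition um :: "'n rvec \<Rightarrow> 'n::{finite,linorder} rvec \<Rightarrow> real" where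
  "um m x = (\<Sum>k\<in>UNIV - {lo}. m $ k * x $ k)"

lemma um_eq: "um m x = mom m x - m $ lo * x $ lo"
  by (simp add: um_def mom_def sum.remove[of UNIV lo])

lemma um_linear: "um m (x + y) = um m x + um m y" "um m (x - y) = um m x - um m y" "um m (c *\<^sub>R x) = c * um m x"
  by (simp_all add: um_eq mom_add mom_diff mom_scale algebra_simps)

lemma um_axis: "um m (axis i c) = (if i = lo then 0 else m $ i * c)"
  by (simp add: um_eq mom_axis) (simp add: axis_def)

lemma tendsto_um: "(f \<longlongrightarrow> l) F \<Longrightarrow> ((\<lambda>t. um m (f t)) \<longlongrightarrow> um m l) F"
  unfolding um_def by (intro tendsto_intros)

lemma um_ups:
  fixes m :: "'n::{finite,linorder} rvec"
  assumes m: "\<And>i. 0 < m $ i" and vs: "\<forall>i\<in>set vs. sec < i"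
  shows "um m (ups (gams m) vs x) = um m x"
proof -
  have m2: "m $ below i + m $ i \<noteq> 0" for i using m[of i] m[of "below i"] by simp
  have "mom m (ups (gams m) vs x) = mom m x"
    by (rule ups_ip[OF vs m2]) (simp add: gams_def)
  then show ?thesis by (simp add: um_eq ups_lo[OF vs])
qed

text \<open>With positions zero and velocity along \<open>hv\<close> the root is a sign times
  \<open>y\<close>, thus linear in \<open>y\<close>; hence the velocities of state and tangent
  vector are mapped alike.\<close>

lemma seg_hv:
  assumes s: "(sec::'n::{finite,linorder}) \<noteq> lo" and vs: "\<forall>i\<in>set (snd \<sigma>). sec < (i::'n)"
    and y: "y \<noteq> 0" and e: "e\<^sup>2 = (1::real)"
  defines "t \<equiv> e * sgn y"
  shows "snd (seg g \<sigma> (e * \<bar>y\<bar>) (0, y *\<^sub>R hv)) =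
      y *\<^sub>R (axis lo (1 + 2 * real (fst \<sigma>) * t) + ups g (snd \<sigma>) (axis sec 1))"
    "snd (dseg g \<sigma> (e * \<bar>y\<bar>) (0, y *\<^sub>R hv) (0, z *\<^sub>R hv)) =
      z *\<^sub>R (axis lo (1 + 2 * real (fst \<sigma>) * t) + ups g (snd \<sigma>) (axis sec 1))"
    "\<exists>c. fst (dseg g \<sigma> (e * \<bar>y\<bar>) (0, y *\<^sub>R hv) (0, z *\<^sub>R hv)) = axis lo c"
    "t\<^sup>2 = 1" "e * \<bar>y\<bar> = t * y"
proof -
  show t2: "t\<^sup>2 = 1" using y e by (simp add: t_def power_mult_distrib sgn_if)
  show ey: "e * \<bar>y\<bar> = t * y" by (simp add: t_def abs_sgn mult_ac)
  have hl: "(hv :: 'n rvec) $ lo = 1" using s by (simp add: hv_def axis_def)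
  have add_axis: "axis lo a + axis lo b = (axis lo (a + b) :: 'n rvec)" for a b :: real
    by (auto simp: axis_def vec_eq_iff)
  have key: "y' *\<^sub>R hv + axis lo (2 * (real (fst \<sigma>) * (t * y'))) = axis lo (y' * (1 + 2 * real (fst \<sigma>) * t)) + (y' *\<^sub>R axis sec 1 :: 'n rvec)" for y'
    by (auto simp: hv_def axis_def vec_eq_iff algebra_simps)
  show "snd (seg g \<sigma> (e * \<bar>y\<bar>) (0, y *\<^sub>R hv)) =
      y *\<^sub>R (axis lo (1 + 2 * real (fst \<sigma>) * t) + ups g (snd \<sigma>) (axis sec 1))"
    unfolding seg_def kick_def ey snd_map_prod snd_conv key ups_linear_simps ups_axis_lo[OF vs]
    by (simp add: scaleR_add_right axis_scaleR)
  have tt: "t * t = 1" using t2 by (simp add: power2_eq_square)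
  have dr: "droot (e * \<bar>y\<bar>) (0, y *\<^sub>R hv) (0, z *\<^sub>R (hv :: 'n rvec)) = t * z"
    unfolding ey droot_def using y t2 hl by (auto simp: power2_eq_1_iff)
  show "snd (dseg g \<sigma> (e * \<bar>y\<bar>) (0, y *\<^sub>R hv) (0, z *\<^sub>R hv)) =
      z *\<^sub>R (axis lo (1 + 2 * real (fst \<sigma>) * t) + ups g (snd \<sigma>) (axis sec 1))"
    unfolding dseg_def dkick_def dr snd_map_prod snd_conv key ups_linear_simps ups_axis_lo[OF vs]
    by (simp add: scaleR_add_right axis_scaleR)
  have "0 - axis lo a = (axis lo (- a) :: 'n rvec)" for a :: real by (auto simp: axis_def vec_eq_iff)
  then show "\<exists>c. fst (dseg g \<sigma> (e * \<bar>y\<bar>) (0, y *\<^sub>R hv) (0, z *\<^sub>R hv)) = axis lo c"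
    unfolding dseg_def dkick_def fst_map_prod fst_conv by (metis ups_axis_lo[OF vs])
qed

text \<open>The filter is arbitrary because the limits are later taken along a subfilter on which
  focusing is assumed. The initial state may vary along it.\<close>

locale large =
  fixes m :: "'n::{finite,linorder} rvec" and F :: "'i filter" and G :: "'i \<Rightarrow> real" and x :: "'i \<Rightarrow> 'n phase"
    and w :: "nat \<Rightarrow> 'n stage" and \<epsilon> :: "nat \<Rightarrow> real"
  assumes m_pos: "\<And>i. 0 < m $ i" and sec_lo: "(sec::'n) \<noteq> lo" and G: "filterlim G at_top F"
    and wok: "\<And>k. \<forall>i\<in>set (snd (w k)). sec < i" and eps: "\<And>k. (\<epsilon> k)\<^sup>2 = 1"
begin

abbreviation "g t \<equiv> gmod (G t) m"
abbreviation "P k t \<equiv> bpre (g t) w \<epsilon> (x t) k"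
abbreviation "S k t \<equiv> bst (g t) w \<epsilon> (x t) k"
abbreviation "V k t \<equiv> broot (g t) w \<epsilon> (x t) k"
abbreviation "U k \<equiv> ups (gams m) (snd (w k))"

lemma g_sec: "g t $ sec = G t" by (simp add: gmod_def)

lemma G_pos: "\<forall>\<^sub>F t in F. 0 < G t"
  using filterlim_at_top_dense[THEN iffD1, OF G] by blast

lemma root_scale: "0 < c \<Longrightarrow> e * sqrt (rad (scale c s)) = c * (e * sqrt (rad s))"
  by (simp add: rad_scale real_sqrt_mult)

text \<open>The root scales like a velocity, so a rescaled stage is the same stage at the rescaled
  state. It is independent of \<open>G\<close>, and it is differentiable at the limit because the
  limiting radicand is positive.\<close>

lemma stage_limit:
  assumes c: "\<forall>\<^sub>F t in F. 0 < c t" and l: "((\<lambda>t. scale (c t) (P k t)) \<longlongrightarrow> l) F" and pos: "0 < rad l"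
  shows "\<forall>\<^sub>F t in F. 0 < rad (P k t)"
    "((\<lambda>t. c t * V k t) \<longlongrightarrow> \<epsilon> k * sqrt (rad l)) F"
    "((\<lambda>t. scale (c t) (S k t)) \<longlongrightarrow> seg (gams m) (w k) (\<epsilon> k * sqrt (rad l)) l) F"
    "((\<lambda>t. dscale (c t) (b t) (d t)) \<longlongrightarrow> e) F \<Longrightarrow>
      ((\<lambda>t. dscale (c t) (b t) (dseg (g t) (w k) (V k t) (P k t) (d t)))
        \<longlongrightarrow> dseg (gams m) (w k) (\<epsilon> k * sqrt (rad l)) l e) F"
proof -
  have lr: "((\<lambda>t. rad (scale (c t) (P k t))) \<longlongrightarrow> rad l) F" by (rule tendsto_rad[OF l])
  have "\<forall>\<^sub>F t in F. 0 < rad (scale (c t) (P k t))" using order_tendstoD(1)[OF lr pos] .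
  then show "\<forall>\<^sub>F t in F. 0 < rad (P k t)"
    using c by eventually_elim (simp add: rad_scale zero_less_mult_iff)
  have lV: "((\<lambda>t. \<epsilon> k * sqrt (rad (scale (c t) (P k t)))) \<longlongrightarrow> \<epsilon> k * sqrt (rad l)) F"
    by (intro tendsto_intros lr)
  then show lV': "((\<lambda>t. c t * V k t) \<longlongrightarrow> \<epsilon> k * sqrt (rad l)) F"
    by (rule Lim_transform_eventually) (use c in eventually_elim, simp add: root_scale broot_def)
  have sg: "scale c' (S k t) = seg (gams m) (w k) (c' * V k t) (scale c' (P k t))" for c' t
    unfolding bst_def scale_seg seg_gmod(1)[OF wok] by simp
  show "((\<lambda>t. scale (c t) (S k t)) \<longlongrightarrow> seg (gams m) (w k) (\<epsilon> k * sqrt (rad l)) l) F"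
    unfolding sg by (rule tendsto_seg[OF l lV'])
  assume d: "((\<lambda>t. dscale (c t) (b t) (d t)) \<longlongrightarrow> e) F"
  have "\<epsilon> k * sqrt (rad l) \<noteq> 0" using pos eps[of k] by auto
  from tendsto_dseg[OF l lV' d this, of "gams m" "w k"]
  have "((\<lambda>t. dseg (gams m) (w k) (c t * V k t) (scale (c t) (P k t)) (dscale (c t) (b t) (d t)))
        \<longlongrightarrow> dseg (gams m) (w k) (\<epsilon> k * sqrt (rad l)) l e) F" .
  then show "((\<lambda>t. dscale (c t) (b t) (dseg (g t) (w k) (V k t) (P k t) (d t)))
        \<longlongrightarrow> dseg (gams m) (w k) (\<epsilon> k * sqrt (rad l)) l e) F"
    by (rule Lim_transform_eventually)
      (use c in eventually_elim, simp add: dscale_dseg seg_gmod(2)[OF wok])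
qed

lemma bump_limit:
  assumes l: "((\<lambda>t. scale (c t) (S k t)) \<longlongrightarrow> l) F"
  shows "((\<lambda>t. scale (c t / G t) (P (Suc k) t)) \<longlongrightarrow> (0, (snd l $ lo - snd l $ sec) *\<^sub>R hv)) F"
    "((\<lambda>t. dscale (c t) (b t) (dst (g t) w \<epsilon> (x t) (d t) k)) \<longlongrightarrow> e) F \<Longrightarrow>
      ((\<lambda>t. dscale (c t / G t) (b t / G t) (dpre (g t) w \<epsilon> (x t) (d t) (Suc k)))
        \<longlongrightarrow> (0, (snd e $ lo - snd e $ sec) *\<^sub>R hv)) F"
proof -
  show "((\<lambda>t. scale (c t / G t) (P (Suc k) t)) \<longlongrightarrow> (0, (snd l $ lo - snd l $ sec) *\<^sub>R hv)) F"
    using bump2_large(1)[OF sec_lo G g_sec l]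
    by (simp add: bpre_Suc scale_bump2[symmetric] scale_scale del: bpre.simps)
  assume d: "((\<lambda>t. dscale (c t) (b t) (dst (g t) w \<epsilon> (x t) (d t) k)) \<longlongrightarrow> e) F"
  show "((\<lambda>t. dscale (c t / G t) (b t / G t) (dpre (g t) w \<epsilon> (x t) (d t) (Suc k)))
        \<longlongrightarrow> (0, (snd e $ lo - snd e $ sec) *\<^sub>R hv)) F"
    using bump2_large(2)[OF sec_lo G g_sec d]
    by (simp add: dpre_Suc dscale_bump2[symmetric] dscale_dscale del: dpre.simps)
qed

lemma rad_hv: "rad (0, y *\<^sub>R (hv :: 'n rvec)) = y\<^sup>2"
  using sec_lo by (simp add: rad_def hv_def axis_def)

lemma sec_ups: "ups (gams m) (snd (w k)) (axis lo c) $ sec = 0" "ups (gams m) (snd (w k)) (axis sec c) $ lo = 0"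
  using sec_lo by (simp_all add: ups_axis_lo[OF wok] ups_lo[OF wok]) (simp_all add: axis_def)

text \<open>Once the rescaled state lies along \<open>hv\<close>, each further stage with its bump
  multiplies the limits of state and tangent vector by the same factor \<open>lam\<close>, nonzero
  by \<open>amplification_nz\<close>. A nonzero tangent limit therefore stays nonzero.\<close>

lemma hv_limits:
  assumes k0: "1 \<le> k0"
    and c: "\<forall>\<^sub>F t in F. 0 < c t" and l: "((\<lambda>t. scale (c t) (P k0 t)) \<longlongrightarrow> (0, y *\<^sub>R hv)) F" "y \<noteq> 0"
    and d: "((\<lambda>t. dscale (c t) (b t) (dpre (g t) w \<epsilon> (x t) (d t) k0)) \<longlongrightarrow> (0, z *\<^sub>R hv)) F"
    and amp: "\<And>k. k0 \<le> k \<Longrightarrow> k < n \<Longrightarrow> fst (w k) \<noteq> 0 \<or> U k (axis sec 1) \<noteq> axis sec 1"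
    and kn: "k0 \<le> k" "k \<le> n"
  shows "\<exists>y' q c' b'. y' \<noteq> 0 \<and> q \<noteq> 0 \<and> (\<forall>\<^sub>F t in F. 0 < c' t) \<and>
     ((\<lambda>t. scale (c' t) (P k t)) \<longlongrightarrow> (0, y' *\<^sub>R hv)) F \<and>
     ((\<lambda>t. dscale (c' t) (b' t) (dpre (g t) w \<epsilon> (x t) (d t) k)) \<longlongrightarrow> (0, (q * z) *\<^sub>R hv)) F \<and>
     (\<forall>\<^sub>F t in F. b t \<noteq> 0 \<longrightarrow> b' t \<noteq> 0)"
  using kn
proof (induction k rule: dec_induct)
  case base
  show ?case
    using c l d by (intro exI[of _ y] exI[of _ 1] exI[of _ c] exI[of _ b]) auto
next
  case (step k)
  then obtain y' q c' b' where h: "y' \<noteq> 0" "q \<noteq> 0" "\<forall>\<^sub>F t in F. 0 < c' t"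
    "((\<lambda>t. scale (c' t) (P k t)) \<longlongrightarrow> (0, y' *\<^sub>R hv)) F"
    "((\<lambda>t. dscale (c' t) (b' t) (dpre (g t) w \<epsilon> (x t) (d t) k)) \<longlongrightarrow> (0, (q * z) *\<^sub>R hv)) F"
    "\<forall>\<^sub>F t in F. b t \<noteq> 0 \<longrightarrow> b' t \<noteq> 0"
    by auto
  have pos: "0 < rad (0, y' *\<^sub>R (hv :: 'n rvec))" using h(1) by (simp add: rad_hv)
  note lim = stage_limit[OF h(3,4) pos]
  define t where "t = \<epsilon> k * sgn y'"
  define lam where "lam = 1 + 2 * real (fst (w k)) * t - U k (axis sec 1) $ sec"
  note sh = seg_hv[OF sec_lo wok[of k] h(1) eps[of k], folded t_def]
  have lam: "lam \<noteq> 0"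
    unfolding lam_def by (rule amplification_nz[OF m_pos wok sh(4)]) (use amp step in auto)
  note bl = bump_limit(1)[OF lim(3), unfolded rad_hv real_sqrt_abs]
  have S: "((\<lambda>t. scale (c' t / G t) (P (Suc k) t)) \<longlongrightarrow> (0, (y' * lam) *\<^sub>R hv)) F"
    using bl unfolding sh(1)
    by (simp add: sec_ups axis_def[of lo] sec_lo lam_def algebra_simps del: bpre.simps)
  have dl: "((\<lambda>t. dscale (c' t) (b' t) (dst (g t) w \<epsilon> (x t) (d t) k)) \<longlongrightarrow>
     dseg (gams m) (w k) (\<epsilon> k * \<bar>y'\<bar>) (0, y' *\<^sub>R hv) (0, (q * z) *\<^sub>R hv)) F"
    using lim(4)[OF h(5)] by (simp add: dst_def rad_hv)
  have T: "((\<lambda>t. dscale (c' t / G t) (b' t / G t) (dpre (g t) w \<epsilon> (x t) (d t) (Suc k)))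
        \<longlongrightarrow> (0, (q * lam * z) *\<^sub>R hv)) F"
    using bump_limit(2)[OF lim(3) dl] unfolding sh(2)
    by (simp add: sec_ups axis_def[of lo] sec_lo lam_def algebra_simps del: dpre.simps)
  have c': "\<forall>\<^sub>F t in F. 0 < c' t / G t" using h(3) G_pos by eventually_elim simp
  have b': "\<forall>\<^sub>F t in F. b t \<noteq> 0 \<longrightarrow> b' t / G t \<noteq> 0" using h(6) G_pos by eventually_elim simp
  show ?case
    using h(1,2) lam c' b' S T
    by (intro exI[of _ "y' * lam"] exI[of _ "q * lam"] exI[of _ "\<lambda>t. c' t / G t"] exI[of _ "\<lambda>t. b' t / G t"]) auto
qed

end

lemma um_mmod_nv:
  fixes m :: "'n::{finite,linorder} rvec"
  assumes m: "\<And>i. 0 < m $ i" and s: "(sec::'n) \<noteq> lo"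
  shows "um m (nv (mmod G m) k) = (if k = sec then 1 else 0)"
proof -
  have b: "below k \<noteq> lo" if "k \<noteq> lo" "k \<noteq> sec"
  proof -
    have "sec < k" using that sec_le[of k] by simp
    then show ?thesis using sec_le_below[of k] s by (metis lo_le order_antisym)
  qed
  show ?thesis
    using m[of k] m[of "below k"] s b
    by (auto simp: nv_def um_linear um_axis mmod_def below_sec[OF s])
qed

lemma nv_mmod_upper:
  fixes m :: "'n::{finite,linorder} rvec"
  assumes s: "(sec::'n) \<noteq> lo" and k: "sec < k"
  shows "nv (mmod G m) k = nv m k" "nv m k $ lo = 0"
proof -
  have "below k \<noteq> lo" using sec_le_below[OF k] s by (metis lo_le order_antisym)
  moreover have "k \<noteq> lo" using k by (metis lo_le not_le)
  ultimately show "nv (mmod G m) k = nv m k" "nv m k $ lo = 0" by (auto simp: nv_def mmod_def axis_def)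
qed

text \<open>In the limit the two lowest masses cancel; the lowest mass itself stays finite, so the
  normals have limits.\<close>

lemma mmod_lo_limit:
  assumes "filterlim G at_top F"
  shows "((\<lambda>t. mmod (G t) m $ lo) \<longlongrightarrow> - m $ sec) F"
proof -
  have e: "((\<lambda>t. 1 / G t) \<longlongrightarrow> 0) F"
    using tendsto_inverse_0_at_top[OF assms] by (simp add: divide_inverse)
  have "((\<lambda>t. m $ sec * (1 / G t + 1) / (1 / G t - 1)) \<longlongrightarrow> m $ sec * (0 + 1) / (0 - 1)) F"
    by (intro tendsto_intros e) simp
  moreover have "\<forall>\<^sub>F t in F. m $ sec * (1 / G t + 1) / (1 / G t - 1) = mmod (G t) m $ lo"
    using filterlim_at_top_dense[THEN iffD1, OF assms, rule_format, of 1]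
    by eventually_elim (simp add: mmod_def field_simps)
  ultimately have "((\<lambda>t. mmod (G t) m $ lo) \<longlongrightarrow> m $ sec * (0 + 1) / (0 - 1)) F"
    by (rule Lim_transform_eventually)
  then show ?thesis by simp
qed

context large
begin

text \<open>The velocity part of the tangent vector tends to a multiple of
  \<open>axis lo (1 + 2 * r * \<tau>) + u\<close> with nonzero upper momentum. Membership in the
  span of the final normals is refuted according to whether \<open>sec\<close> is \<open>i\<close>,
  \<open>j\<close> or neither.\<close>

lemma not_focus:
  assumes F: "F \<noteq> bot" and ij: "i < j"
    and c: "\<forall>\<^sub>F t in F. 0 < c t" and l: "((\<lambda>t. scale (c t) (P n t)) \<longlongrightarrow> (0, y *\<^sub>R hv)) F" "y \<noteq> 0"
    and d: "((\<lambda>t. dscale (c t) (b t) (dpre (g t) w \<epsilon> (x t) (d t) n)) \<longlongrightarrow> (0, z *\<^sub>R hv)) F" "z \<noteq> 0"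
    and foc: "\<forall>\<^sub>F t in F. masses.focus (mmod (G t) m) i j (V n t) (S n t) (dst (g t) w \<epsilon> (x t) (d t) n)"
    and nd1: "i = sec \<Longrightarrow> fst (w n) = 0 \<Longrightarrow> U n (axis sec 1) \<notin> span {axis sec 1, nv m j}"
    and nd2: "j = sec \<Longrightarrow> fst (w n) = 0 \<Longrightarrow> U n (axis sec 1) \<noteq> axis sec 1"
  shows False
proof -
  define r where "r = real (fst (w n))"
  define u where "u = U n (axis sec 1)"
  define \<tau> where "\<tau> = \<epsilon> n * sgn y"
  let ?D = "\<lambda>t. dst (g t) w \<epsilon> (x t) (d t) n"
  note sh = seg_hv[OF sec_lo wok[of n] l(2) eps[of n], folded \<tau>_def r_def]
  have pos: "0 < rad (0, y *\<^sub>R (hv :: 'n rvec))" using l(2) by (simp add: rad_hv)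
  note lim = stage_limit[OF c l(1) pos, unfolded rad_hv real_sqrt_abs]
  have G1: "\<forall>\<^sub>F t in F. 1 < G t" using filterlim_at_top_dense[THEN iffD1, OF G] by blast
  have foc': "\<forall>\<^sub>F t in F. snd (?D t) \<in> span {nv (mmod (G t) m) i, nv (mmod (G t) m) j} \<and>
     (snd (?D t) = 0 \<or> (\<exists>t0. fst (?D t) = - t0 *\<^sub>R snd (?D t) \<and> (i = lo \<longrightarrow> t0 = snd (S n t) $ lo + V n t)))"
    using foc G1
  proof eventually_elim
    case (elim t)
    interpret masses "mmod (G t) m" "gmod (G t) m" by (rule masses_mod[OF m_pos sec_lo elim(2)])
    show ?case using elim(1) unfolding focus_def by blast
  qed
  obtain \<phi> where \<phi>: "fst (dseg (gams m) (w n) (\<epsilon> n * \<bar>y\<bar>) (0, y *\<^sub>R hv) (0, z *\<^sub>R hv)) = axis lo \<phi>"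
    using sh(3) by blast
  have dl: "((\<lambda>t. dscale (c t) (b t) (?D t)) \<longlongrightarrow> dseg (gams m) (w n) (\<epsilon> n * \<bar>y\<bar>) (0, y *\<^sub>R hv) (0, z *\<^sub>R hv)) F"
    using lim(4)[OF d(1)] by (simp add: dst_def)
  define L where "L = z *\<^sub>R (axis lo (1 + 2 * r * \<tau>) + u)"
  have ds: "((\<lambda>t. b t *\<^sub>R snd (?D t)) \<longlongrightarrow> L) F"
    using tendsto_snd[OF dl] by (simp add: sh(2) dscale_def L_def u_def)
  have df: "((\<lambda>t. (c t * b t) *\<^sub>R fst (?D t)) \<longlongrightarrow> axis lo \<phi>) F"
    using tendsto_fst[OF dl] by (simp add: \<phi> dscale_def)
  have ulo: "u $ lo = 0" using sec_ups(2)[of n 1] by (simp add: u_def)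
  have umu: "um m u = m $ sec" unfolding u_def using um_ups[OF m_pos wok] sec_lo by (simp add: um_axis)
  have umL: "um m L = z * m $ sec" by (simp add: L_def um_linear um_axis umu)
  have Llo: "L $ lo = z * (1 + 2 * r * \<tau>)" by (simp add: L_def ulo axis_def)
  have umds: "((\<lambda>t. um m (b t *\<^sub>R snd (?D t))) \<longlongrightarrow> z * m $ sec) F"
    using tendsto_um[OF ds, of m] umL by simp
  have zm: "z * m $ sec \<noteq> 0" using d(2) m_pos[of sec] by simp
  have bs: "\<forall>\<^sub>F t in F. \<exists>\<alpha> \<beta>. b t *\<^sub>R snd (?D t) = \<alpha> *\<^sub>R nv (mmod (G t) m) i + \<beta> *\<^sub>R nv (mmod (G t) m) j"
    using foc'
  proof eventually_elim
    case (elim t)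
    then have "b t *\<^sub>R snd (?D t) \<in> span {nv (mmod (G t) m) i, nv (mmod (G t) m) j}" by (auto intro: span_scale)
    then show ?case unfolding span_pair by blast
  qed
  have jlo: "j \<noteq> lo" using ij by (metis lo_le not_le)
  have closedW: "closed (span W)" for W :: "'n rvec set" by (rule closed_subspace) simp
  have upl: "((\<lambda>t. b t *\<^sub>R snd (?D t) - axis lo ((b t *\<^sub>R snd (?D t)) $ lo)) \<longlongrightarrow> z *\<^sub>R u) F"
  proof -
    have "L - axis lo (L $ lo) = z *\<^sub>R u"
      unfolding Llo by (simp add: L_def scaleR_add_right axis_scaleR)
    then show ?thesis
      using tendsto_diff[OF ds tendsto_axis[OF tendsto_vec_nth[OF ds, of lo], of lo]] by simp
  qed
  have inW: "u \<in> span W"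
    if "\<forall>\<^sub>F t in F. b t *\<^sub>R snd (?D t) - axis lo ((b t *\<^sub>R snd (?D t)) $ lo) \<in> span W" for W
  proof -
    have "z *\<^sub>R u \<in> span W" by (rule Lim_in_closed_set[OF closedW that F upl])
    then have "(1 / z) *\<^sub>R (z *\<^sub>R u) \<in> span W" by (rule span_scale)
    then show ?thesis using d(2) by simp
  qed
  consider "i \<noteq> sec" "j \<noteq> sec" | "i = sec" "sec < j" | "j = sec" "i = lo"
    using ij sec_le[of i] by (metis not_le)
  then show False
  proof cases
    case 1
    \<comment> \<open>Only the normal of \<open>sec\<close> carries upper momentum.\<close>
    have "\<forall>\<^sub>F t in F. um m (b t *\<^sub>R snd (?D t)) = 0"
      using bs
    proof eventually_elim
      case (elim t)
      then obtain \<alpha> \<beta> where e: "b t *\<^sub>R snd (?D t) = \<alpha> *\<^sub>R nv (mmod (G t) m) i + \<beta> *\<^sub>R nv (mmod (G t) m) j" by blast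
      show ?case unfolding e using 1 by (simp add: um_linear um_mmod_nv[OF m_pos sec_lo])
    qed
    then have "((\<lambda>t. um m (b t *\<^sub>R snd (?D t))) \<longlongrightarrow> 0) F" by (simp add: tendsto_eventually)
    then show False using tendsto_unique[OF F umds] zm by blast
  next
    case 2
    have r0: "r = 0"
    proof (rule ccontr)
      assume "r \<noteq> 0"
      \<comment> \<open>Both sides come from the normal of \<open>sec\<close> alone. As the lowest
        mass tends to \<open>- m $ sec\<close>, the limit forces
        \<open>r * \<tau> = 0\<close>.\<close>
      have "\<forall>\<^sub>F t in F. (b t *\<^sub>R snd (?D t)) $ lo * mmod (G t) m $ lo = - um m (b t *\<^sub>R snd (?D t))"
        using bs G1
      proof eventually_elim
        case (elim t)
        interpret masses "mmod (G t) m" "gmod (G t) m" by (rule masses_mod[OF m_pos sec_lo elim(2)])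
        from elim(1) obtain \<alpha> \<beta> where e: "b t *\<^sub>R snd (?D t) = \<alpha> *\<^sub>R nv (mmod (G t) m) i + \<beta> *\<^sub>R nv (mmod (G t) m) j" by blast
        have "nv (mmod (G t) m) j $ lo = 0" using nv_mmod_upper[OF sec_lo 2(2)] by simp
        moreover have "nv (mmod (G t) m) i $ lo = - 1 / mmod (G t) m $ lo"
          using 2 sec_lo by (simp add: nv_def below_sec axis_def)
        ultimately show ?case
          unfolding e using 2 M_nz[of lo] by (simp add: um_linear um_mmod_nv[OF m_pos sec_lo])
      qed
      moreover have "((\<lambda>t. (b t *\<^sub>R snd (?D t)) $ lo * mmod (G t) m $ lo) \<longlongrightarrow> z * (1 + 2 * r * \<tau>) * (- m $ sec)) F"
        using tendsto_mult[OF tendsto_vec_nth[OF ds, of lo] mmod_lo_limit[OF G, of m]] Llo by simp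
      ultimately have "((\<lambda>t. - um m (b t *\<^sub>R snd (?D t))) \<longlongrightarrow> z * (1 + 2 * r * \<tau>) * (- m $ sec)) F"
        by (rule Lim_transform_eventually[rotated])
      from tendsto_unique[OF F this tendsto_minus[OF umds]] have "r * \<tau> = 0"
        using d(2) m_pos[of sec] by (simp add: algebra_simps)
      then show False using \<open>r \<noteq> 0\<close> sh(4) by auto
    qed
    \<comment> \<open>Dropping the \<open>lo\<close> component frees the final normals of the
      varying lowest mass.\<close>
    have "u \<in> span {axis sec 1, nv m j}"
    proof (rule inW)
      show "\<forall>\<^sub>F t in F. b t *\<^sub>R snd (?D t) - axis lo ((b t *\<^sub>R snd (?D t)) $ lo) \<in> span {axis sec 1, nv m j}"
        using bs
      proof eventually_elim
        case (elim t)
        then obtain \<alpha> \<beta> where e: "b t *\<^sub>R snd (?D t) = \<alpha> *\<^sub>R nv (mmod (G t) m) i + \<beta> *\<^sub>R nv (mmod (G t) m) j" by blast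
        have n: "nv (mmod (G t) m) j = nv m j" "nv m j $ lo = 0" using nv_mmod_upper[OF sec_lo 2(2)] by auto
        have n2: "nv (mmod (G t) m) i = (1 / m $ sec) *\<^sub>R axis sec 1 - axis lo (1 / mmod (G t) m $ lo)"
          using 2 sec_lo by (simp add: nv_def below_sec mmod_def axis_scaleR[symmetric])
        have "b t *\<^sub>R snd (?D t) - axis lo ((b t *\<^sub>R snd (?D t)) $ lo) = (\<alpha> / m $ sec) *\<^sub>R axis sec 1 + \<beta> *\<^sub>R nv m j"
          unfolding e n n2 using sec_lo n(2) by (auto simp: vec_eq_iff axis_def)
        then show ?case unfolding span_pair by blast
      qed
    qed
    then show False using nd1[OF 2(1)] r0 by (simp add: u_def r_def)
  next
    case 3
    have up: "u \<in> span {axis sec 1}"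
    proof (rule inW)
      show "\<forall>\<^sub>F t in F. b t *\<^sub>R snd (?D t) - axis lo ((b t *\<^sub>R snd (?D t)) $ lo) \<in> span {axis sec 1}"
        using bs
      proof eventually_elim
        case (elim t)
        then obtain \<alpha> \<beta> where e: "b t *\<^sub>R snd (?D t) = \<alpha> *\<^sub>R nv (mmod (G t) m) i + \<beta> *\<^sub>R nv (mmod (G t) m) j" by blast
        have "b t *\<^sub>R snd (?D t) - axis lo ((b t *\<^sub>R snd (?D t)) $ lo) = (\<beta> / m $ sec) *\<^sub>R axis sec 1"
          unfolding e using 3 sec_lo by (auto simp: nv_def below_sec mmod_def vec_eq_iff axis_def)
        then show ?case by (simp add: span_base span_scale)
      qed
    qed
    have "u = axis sec 1"
    proof -
      obtain \<kappa> where k: "u = \<kappa> *\<^sub>R axis sec 1" using up by (auto simp: span_singleton)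
      then show ?thesis using umu sec_lo m_pos[of sec] by (simp add: um_linear um_axis)
    qed
    then have rnz: "fst (w n) \<noteq> 0" using nd2[OF 3(1)] by (auto simp: u_def)
    have snz: "\<forall>\<^sub>F t in F. um m (b t *\<^sub>R snd (?D t)) \<noteq> 0" using tendsto_imp_eventually_ne[OF umds zm] .
    \<comment> \<open>The position part tends to a vector along \<open>lo\<close>, without upper
      momentum, while the velocity part keeps a nonzero one; so the rescaled arrival time must tend
      to zero.\<close>
    have ev: "\<forall>\<^sub>F t in F. um m ((c t * b t) *\<^sub>R fst (?D t)) =
       - (c t * snd (S n t) $ lo + c t * V n t) * um m (b t *\<^sub>R snd (?D t))"
      using foc' snz
    proof eventually_elim
      case (elim t)
      then have "snd (?D t) \<noteq> 0" by (auto simp: um_def)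
      then have "fst (?D t) = - (snd (S n t) $ lo + V n t) *\<^sub>R snd (?D t)" using elim 3 by metis
      then have "um m (fst (?D t)) = - (snd (S n t) $ lo + V n t) * um m (snd (?D t))" by (simp only: um_linear)
      then show ?case unfolding um_linear by (simp only:) (simp add: algebra_simps)
    qed
    have lm: "((\<lambda>t. - (c t * snd (S n t) $ lo + c t * V n t) * um m (b t *\<^sub>R snd (?D t)))
        \<longlongrightarrow> - (y * (1 + 2 * r * \<tau>) + \<tau> * y) * (z * m $ sec)) F"
    proof (intro tendsto_mult[OF tendsto_minus[OF tendsto_add] umds])
      show "((\<lambda>t. c t * V n t) \<longlongrightarrow> \<tau> * y) F" using lim(2) sh(5) by simp
      have "((\<lambda>t. snd (scale (c t) (S n t)) $ lo) \<longlongrightarrow> y * (1 + 2 * r * \<tau>)) F"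
        using tendsto_vec_nth[OF tendsto_snd[OF lim(3)], of lo]
        by (simp add: sh(1) ulo[unfolded u_def] axis_def[of lo])
      then show "((\<lambda>t. c t * snd (S n t) $ lo) \<longlongrightarrow> y * (1 + 2 * r * \<tau>)) F" by (simp add: scale_def)
    qed
    have "((\<lambda>t. um m ((c t * b t) *\<^sub>R fst (?D t))) \<longlongrightarrow> 0) F"
      using tendsto_um[OF df, of m] by (simp add: um_axis)
    moreover have "((\<lambda>t. um m ((c t * b t) *\<^sub>R fst (?D t))) \<longlongrightarrow> - (y * (1 + 2 * r * \<tau>) + \<tau> * y) * (z * m $ sec)) F"
      by (rule Lim_transform_eventually[OF lm]) (use ev in eventually_elim, simp)
    ultimately have "- (y * (1 + 2 * r * \<tau>) + \<tau> * y) * (z * m $ sec) = 0"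
      using tendsto_unique[OF F] by blast
    then have "y * (1 + 2 * r * \<tau> + \<tau>) * (z * m $ sec) = 0" by (simp add: algebra_simps)
    \<comment> \<open>Impossible for \<open>\<tau> = 1\<close>; for \<open>\<tau> = - 1\<close> it
      forces \<open>r = 0\<close>.\<close>
    then have "1 + 2 * r * \<tau> + \<tau> = 0" using zm l(2) by simp
    moreover have "\<tau> = 1 \<or> \<tau> = - 1" using sh(4) by (simp add: power2_eq_1_iff)
    moreover have "1 \<le> r" using rnz by (simp add: r_def)
    ultimately show False by auto
  qed
qed

end

text \<open>The words of the first \<open>k\<close> stages without floor and lowest pair: the motion
  of vectors that those collisions do not touch.\<close>

primrec uprod :: "'n rvec \<Rightarrow> (nat \<Rightarrow> 'n stage) \<Rightarrow> nat \<Rightarrow> 'n::{finite,linorder} rvec \<Rightarrow> 'n rvec" where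
  "uprod g w 0 v = v"
| "uprod g w (Suc k) v = ups g (snd (w k)) (uprod g w k v)"

lemma linear_uprod: "linear (uprod g w k)"
proof (induction k)
  case 0
  have "uprod g w 0 = id" by (auto simp: fun_eq_iff)
  then show ?case by (simp only: linear_id)
next
  case (Suc k)
  have "uprod g w (Suc k) = ups g (snd (w k)) \<circ> uprod g w k" by (auto simp: fun_eq_iff)
  then show ?case using linear_compose[OF Suc linear_ups, of g "snd (w k)"] by metis
qed

lemma uprod_lo:
  assumes "\<And>k. \<forall>i\<in>set (snd (w k)). (sec::'n::{finite,linorder}) < i"
  shows "uprod g w k v $ (lo::'n) = v $ lo"
  by (induction k) (simp_all add: ups_lo[OF assms])

lemma um_uprod:
  fixes m :: "'n::{finite,linorder} rvec"
  assumes m: "\<And>i. 0 < m $ i" and "\<And>k. \<forall>i\<in>set (snd (w k)). sec < i"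
  shows "um m (uprod (gams m) w k v) = um m v"
  by (induction k) (simp_all add: um_ups[OF assms])

context large
begin

text \<open>With zero position part and zero \<open>lo\<close> component the derivative of the root
  is zero, and a bump fixes a vector whose \<open>lo\<close> and \<open>sec\<close> components
  vanish.\<close>

lemma dst_untouched:
  assumes lo: "D $ lo = 0" and untouched: "\<And>k. k < n \<Longrightarrow> uprod (gams m) w (Suc k) D $ sec = 0"
  shows "dst (g t) w \<epsilon> y (0, D) n = (0, uprod (gams m) w (Suc n) D)"
proof -
  have seg0: "dseg (g t) (w k) W s (0, v) = (0, U k v)" if "v $ lo = 0" for k W s v
  proof -
    have "droot W s (0, v) = 0" using that by (simp add: droot_def)
    then have "dkick r W s (0, v) = (0, v)" for r
      using that by (auto simp: dkick_def axis_def vec_eq_iff)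
    then show ?thesis by (simp add: dseg_def ups_gmod[OF wok] ups_linear_simps)
  qed
  have pre0: "dpre (g t) w \<epsilon> y (0, D) k = (0, uprod (gams m) w k D)" if "k \<le> n" for k
    using that
  proof (induction k)
    case (Suc k)
    have l: "uprod (gams m) w k D $ lo = 0" "uprod (gams m) w (Suc k) D $ lo = 0"
      by (simp_all only: uprod_lo[OF wok] lo)
    have s: "uprod (gams m) w (Suc k) D $ sec = 0" using untouched Suc by simp
    have b: "bump e sec v = v" if "v $ lo = 0" "v $ sec = 0" for e and v :: "'n rvec"
      using that by (auto simp: bump_def vec_eq_iff below_sec[OF sec_lo])
    have "bump e sec (0 :: 'n rvec) = 0" for e by (rule b) auto
    then show ?case
      using Suc seg0[OF l(1)] b[OF l(2) s] by (simp add: bump2_def)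
  qed simp
  have "uprod (gams m) w n D $ lo = 0" by (simp only: uprod_lo[OF wok] lo)
  then show ?thesis by (simp add: dst_def pre0 seg0)
qed

text \<open>The initial states approach one with all positions zero, where the first root is a sign
  times the velocity of the lowest particle; in the limit the first stage acts linearly on
  velocities.\<close>

lemma initial_limit:
  assumes x: "(x \<longlongrightarrow> (0, X)) F" and X: "0 < X $ lo"
  shows "\<forall>\<^sub>F t in F. 0 < rad (P 0 t)"
    "((\<lambda>t. scale (1 / G t) (P 1 t)) \<longlongrightarrow> (0, ((1 + 2 * real (fst (w 0)) * \<epsilon> 0) * X $ lo - U 0 X $ sec) *\<^sub>R hv)) F"
    "(D \<longlongrightarrow> Z) F \<Longrightarrow> ((\<lambda>t. dscale (1 / G t) (1 / G t) (dpre (g t) w \<epsilon> (x t) (0, D t) 1)) \<longlongrightarrow>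
       (0, ((1 + 2 * real (fst (w 0)) * \<epsilon> 0) * Z $ lo - U 0 Z $ sec) *\<^sub>R hv)) F"
proof -
  have r: "rad (0, X) = (X $ lo)\<^sup>2" by (simp add: rad_def)
  have x': "((\<lambda>t. scale 1 (P 0 t)) \<longlongrightarrow> (0, X)) F" using x by (simp add: scale_def)
  have pos: "0 < rad (0, X)" using X by (simp add: r)
  have sq: "sqrt (rad (0, X)) = X $ lo" using X by (simp add: r)
  note lim = stage_limit[OF _ x' pos, unfolded sq, simplified]
  show "\<forall>\<^sub>F t in F. 0 < rad (P 0 t)" using lim(1) by simp
  have u: "U 0 (v + axis lo c) $ lo = v $ lo + c" "U 0 (v + axis lo c) $ sec = U 0 v $ sec" for v c
    using sec_ups(1)[of 0 c] by (simp_all add: ups_linear_simps ups_lo[OF wok])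
  show "((\<lambda>t. scale (1 / G t) (P 1 t)) \<longlongrightarrow> (0, ((1 + 2 * real (fst (w 0)) * \<epsilon> 0) * X $ lo - U 0 X $ sec) *\<^sub>R hv)) F"
    using bump_limit(1)[OF lim(3)]
    by (simp add: seg_def kick_def u algebra_simps del: bpre.simps)
  assume D: "(D \<longlongrightarrow> Z) F"
  have D': "((\<lambda>t. dscale 1 1 (0, D t)) \<longlongrightarrow> (0, Z)) F" by (simp add: dscale_def tendsto_Pair D)
  have dr: "droot (\<epsilon> 0 * X $ lo) (0, X) (0, Z) = \<epsilon> 0 * Z $ lo"
    using eps[of 0] X by (auto simp: droot_def power2_eq_1_iff)
  have "((\<lambda>t. dscale 1 1 (dst (g t) w \<epsilon> (x t) (0, D t) 0)) \<longlongrightarrow>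
      dseg (gams m) (w 0) (\<epsilon> 0 * X $ lo) (0, X) (0, Z)) F"
    using lim(4)[OF D'] by (simp add: dst_def)
  from bump_limit(2)[OF lim(3) this]
  show "((\<lambda>t. dscale (1 / G t) (1 / G t) (dpre (g t) w \<epsilon> (x t) (0, D t) 1)) \<longlongrightarrow>
       (0, ((1 + 2 * real (fst (w 0)) * \<epsilon> 0) * Z $ lo - U 0 Z $ sec) *\<^sub>R hv)) F"
    by (simp add: dseg_def dkick_def dr u algebra_simps del: dpre.simps)
qed

lemma invG_pos: "\<forall>\<^sub>F t in F. 0 < 1 / G t" using G_pos by eventually_elim simp

lemma state_limits:
  assumes x: "(x \<longlongrightarrow> (0, X)) F" and X: "0 < X $ lo"
    and y: "(1 + 2 * real (fst (w 0)) * \<epsilon> 0) * X $ lo - U 0 X $ sec \<noteq> 0"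
    and amp: "\<And>k. 1 \<le> k \<Longrightarrow> k < n \<Longrightarrow> fst (w k) \<noteq> 0 \<or> U k (axis sec 1) \<noteq> axis sec 1"
    and k: "1 \<le> k" "k \<le> n"
  shows "\<exists>y c. y \<noteq> 0 \<and> (\<forall>\<^sub>F t in F. 0 < c t) \<and> ((\<lambda>t. scale (c t) (P k t)) \<longlongrightarrow> (0, y *\<^sub>R hv)) F"
proof -
  \<comment> \<open>Only the states are of interest, so the zero tangent vector is fed into
    \<open>hv_limits\<close>.\<close>
  have z: "((\<lambda>t. dscale (1 / G t) (1 / G t) (dpre (g t) w \<epsilon> (x t) ((\<lambda>_. (0, 0)) t) 1)) \<longlongrightarrow> (0, 0 *\<^sub>R hv)) F"
    using initial_limit(3)[OF x X, of "\<lambda>_. 0" 0] by (simp add: ups_linear_simps)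
  from hv_limits[OF order_refl invG_pos initial_limit(2)[OF x X] y z amp k]
  show ?thesis by blast
qed

lemma rad_positive:
  assumes x: "(x \<longlongrightarrow> (0, X)) F" and X: "0 < X $ lo"
    and y: "(1 + 2 * real (fst (w 0)) * \<epsilon> 0) * X $ lo - U 0 X $ sec \<noteq> 0"
    and amp: "\<And>k. 1 \<le> k \<Longrightarrow> k < n \<Longrightarrow> fst (w k) \<noteq> 0 \<or> U k (axis sec 1) \<noteq> axis sec 1"
    and k: "k \<le> n"
  shows "\<forall>\<^sub>F t in F. 0 < rad (P k t)"
proof (cases "k = 0")
  case True then show ?thesis using initial_limit(1)[OF x X] by simp
next
  case False
  then obtain y c where h: "y \<noteq> 0" "\<forall>\<^sub>F t in F. 0 < c t" "((\<lambda>t. scale (c t) (P k t)) \<longlongrightarrow> (0, y *\<^sub>R hv)) F"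
    using state_limits[OF x X y amp, where n=n and k=k] k by auto
  show ?thesis by (rule stage_limit(1)[OF h(2,3)]) (use h(1) in \<open>simp add: rad_hv\<close>)
qed

text \<open>Some bump gives the tangent vector a nonzero limit along \<open>hv\<close>: the first
  bump, or the one after stage \<open>k\<close> if the vector lies above \<open>lo\<close> and was
  untouched before. From there \<open>hv_limits\<close> leads to the last stage, where
  \<open>not_focus\<close> applies.\<close>

lemma never_focus_touched:
  assumes F: "F \<noteq> bot" and x: "(x \<longlongrightarrow> (0, X)) F" and X: "0 < X $ lo" and D: "(D \<longlongrightarrow> Z) F"
    and y: "(1 + 2 * real (fst (w 0)) * \<epsilon> 0) * X $ lo - U 0 X $ sec \<noteq> 0"
    and amp: "\<And>k. 1 \<le> k \<Longrightarrow> k < n \<Longrightarrow> fst (w k) \<noteq> 0 \<or> U k (axis sec 1) \<noteq> axis sec 1"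
    and n: "1 \<le> n" and ij: "i < j"
    and touch: "(1 + 2 * real (fst (w 0)) * \<epsilon> 0) * Z $ lo - U 0 Z $ sec \<noteq> 0 \<or>
      (\<exists>k<n. (\<forall>t. D t $ lo = 0) \<and> (\<forall>t. \<forall>k'<k. uprod (gams m) w (Suc k') (D t) $ sec = 0) \<and> uprod (gams m) w (Suc k) Z $ sec \<noteq> 0)"
    and foc: "\<forall>\<^sub>F t in F. masses.focus (mmod (G t) m) i j (V n t) (S n t) (dst (g t) w \<epsilon> (x t) (0, D t) n)"
    and nd1: "i = sec \<Longrightarrow> fst (w n) = 0 \<Longrightarrow> U n (axis sec 1) \<notin> span {axis sec 1, nv m j}"
    and nd2: "j = sec \<Longrightarrow> fst (w n) = 0 \<Longrightarrow> U n (axis sec 1) \<noteq> axis sec 1"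
  shows False
proof -
  obtain k0 c b y1 z1 where k0: "1 \<le> k0" "k0 \<le> n" and c: "\<forall>\<^sub>F t in F. 0 < c t"
    and S: "((\<lambda>t. scale (c t) (P k0 t)) \<longlongrightarrow> (0, y1 *\<^sub>R hv)) F" "y1 \<noteq> 0"
    and T: "((\<lambda>t. dscale (c t) (b t) (dpre (g t) w \<epsilon> (x t) (0, D t) k0)) \<longlongrightarrow> (0, z1 *\<^sub>R hv)) F" "z1 \<noteq> 0"
    using touch
  proof
    assume "(1 + 2 * real (fst (w 0)) * \<epsilon> 0) * Z $ lo - U 0 Z $ sec \<noteq> 0"
    then show thesis
      by (rule that[OF order_refl n invG_pos initial_limit(2)[OF x X] y initial_limit(3)[OF x X D]])
  next
    assume "\<exists>k<n. (\<forall>t. D t $ lo = 0) \<and> (\<forall>t. \<forall>k'<k. uprod (gams m) w (Suc k') (D t) $ sec = 0) \<and> uprod (gams m) w (Suc k) Z $ sec \<noteq> 0"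
    then obtain k where k: "k < n" "\<And>t. D t $ lo = 0" "\<And>t k'. k' < k \<Longrightarrow> uprod (gams m) w (Suc k') (D t) $ sec = 0"
      "uprod (gams m) w (Suc k) Z $ sec \<noteq> 0" by blast
    have un: "dst (g t) w \<epsilon> (x t) (0, D t) k = (0, uprod (gams m) w (Suc k) (D t))" for t
      by (rule dst_untouched[OF k(2)]) (use k(3) in auto)
    have un': "((\<lambda>t. dscale (c t) 1 (dst (g t) w \<epsilon> (x t) (0, D t) k)) \<longlongrightarrow> (0, uprod (gams m) w (Suc k) Z)) F" for c
      unfolding un dscale_def using tendsto_Pair[OF tendsto_const tendsto_linear[OF linear_uprod D, of "gams m" w "Suc k"], of 0]
      by (simp del: uprod.simps)
    have "((\<lambda>t. D t $ lo) \<longlongrightarrow> Z $ lo) F" by (intro tendsto_intros D)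
    then have Zlo: "Z $ lo = 0" using k(2) F by (simp add: tendsto_const_iff)
    have ulo: "uprod (gams m) w (Suc k) Z $ lo = 0" by (simp only: uprod_lo[OF wok] Zlo)
    show thesis
    proof (cases "k = 0")
      case True
      have x': "((\<lambda>t. scale 1 (P 0 t)) \<longlongrightarrow> (0, X)) F" using x by (simp add: scale_def)
      have pos: "0 < rad (0, X)" using X by (simp add: rad_def)
      note lim = stage_limit[OF _ x' pos, simplified]
      have "((\<lambda>t. dscale (1 / G t) (1 / G t) (dpre (g t) w \<epsilon> (x t) (0, D t) 1)) \<longlongrightarrow>
          (0, (uprod (gams m) w (Suc k) Z $ lo - uprod (gams m) w (Suc k) Z $ sec) *\<^sub>R hv)) F"
        using bump_limit(2)[OF lim(3) un'[of "\<lambda>_. 1", unfolded True]] True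
        by (simp del: dpre.simps uprod.simps)
      then show thesis
        by (rule that[OF order_refl n invG_pos initial_limit(2)[OF x X] y]) (use ulo k(4) in simp)
    next
      case False
      then obtain y' c where h: "y' \<noteq> 0" "\<forall>\<^sub>F t in F. 0 < c t" "((\<lambda>t. scale (c t) (P k t)) \<longlongrightarrow> (0, y' *\<^sub>R hv)) F"
        using state_limits[OF x X y amp, where n=n and k=k] k(1) by auto
      have pos: "0 < rad (0, y' *\<^sub>R (hv :: 'n rvec))" using h(1) by (simp add: rad_hv)
      note lim = stage_limit[OF h(2,3) pos]
      define t where "t = \<epsilon> k * sgn y'"
      define lam where "lam = 1 + 2 * real (fst (w k)) * t - U k (axis sec 1) $ sec"
      note sh = seg_hv[OF sec_lo wok[of k] h(1) eps[of k], folded t_def]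
      have lam: "lam \<noteq> 0"
        unfolding lam_def by (rule amplification_nz[OF m_pos wok sh(4)]) (use amp[of k] False k(1) in auto)
      have P': "((\<lambda>t. scale (c t / G t) (P (Suc k) t)) \<longlongrightarrow> (0, (y' * lam) *\<^sub>R hv)) F"
        using bump_limit(1)[OF lim(3)] unfolding rad_hv real_sqrt_abs sh(1)
        by (simp add: sec_ups axis_def[of lo] sec_lo lam_def algebra_simps del: bpre.simps)
      have T': "((\<lambda>t. dscale (c t / G t) (1 / G t) (dpre (g t) w \<epsilon> (x t) (0, D t) (Suc k))) \<longlongrightarrow>
          (0, (uprod (gams m) w (Suc k) Z $ lo - uprod (gams m) w (Suc k) Z $ sec) *\<^sub>R hv)) F"
        using bump_limit(2)[OF lim(3) un'] by (simp del: dpre.simps uprod.simps)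
      have c': "\<forall>\<^sub>F t in F. 0 < c t / G t" using h(2) G_pos by eventually_elim simp
      show thesis
        by (rule that[OF _ _ c' P' _ T']) (use k(1,4) ulo h(1) lam in \<open>auto simp del: uprod.simps\<close>)
    qed
  qed
  obtain y2 q c' b' where h: "y2 \<noteq> 0" "q \<noteq> 0" "\<forall>\<^sub>F t in F. 0 < c' t"
    "((\<lambda>t. scale (c' t) (P n t)) \<longlongrightarrow> (0, y2 *\<^sub>R hv)) F"
    "((\<lambda>t. dscale (c' t) (b' t) (dpre (g t) w \<epsilon> (x t) (0, D t) n)) \<longlongrightarrow> (0, (q * z1) *\<^sub>R hv)) F"
  proof -
    have "fst (w k) \<noteq> 0 \<or> U k (axis sec 1) \<noteq> axis sec 1" if "k0 \<le> k" "k < n" for k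
      using amp[of k] k0 that by linarith
    from hv_limits[OF k0(1) c S T(1) this k0(2) order_refl] show thesis using that by blast
  qed
  show False
    by (rule not_focus[OF F ij h(3,4,1,5) _ foc nd1 nd2]) (use h(2) T(2) in auto)
qed

text \<open>The tangent vector moves by words alone, whatever \<open>G\<close>. Its vanishing upper
  momentum and \<open>lo\<close> component leave only the final normals above \<open>sec\<close>;
  their span does not depend on \<open>G\<close> and is closed, so the limit would lie in
  it.\<close>

lemma never_focus_untouched:
  assumes F: "F \<noteq> bot" and D: "(D \<longlongrightarrow> Z) F" and ij: "i < j"
    and lo: "\<And>t. D t $ lo = 0" and um: "\<And>t. um m (D t) = 0"
    and untouched: "\<And>t k. k < n \<Longrightarrow> uprod (gams m) w (Suc k) (D t) $ sec = 0"
    and Z: "uprod (gams m) w (Suc n) Z \<notin> span (nv m ` ({i, j} \<inter> {sec<..}))"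
    and foc: "\<forall>\<^sub>F t in F. masses.focus (mmod (G t) m) i j (V n t) (S n t) (dst (g t) w \<epsilon> (x t) (0, D t) n)"
  shows False
proof -
  have G1: "\<forall>\<^sub>F t in F. 1 < G t" using filterlim_at_top_dense[THEN iffD1, OF G] by blast
  have jlo: "j \<noteq> lo" using ij by (metis lo_le not_le)
  have "\<forall>\<^sub>F t in F. uprod (gams m) w (Suc n) (D t) \<in> span (nv m ` ({i, j} \<inter> {sec<..}))"
    using foc G1
  proof eventually_elim
    case (elim t)
    interpret masses "mmod (G t) m" "gmod (G t) m" by (rule masses_mod[OF m_pos sec_lo elim(2)])
    let ?M = "mmod (G t) m" and ?v = "uprod (gams m) w (Suc n) (D t)"
    have v: "dst (g t) w \<epsilon> (x t) (0, D t) n = (0, ?v)" by (rule dst_untouched[OF lo untouched])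
    have "?v \<in> span {nv ?M i, nv ?M j}"
      using elim(1) unfolding focus_def v by simp
    then obtain \<alpha> \<beta> where e: "?v = \<alpha> *\<^sub>R nv ?M i + \<beta> *\<^sub>R nv ?M j" unfolding span_pair by blast
    have umv: "um m ?v = 0" by (simp only: um_uprod[OF m_pos wok] um)
    have vlo: "?v $ lo = 0" by (simp only: uprod_lo[OF wok] lo)
    have in_span: "nv ?M k \<in> span (nv m ` ({i, j} \<inter> {sec<..}))" if "k \<in> {i, j}" "sec < k" for k
      using that nv_mmod_upper[OF sec_lo that(2)] by (auto intro!: span_base)
    have zi: "\<alpha> *\<^sub>R nv ?M i \<in> span (nv m ` ({i, j} \<inter> {sec<..}))" if "\<alpha> = 0 \<or> sec < i"
      using that in_span[of i] by (auto intro: span_scale span_zero)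
    have zj: "\<beta> *\<^sub>R nv ?M j \<in> span (nv m ` ({i, j} \<inter> {sec<..}))" if "\<beta> = 0 \<or> sec < j"
      using that in_span[of j] by (auto intro: span_scale span_zero)
    have umab: "(if i = sec then \<alpha> else 0) + (if j = sec then \<beta> else 0) = 0"
      using umv unfolding e by (simp add: um_linear um_mmod_nv[OF m_pos sec_lo] split: if_splits)
    have b: "\<beta> = 0 \<or> sec < j" and a: "\<alpha> = 0 \<or> sec < i"
    proof -
      have j: "j = sec \<or> sec < j" using sec_le[OF jlo] by auto
      show b: "\<beta> = 0 \<or> sec < j" using umab j ij by (auto split: if_splits)
      show "\<alpha> = 0 \<or> sec < i"
      proof (cases "i = lo")
        case True
        have "\<beta> * nv ?M j $ lo = 0" using b nv_mmod_upper[OF sec_lo, of j] by auto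
        then have "\<alpha> * (1 / ?M $ lo) = 0"
          using vlo unfolding e by (auto simp: True nv_def[of _ lo])
        then show ?thesis using M_nz[of lo] by simp
      next
        case False
        then show ?thesis using umab sec_le[of i] ij by (cases "i = sec") (auto split: if_splits)
      qed
    qed
    show ?case unfolding e by (intro span_add zi zj a b)
  qed
  then have "uprod (gams m) w (Suc n) Z \<in> span (nv m ` ({i, j} \<inter> {sec<..}))"
    using Lim_in_closed_set[OF _ _ F tendsto_linear[OF linear_uprod D]] closed_subspace[OF subspace_span] by blast
  then show False using Z by simp
qed

end

section \<open>Choice of generic initial points\<close>

lemma generic_point:
  fixes Ls :: "('a::real_vector \<Rightarrow> real) set"
  assumes "finite Ls" "\<And>f. f \<in> Ls \<Longrightarrow> linear f \<and> (\<exists>X. f X \<noteq> 0)"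
  shows "\<exists>X. \<forall>f\<in>Ls. f X \<noteq> 0"
  using assms
proof (induction Ls rule: finite_induct)
  case (insert f Ls)
  then obtain X Y where X: "\<forall>h\<in>Ls. h X \<noteq> 0" and Y: "f Y \<noteq> 0" by blast
  \<comment> \<open>On the line through \<open>X\<close> in direction \<open>Y\<close> each of these
    functionals is affine and not identically zero, so it has at most one zero.\<close>
  have bad: "finite {t. h (X + t *\<^sub>R Y) = 0}" if "h \<in> insert f Ls" for h
  proof -
    have l: "h (X + t *\<^sub>R Y) = h X + t * h Y" for t
      using insert.prems[OF that] by (simp add: linear_add linear_scale)
    have "{t. h (X + t *\<^sub>R Y) = 0} \<subseteq> {- h X / h Y}"
    proof (cases "h Y = 0")
      case True
      then have "h X \<noteq> 0" using that X Y by auto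
      then show ?thesis using True by (auto simp: l)
    next
      case False then show ?thesis by (auto simp: l field_simps)
    qed
    then show ?thesis by (rule finite_subset) simp
  qed
  have "finite (\<Union>h\<in>insert f Ls. {t. h (X + t *\<^sub>R Y) = 0})" using insert.hyps bad by blast
  then obtain t where "t \<notin> (\<Union>h\<in>insert f Ls. {t. h (X + t *\<^sub>R Y) = 0})"
    using ex_new_if_finite[OF infinite_UNIV_char_0] by blast
  then show ?case by (intro exI[of _ "X + t *\<^sub>R Y"]) auto
qed simp

text \<open>Nonvanishing is an open condition, so the functions are treated one after another on
  shrinking open sets; this is why each must be nonzero somewhere in every such set that meets
  \<open>C\<close>.\<close>

lemma simultaneous_nonvanishing:
  fixes f :: "'e \<Rightarrow> 'a::topological_space \<Rightarrow> real"
  assumes "finite E" "\<And>e. e \<in> E \<Longrightarrow> continuous_on UNIV (f e)"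
    and nz: "\<And>e Q0. e \<in> E \<Longrightarrow> open Q0 \<Longrightarrow> Q0 \<subseteq> S \<Longrightarrow> Q0 \<inter> C \<noteq> {} \<Longrightarrow> \<exists>x\<in>Q0 \<inter> C. f e x \<noteq> 0"
    and S: "open S" "S \<inter> C \<noteq> {}"
  shows "\<exists>x\<in>S \<inter> C. \<forall>e\<in>E. f e x \<noteq> 0"
proof -
  have "\<exists>Q0. open Q0 \<and> Q0 \<subseteq> S \<and> Q0 \<inter> C \<noteq> {} \<and> (\<forall>x\<in>Q0. \<forall>e\<in>E. f e x \<noteq> 0)"
    using assms(1,2) nz
  proof (induction E rule: finite_induct)
    case empty then show ?case using S by (intro exI[of _ S]) auto
  next
    case (insert e E)
    then obtain Q where Q: "open Q" "Q \<subseteq> S" "Q \<inter> C \<noteq> {}" "\<forall>x\<in>Q. \<forall>e\<in>E. f e x \<noteq> 0" by auto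
    obtain x where x: "x \<in> Q \<inter> C" "f e x \<noteq> 0" using insert.prems(2)[of e Q] Q by auto
    have "open (f e -` (- {0}))" using insert.prems(1)[of e] by (intro open_vimage) auto
    then show ?case using Q x by (intro exI[of _ "Q \<inter> f e -` (- {0})"]) auto
  qed
  then show ?thesis by blast
qed

lemma bpre_cong:
  assumes "\<And>k. k < n \<Longrightarrow> \<epsilon> k = \<epsilon>' k" "k \<le> n"
  shows "bpre g w \<epsilon> x k = bpre g w \<epsilon>' x k"
  using assms(2)
proof (induction k)
  case (Suc k)
  then show ?case using assms(1)[of k] by simp
qed simp

lemma tendsto_bump2: "(s \<longlongrightarrow> l) F \<Longrightarrow> ((\<lambda>t. bump2 g (s t)) \<longlongrightarrow> bump2 g l) F"
  unfolding bump2_def by (rule tendsto_map_linear[OF linear_bump])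

lemma tendsto_bpre: "((\<lambda>y. bpre g w \<epsilon> y k) \<longlongrightarrow> bpre g w \<epsilon> x k) (nhds x)"
proof (induction k)
  case 0 then show ?case by (simp add: filterlim_ident)
next
  case (Suc k)
  show ?case
    unfolding bpre.simps by (intro tendsto_bump2 tendsto_seg Suc tendsto_mult tendsto_const tendsto_real_sqrt tendsto_rad)
qed

lemma tendsto_broot: "((\<lambda>y. broot g w \<epsilon> y k) \<longlongrightarrow> broot g w \<epsilon> x k) (nhds x)"
  unfolding broot_def by (intro tendsto_mult tendsto_const tendsto_real_sqrt tendsto_rad tendsto_bpre)

lemma tendsto_bst: "((\<lambda>y. bst g w \<epsilon> y k) \<longlongrightarrow> bst g w \<epsilon> x k) (nhds x)"
  unfolding bst_def by (intro tendsto_seg tendsto_bpre tendsto_broot)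

lemma tendsto_gap: "(f \<longlongrightarrow> l) F \<Longrightarrow> ((\<lambda>t. gap (f t) i) \<longlongrightarrow> gap l i) F"
  by (rule tendsto_linear[OF linear_gap])

lemma continuous_fin: "continuous_on UNIV (\<lambda>x. fin i j (broot g w \<epsilon> x c) (bst g w \<epsilon> x c))"
proof -
  have L: "((\<lambda>y. fin i j (broot g w \<epsilon> y c) (bst g w \<epsilon> y c)) \<longlongrightarrow> fin i j (broot g w \<epsilon> x c) (bst g w \<epsilon> x c)) (nhds x)" for x
  proof (cases "i = lo")
    case True
    then show ?thesis
      unfolding fin_def
      by (simp, intro tendsto_intros tendsto_gap tendsto_broot tendsto_bst[THEN tendsto_fst] tendsto_bst[THEN tendsto_snd])
  next
    case False
    then show ?thesis
      unfolding fin_def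
      by (simp, intro tendsto_intros tendsto_gap tendsto_bst[THEN tendsto_fst] tendsto_bst[THEN tendsto_snd])
  qed
  show ?thesis
    unfolding continuous_on_eq_continuous_at[OF open_UNIV] isCont_def
    by (rule ballI, rule tendsto_mono[OF _ L]) (simp add: at_within_def)
qed

text \<open>These conditions exclude focusing. Actual orbits satisfy them because two particles that have
  separated do not meet again unless one of them has collided with something else in between.\<close>

definition nondegenerate ::
  "'n rvec \<Rightarrow> (nat \<Rightarrow> 'n stage) \<Rightarrow> nat \<Rightarrow> 'n \<Rightarrow> 'n \<Rightarrow> 'n \<Rightarrow> 'n::{finite,linorder} \<Rightarrow> bool" where
  "nondegenerate m w c a b i j \<longleftrightarrow>
     (\<forall>k. 1 \<le> k \<and> k < c \<longrightarrow> fst (w k) \<noteq> 0 \<or> ups (gams m) (snd (w k)) (axis sec 1) \<noteq> axis sec 1) \<and>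
     (1 \<le> c \<and> a = sec \<longrightarrow> fst (w 0) \<noteq> 0 \<or> ups (gams m) (snd (w 0)) (axis sec 1) \<noteq> axis sec 1) \<and>
     (1 \<le> c \<and> i = sec \<and> fst (w c) = 0 \<longrightarrow> ups (gams m) (snd (w c)) (axis sec 1) \<notin> span {axis sec 1, nv m j}) \<and>
     (1 \<le> c \<and> j = sec \<and> fst (w c) = 0 \<longrightarrow> ups (gams m) (snd (w c)) (axis sec 1) \<noteq> axis sec 1) \<and>
     (1 \<le> c \<and> sec < a \<longrightarrow> (\<exists>h\<in>span {nv m a, nv m b}. (\<exists>k<c. uprod (gams m) w (Suc k) h $ sec \<noteq> 0) \<or>
        uprod (gams m) w (Suc c) h \<notin> span (nv m ` ({i, j} \<inter> {sec<..})))) \<and>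
     (c = 0 \<and> (sec < i \<or> i = sec \<and> fst (w 0) = 0) \<longrightarrow>
        (\<exists>q. gap q a = 0 \<and> gap q b = 0 \<and> (gap (ups (gams m) (snd (w 0)) q) i \<noteq> 0 \<or> gap (ups (gams m) (snd (w 0)) q) j \<noteq> 0)))"

text \<open>The velocity part of the characteristic direction of the piece \<open>a\<close>,
  \<open>b\<close>: the combination of both normals that is orthogonal to \<open>X\<close> in the
  mass product.\<close>

definition charv :: "'n rvec \<Rightarrow> 'n \<Rightarrow> 'n \<Rightarrow> 'n::{finite,linorder} rvec \<Rightarrow> 'n rvec" where
  "charv M a b X = gap X a *\<^sub>R nv M b - gap X b *\<^sub>R nv M a"

text \<open>The limit of \<open>mmod G m\<close>. Its normals make sense, but it does not satisfy
  \<open>masses\<close>, since the two lowest masses add up to zero.\<close>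

definition mlim :: "'n::{finite,linorder} rvec \<Rightarrow> 'n rvec" where
  "mlim m = (\<chi> i. if i = lo then - m $ sec else m $ i)"

lemma linear_charv: "linear (charv M a b)"
  by (rule linearI) (simp_all add: charv_def gap_linear algebra_simps)

lemma gap_axis_below: "k < i \<Longrightarrow> gap (axis i 1) k = 0"
  using below_less[of k] by (cases "k = lo") (auto simp: gap_eq axis_def)

lemma gap_axis: "gap (axis i 1) i = 1"
  using below_less[of i] by (cases "i = lo") (auto simp: gap_eq axis_def)

lemma charv_axis: "a < b \<Longrightarrow> charv M a b (axis b 1) = - nv M a"
  by (simp add: charv_def gap_axis gap_axis_below)

lemma charv_surj:
  assumes "a \<noteq> b" "h \<in> span {nv M a, nv M b}"
  shows "\<exists>X. charv M a b X = h"
proof -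
  obtain \<alpha> \<beta> where h: "h = \<alpha> *\<^sub>R nv M a + \<beta> *\<^sub>R nv M b" using assms(2) unfolding span_pair by blast
  have "charv M a b (\<beta> *\<^sub>R ev a - \<alpha> *\<^sub>R ev b) = h"
    using assms(1) by (simp add: charv_def gap_linear gap_ev h)
  then show ?thesis ..
qed

lemma linear_nth: "linear (\<lambda>X::'n::finite rvec. X $ i)"
  by (rule linearI) auto

lemma linear_first:
  "linear (\<lambda>X. c * X $ lo - ups g vs X $ sec)" 
  by (rule linearI) (simp_all add: ups_linear_simps algebra_simps)

text \<open>Each condition follows from some linear functional of \<open>X\<close> being nonzero, so
  by \<open>generic_point\<close> one test vector for each suffices. Both signs \<open>e\<close> are
  required because the first root may have either.\<close>

lemma choose_velocity:
  fixes m :: "'n::{finite,linorder} rvec"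
  assumes m: "\<And>i. 0 < m $ i" and s: "(sec::'n) \<noteq> lo" and wok: "\<And>k. \<forall>i\<in>set (snd (w k)). sec < i"
    and ab: "a < b" and c: "1 \<le> c" and nd: "nondegenerate m w c a b i j"
  shows "\<exists>X. 0 < X $ lo \<and> gap X a \<noteq> 0 \<and> gap X b \<noteq> 0 \<and>
    (\<forall>e\<in>{1, -1}. (1 + 2 * real (fst (w 0)) * e) * X $ lo - ups (gams m) (snd (w 0)) X $ sec \<noteq> 0) \<and>
    (if a \<le> sec then \<forall>e\<in>{1, -1}. (1 + 2 * real (fst (w 0)) * e) * charv (mlim m) a b X $ lo
         - ups (gams m) (snd (w 0)) (charv (mlim m) a b X) $ sec \<noteq> 0
     else (\<exists>k<c. (\<forall>Y. \<forall>k'<k. uprod (gams m) w (Suc k') (charv m a b Y) $ sec = 0) \<and>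
            uprod (gams m) w (Suc k) (charv m a b X) $ sec \<noteq> 0) \<or>
          (\<forall>Y. \<forall>k<c. uprod (gams m) w (Suc k) (charv m a b Y) $ sec = 0) \<and>
            uprod (gams m) w (Suc c) (charv m a b X) \<notin> span (nv m ` ({i, j} \<inter> {sec<..})))"
proof -
  define U0 where "U0 = ups (gams m) (snd (w 0))"
  define r where "r = real (fst (w 0))"
  define Y where "Y = (\<lambda>e X. (1 + 2 * r * e) * X $ lo - U0 X $ sec)"
  \<comment> \<open>\<open>r\<close> is a natural number, so this is an odd integer.\<close>
  have odd: "1 + 2 * r * e \<noteq> 0" if "e \<in> {1, -1}" for e
  proof -
    have "r = 0 \<or> 1 \<le> r" by (auto simp: r_def)
    then show ?thesis using that by auto
  qed
  have linY: "linear (Y e)" for e unfolding Y_def U0_def by (rule linear_first)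
  have U0lo: "U0 (axis lo t) = axis lo t" for t unfolding U0_def by (rule ups_axis_lo[OF wok])
  have Ylo: "Y e (axis lo t) = (1 + 2 * r * e) * t" for e t
    using s unfolding Y_def U0lo by (simp add: axis_def)
  have nzY: "\<exists>X. Y e X \<noteq> 0" if "e \<in> {1, -1}" for e
    using Ylo[of e 1] odd[OF that] by (intro exI[of _ "axis lo 1"]) simp
  have fins: "finite L \<Longrightarrow> (\<And>f. f \<in> L \<Longrightarrow> linear f \<and> (\<exists>X. f X \<noteq> 0)) \<Longrightarrow>
      \<exists>X. 0 < X $ lo \<and> gap X a \<noteq> 0 \<and> gap X b \<noteq> 0 \<and> Y 1 X \<noteq> 0 \<and> Y (-1) X \<noteq> 0 \<and> (\<forall>f\<in>L. f X \<noteq> 0)"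
    for L :: "('n rvec \<Rightarrow> real) set"
  proof -
    assume L: "finite L" "\<And>f. f \<in> L \<Longrightarrow> linear f \<and> (\<exists>X. f X \<noteq> 0)"
    let ?L = "L \<union> {\<lambda>X. X $ lo, \<lambda>X. gap X a, \<lambda>X. gap X b, Y 1, Y (-1)}"
    have 1: "linear f \<and> (\<exists>X. f X \<noteq> 0)" if "f \<in> ?L" for f
    proof -
      have 1: "linear (\<lambda>X::'n rvec. X $ lo) \<and> (\<exists>X::'n rvec. X $ lo \<noteq> 0)"
        by (intro conjI linear_nth exI[of _ "axis lo 1"]) (simp add: axis_def)
      have 2: "linear (\<lambda>X. gap X k) \<and> (\<exists>X. gap X k \<noteq> 0)" for k :: 'n
        by (intro conjI linear_gap exI[of _ "axis k 1"]) (simp add: gap_axis)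
      have 3: "linear (Y e) \<and> (\<exists>X. Y e X \<noteq> 0)" if "e \<in> {1, -1}" for e
        using linY nzY[OF that] by blast
      from that consider (l) "f \<in> L" | "f = (\<lambda>X. X $ lo)" | "f = (\<lambda>X. gap X a)" | "f = (\<lambda>X. gap X b)" | "f = Y 1" | "f = Y (-1)"
        by blast
      then show ?thesis using L(2) 1 2 3[of 1] 3[of "-1"] by cases simp_all
    qed
    have "finite ?L" using L by simp
    from generic_point[OF this 1] obtain X where X: "\<forall>f\<in>?L. f X \<noteq> 0" ..
    \<comment> \<open>Nonvanishing of linear functionals survives a change of sign, which makes the
      lowest velocity positive.\<close>
    define X' where "X' = sgn (X $ lo) *\<^sub>R X"
    have Xlo: "X $ lo \<noteq> 0" using bspec[OF X, of "\<lambda>X. X $ lo"] by simp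
    have sX: "f X' \<noteq> 0" if "f \<in> ?L" for f
      using bspec[OF X that] 1[OF that] Xlo by (simp add: X'_def linear_scale sgn_if)
    have "0 < X' $ lo" using Xlo by (simp add: X'_def sgn_if)
    moreover have "gap X' a \<noteq> 0" "gap X' b \<noteq> 0" using sX[of "\<lambda>X. gap X a"] sX[of "\<lambda>X. gap X b"] by auto
    moreover have "Y 1 X' \<noteq> 0" "Y (-1) X' \<noteq> 0" "\<forall>f\<in>L. f X' \<noteq> 0" using sX by auto
    ultimately show ?thesis by blast
  qed
  show ?thesis
  proof (cases "a \<le> sec")
    case True
    \<comment> \<open>The test vector \<open>axis b 1\<close> closes gap \<open>a\<close> and opens
      gap \<open>b\<close>, so its characteristic vector is minus the normal of
      \<open>a\<close>.\<close>
    have zz: "Y e (charv (mlim m) a b (axis b 1)) \<noteq> 0" if e: "e \<in> {1, -1}" for e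
    proof (cases "a = lo")
      case True
      have "charv (mlim m) a b (axis b 1) = axis lo (1 / m $ sec)"
        by (simp add: charv_axis[OF ab]) (simp add: True nv_def mlim_def axis_def vec_eq_iff)
      then show ?thesis using Ylo odd[OF e] m[of sec] by simp
    next
      case False
      then have as: "a = sec" using True sec_le[of a] by simp
      \<comment> \<open>With lowest mass \<open>- m $ sec\<close> the normal of \<open>sec\<close>
        is a multiple of \<open>hv\<close>, and the condition turns into the amplification factor of
        the first stage.\<close>
      have ch: "charv (mlim m) a b (axis b 1) = axis lo (- 1 / m $ sec) + (- 1 / m $ sec) *\<^sub>R axis sec 1"
        using s by (simp add: charv_axis[OF ab]) (auto simp: as nv_def mlim_def below_sec axis_def vec_eq_iff)
      have "1 + 2 * real (fst (w 0)) * e - U0 (axis sec 1) $ sec \<noteq> 0"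
        unfolding U0_def by (rule amplification_nz[OF m wok]) (use nd c as e in \<open>auto simp: nondegenerate_def\<close>)
      moreover have "Y e (charv (mlim m) a b (axis b 1)) = (- 1 / m $ sec) * (1 + 2 * r * e - U0 (axis sec 1) $ sec)"
        unfolding ch linear_add[OF linY] linear_scale[OF linY] Ylo
        using s by (simp add: Y_def axis_def[of sec] algebra_simps)
      ultimately show ?thesis using m[of sec] by (simp add: r_def)
    qed
    have "linear (\<lambda>X. Y e (charv (mlim m) a b X))" for e
      using linear_compose[OF linear_charv linY] by (simp add: comp_def)
    then have "\<exists>X. 0 < X $ lo \<and> gap X a \<noteq> 0 \<and> gap X b \<noteq> 0 \<and> Y 1 X \<noteq> 0 \<and> Y (-1) X \<noteq> 0 \<and>
        (\<forall>f\<in>{\<lambda>X. Y 1 (charv (mlim m) a b X), \<lambda>X. Y (-1) (charv (mlim m) a b X)}. f X \<noteq> 0)"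
      using zz by (intro fins) auto
    then show ?thesis using True unfolding Y_def U0_def r_def by auto
  next
    case False
    define L where "L = (\<lambda>k h. uprod (gams m) w (Suc k) h $ sec)"
    have l: "linear (\<lambda>X. uprod (gams m) w k (charv m a b X))" for k
      using linear_compose[OF linear_charv linear_uprod] by (simp only: comp_def)
    have linL: "linear (\<lambda>X. L k (charv m a b X))" for k
      by (rule linearI) (simp_all add: L_def linear_add[OF l] linear_scale[OF l] del: uprod.simps)
    show ?thesis
    proof (cases "\<exists>k<c. \<exists>X. L k (charv m a b X) \<noteq> 0")
      case True
      \<comment> \<open>The first stage at which some characteristic vector becomes visible to the
        lowest pair; before it all of them are untouched.\<close>
      define k where "k = (LEAST k. k < c \<and> (\<exists>X. L k (charv m a b X) \<noteq> 0))"
      have k: "k < c \<and> (\<exists>X. L k (charv m a b X) \<noteq> 0)" unfolding k_def by (rule LeastI_ex[OF True])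
      have "\<not> (k' < c \<and> (\<exists>X. L k' (charv m a b X) \<noteq> 0))" if "k' < k" for k'
        using not_less_Least that unfolding k_def by blast
      then have kk: "\<forall>Y. \<forall>k'<k. L k' (charv m a b Y) = 0" using k by auto
      have "\<exists>X. 0 < X $ lo \<and> gap X a \<noteq> 0 \<and> gap X b \<noteq> 0 \<and> Y 1 X \<noteq> 0 \<and> Y (-1) X \<noteq> 0 \<and>
          (\<forall>f\<in>{\<lambda>X. L k (charv m a b X)}. f X \<noteq> 0)"
        using k linL by (intro fins) auto
      then show ?thesis using k kk False unfolding Y_def U0_def r_def L_def
        by (elim exE conjE) (rule exI, intro conjI; simp del: uprod.simps; blast)
    next
      case un: False
      let ?W = "span (nv m ` ({i, j} \<inter> {sec<..}))"
      have un': "uprod (gams m) w (Suc k) h $ sec = 0" if "k < c" "h \<in> span {nv m a, nv m b}" for k h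
        using un charv_surj[of a b h m] that ab unfolding L_def by fastforce
      then obtain h where h: "h \<in> span {nv m a, nv m b}" "uprod (gams m) w (Suc c) h \<notin> ?W"
        using nd c False unfolding nondegenerate_def by (metis not_le)
      then obtain X0 where X0: "charv m a b X0 = h" using charv_surj[of a b h m] ab by auto
      obtain y z where yz: "y \<in> ?W" "\<And>v. v \<in> ?W \<Longrightarrow> orthogonal z v" "uprod (gams m) w (Suc c) h = y + z"
        using orthogonal_subspace_decomp_exists[of "nv m ` ({i, j} \<inter> {sec<..})" "uprod (gams m) w (Suc c) h"] by metis
      have "z \<noteq> 0" using yz h(2) by auto
      \<comment> \<open>Pairing with the component \<open>z\<close> orthogonal to \<open>?W\<close>
        turns the exclusion from a subspace into the nonvanishing of a linear functional.\<close>
      define f where "f = (\<lambda>X. z \<bullet> uprod (gams m) w (Suc c) (charv m a b X))"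
      have linf: "linear f"
        by (rule linearI) (simp_all add: f_def linear_add[OF l] linear_scale[OF l] inner_add_right del: uprod.simps)
      have "z \<bullet> y = 0" using yz(1,2) by (simp add: orthogonal_def)
      then have "f X0 \<noteq> 0" using \<open>z \<noteq> 0\<close> unfolding f_def X0 yz(3) by (simp add: inner_add_right)
      then have "\<exists>X. 0 < X $ lo \<and> gap X a \<noteq> 0 \<and> gap X b \<noteq> 0 \<and> Y 1 X \<noteq> 0 \<and> Y (-1) X \<noteq> 0 \<and>
          (\<forall>f\<in>{f}. f X \<noteq> 0)"
        using linf by (intro fins) auto
      then obtain X where X: "0 < X $ lo" "gap X a \<noteq> 0" "gap X b \<noteq> 0" "Y 1 X \<noteq> 0" "Y (-1) X \<noteq> 0" "f X \<noteq> 0" by auto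
      have "uprod (gams m) w (Suc c) (charv m a b X) \<notin> ?W"
        using X(6) yz(2) unfolding f_def orthogonal_def by blast
      moreover have "\<forall>Y. \<forall>k<c. uprod (gams m) w (Suc k) (charv m a b Y) $ sec = 0"
        using un unfolding L_def by blast
      ultimately show ?thesis using X False unfolding Y_def U0_def r_def
        by (intro exI[of _ X]) (simp del: uprod.simps)
    qed
  qed
qed

text \<open>Neither the energy nor the signs of the other gaps are fixed, so this is a linear
  subspace and contains whole lines.\<close>

definition corner :: "'n \<Rightarrow> 'n \<Rightarrow> 'n::{finite,linorder} phase set" where
  "corner a b = {x. gap (fst x) a = 0 \<and> gap (fst x) b = 0}"

lemma eventually_on_line:
  assumes "open Q" "x \<in> Q \<inter> corner a b" "gap (fst \<eta>) a = 0" "gap (fst \<eta>) b = 0"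
  shows "\<forall>\<^sub>F t in nhds 0. x + t *\<^sub>R \<eta> \<in> Q \<inter> corner a b"
proof -
  have "((\<lambda>t::real. x + t *\<^sub>R \<eta>) \<longlongrightarrow> x + 0 *\<^sub>R \<eta>) (nhds 0)" by (intro tendsto_intros) (simp add: filterlim_ident)
  from topological_tendstoD[OF this assms(1)] have "\<forall>\<^sub>F t in nhds 0. x + t *\<^sub>R \<eta> \<in> Q"
    using assms(2) by simp
  then show ?thesis by eventually_elim (use assms(2-4) in \<open>simp add: corner_def gap_linear\<close>)
qed

lemma small_on_line:
  assumes "open Q" "x \<in> Q \<inter> corner a b" "gap (fst \<eta>) a = 0" "gap (fst \<eta>) b = 0"
  shows "\<exists>t>0. x + t *\<^sub>R \<eta> \<in> Q \<inter> corner a b \<and> x - t *\<^sub>R \<eta> \<in> Q \<inter> corner a b"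
proof -
  obtain e where e: "0 < e" "\<And>t. \<bar>t\<bar> < e \<Longrightarrow> x + t *\<^sub>R \<eta> \<in> Q \<inter> corner a b"
    using eventually_on_line[OF assms] unfolding eventually_nhds_metric dist_real_def by auto
  show ?thesis using e(1) e(2)[of "e/2"] e(2)[of "- (e/2)"] by (intro exI[of _ "e/2"]) auto
qed

context masses
begin

text \<open>For \<open>i \<noteq> lo\<close> either both final gap velocities vanish throughout the
  region, or one of them is nonzero on an open part that still meets the corner;
  \<open>focusing\<close> covers both situations.\<close>

lemma focus_region:
  assumes Q: "open Q" "Q \<inter> corner a b \<noteq> {}" and ab: "a \<noteq> b" and ij: "i < j"
    and reg: "\<And>x. x \<in> Q \<Longrightarrow> regular w \<epsilon> x n \<and> gap (snd x) a \<noteq> 0"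
    and zero: "\<And>x. x \<in> Q \<inter> corner a b \<Longrightarrow> fin i j (broot g w \<epsilon> x n) (bst g w \<epsilon> x n) = 0"
  shows "\<exists>Q'. open Q' \<and> Q' \<subseteq> Q \<and> Q' \<inter> corner a b \<noteq> {} \<and>
    (\<forall>x\<in>Q' \<inter> corner a b. focus i j (broot g w \<epsilon> x n) (bst g w \<epsilon> x n)
       (dst g w \<epsilon> x (0, charv M a b (snd x)) n))"
proof -
  define sl where "sl = (\<lambda>x. gap (snd (bst g w \<epsilon> x n)) i \<noteq> 0 \<or> gap (snd (bst g w \<epsilon> x n)) j \<noteq> 0)"
  have foc: "focus i j (broot g w \<epsilon> x n) (bst g w \<epsilon> x n) (dst g w \<epsilon> x (0, charv M a b (snd x)) n)"
    if x: "x \<in> Q' \<inter> corner a b" and Q': "open Q'" "Q' \<subseteq> Q"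
      and deg: "i \<noteq> lo \<Longrightarrow> deg \<or> sl x" and dz: "\<And>y. y \<in> Q' \<inter> corner a b \<Longrightarrow> deg \<Longrightarrow> \<not> sl y" for x Q' deg
    unfolding charv_def
  proof (rule focusing[OF _ ab ij, where deg = deg])
    have "x \<in> Q" using x Q' by blast
    then show "regular w \<epsilon> x n" "gap (snd x) a \<noteq> 0 \<or> gap (snd x) b \<noteq> 0" using reg by simp_all
    show "i \<noteq> lo \<Longrightarrow> deg \<or> gap (snd (bst g w \<epsilon> x n)) i \<noteq> 0 \<or> gap (snd (bst g w \<epsilon> x n)) j \<noteq> 0"
      using deg by (simp add: sl_def)
    fix \<eta> :: "'n phase" assume "gap (fst \<eta>) a = 0" "gap (fst \<eta>) b = 0"
    from eventually_on_line[OF Q'(1) x this]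
    show "\<forall>\<^sub>F t in nhds 0. fin i j (broot g w \<epsilon> (x + t *\<^sub>R \<eta>) n) (bst g w \<epsilon> (x + t *\<^sub>R \<eta>) n) = 0 \<and>
        (deg \<longrightarrow> gap (snd (bst g w \<epsilon> (x + t *\<^sub>R \<eta>) n)) i = 0)"
    proof eventually_elim
      case (elim t)
      have "x + t *\<^sub>R \<eta> \<in> Q \<inter> corner a b" using elim Q'(2) by blast
      then show ?case using zero[of "x + t *\<^sub>R \<eta>"] dz[OF elim] by (simp add: sl_def)
    qed
  qed
  show ?thesis
  proof (cases "i = lo \<or> (\<forall>x\<in>Q \<inter> corner a b. \<not> sl x)")
    case True
    have "focus i j (broot g w \<epsilon> x n) (bst g w \<epsilon> x n) (dst g w \<epsilon> x (0, charv M a b (snd x)) n)"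
      if x: "x \<in> Q \<inter> corner a b" for x
      using foc[OF x Q(1) order_refl, of "i \<noteq> lo"] True by blast
    then show ?thesis using Q by (intro exI[of _ Q]) auto
  next
    case False
    define Q' where "Q' = Q \<inter> {x. sl x}"
    have c: "continuous_on UNIV (\<lambda>x. gap (snd (bst g w \<epsilon> x n)) k)" for k
      unfolding continuous_on_eq_continuous_at[OF open_UNIV] isCont_def
      by (rule ballI, rule tendsto_mono[OF _ tendsto_gap[OF tendsto_snd[OF tendsto_bst]]]) (simp add: at_within_def)
    have "{x. sl x} = (\<lambda>x. gap (snd (bst g w \<epsilon> x n)) i) -` (- {0}) \<union> (\<lambda>x. gap (snd (bst g w \<epsilon> x n)) j) -` (- {0})"
      by (auto simp: sl_def)
    moreover have "open \<dots>" by (intro open_Un open_vimage c) auto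
    ultimately have o: "open Q'" using Q(1) by (simp add: Q'_def open_Int)
    have "focus i j (broot g w \<epsilon> x n) (bst g w \<epsilon> x n) (dst g w \<epsilon> x (0, charv M a b (snd x)) n)"
      if x: "x \<in> Q' \<inter> corner a b" for x
      using x by (intro foc[OF x o, of False]) (auto simp: Q'_def)
    then show ?thesis using o False by (intro exI[of _ Q']) (auto simp: Q'_def)
  qed
qed

end

text \<open>The product filter yields one coefficient \<open>G\<close> together with a whole
  neighbourhood of initial points, as \<open>focus_region\<close> argues on open sets.\<close>

lemma no_focus_region:
  fixes m :: "'n::{finite,linorder} rvec"
  assumes m: "\<And>i. 0 < m $ i" and s: "(sec::'n) \<noteq> lo" and wok: "\<And>k. \<forall>i\<in>set (snd (w k)). sec < i"
    and eps: "\<And>k. (\<epsilon> k)\<^sup>2 = (1::real)" and ab: "a < b" and ij: "i < j" and c: "1 \<le> c"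
    and nd: "nondegenerate m w c a b i j"
    and X: "0 < X $ lo" "\<forall>e\<in>{1, -1}. (1 + 2 * real (fst (w 0)) * e) * X $ lo - ups (gams m) (snd (w 0)) X $ sec \<noteq> 0"
      "if a \<le> sec then \<forall>e\<in>{1, -1}. (1 + 2 * real (fst (w 0)) * e) * charv (mlim m) a b X $ lo
         - ups (gams m) (snd (w 0)) (charv (mlim m) a b X) $ sec \<noteq> 0
       else (\<exists>k<c. (\<forall>Y. \<forall>k'<k. uprod (gams m) w (Suc k') (charv m a b Y) $ sec = 0) \<and>
            uprod (gams m) w (Suc k) (charv m a b X) $ sec \<noteq> 0) \<or>
          (\<forall>Y. \<forall>k<c. uprod (gams m) w (Suc k) (charv m a b Y) $ sec = 0) \<and>
            uprod (gams m) w (Suc c) (charv m a b X) \<notin> span (nv m ` ({i, j} \<inter> {sec<..}))"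
  shows "\<forall>\<^sub>F (G, x) in at_top \<times>\<^sub>F nhds (0, X). 1 < G \<and> masses.regular (gmod G m) w \<epsilon> x c \<and>
     \<not> masses.focus (mmod G m) i j (broot (gmod G m) w \<epsilon> x c) (bst (gmod G m) w \<epsilon> x c)
       (dst (gmod G m) w \<epsilon> x (0, charv (mmod G m) a b (snd x)) c)"
proof -
  define F where "F = (at_top :: real filter) \<times>\<^sub>F nhds ((0, X) :: 'n phase)"
  have G: "filterlim fst at_top F" unfolding F_def by (rule filterlim_fst)
  have x: "(snd \<longlongrightarrow> (0, X)) F" unfolding F_def by (rule filterlim_snd)
  have e0: "\<epsilon> 0 \<in> {1, -1}" using eps[of 0] by (auto simp: power2_eq_1_iff)
  have y: "(1 + 2 * real (fst (w 0)) * \<epsilon> 0) * X $ lo - ups (gams m) (snd (w 0)) X $ sec \<noteq> 0"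
    using X(2) e0 by blast
  have amp: "\<And>k. 1 \<le> k \<Longrightarrow> k < c \<Longrightarrow> fst (w k) \<noteq> 0 \<or> ups (gams m) (snd (w k)) (axis sec 1) \<noteq> axis sec 1"
    using nd unfolding nondegenerate_def by blast
  have lg: "large m F' fst w \<epsilon>" if "F' \<le> F" for F' :: "(real \<times> 'n phase) filter"
    by unfold_locales (use m s wok eps filterlim_mono[OF G order_refl that] in auto)
  have "\<forall>\<^sub>F t in F. \<forall>k\<in>{..c}. 0 < rad (bpre (gmod (fst t) m) w \<epsilon> (snd t) k)"
  proof (intro eventually_ball_finite ballI)
    fix k assume "k \<in> {..c}"
    then show "\<forall>\<^sub>F t in F. 0 < rad (bpre (gmod (fst t) m) w \<epsilon> (snd t) k)"
      by (intro large.rad_positive[OF lg[OF order_refl] x X(1) y amp]) auto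
  qed simp
  moreover have G1: "\<forall>\<^sub>F t in F. 1 < fst t" using filterlim_at_top_dense[THEN iffD1, OF G] by blast
  moreover have "\<forall>\<^sub>F t in F. \<not> masses.focus (mmod (fst t) m) i j (broot (gmod (fst t) m) w \<epsilon> (snd t) c)
       (bst (gmod (fst t) m) w \<epsilon> (snd t) c) (dst (gmod (fst t) m) w \<epsilon> (snd t) (0, charv (mmod (fst t) m) a b (snd (snd t))) c)"
    (is "eventually (\<lambda>t. \<not> ?foc t) F")
  proof (rule ccontr)
    assume neg: "\<not> eventually (\<lambda>t. \<not> ?foc t) F"
    \<comment> \<open>If focusing were not eventually excluded, it would hold along this nontrivial
      subfilter, to which the limits of \<open>large\<close> apply.\<close>
    define F' where "F' = inf F (principal {t. ?foc t})"
    have F': "F' \<noteq> bot" "F' \<le> F"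
      using neg by (auto simp: F'_def trivial_limit_def eventually_inf_principal)
    have foc: "\<forall>\<^sub>F t in F'. ?foc t" by (simp add: F'_def eventually_inf_principal)
    interpret large m F' fst snd w \<epsilon> by (rule lg[OF F'(2)])
    have x': "(snd \<longlongrightarrow> (0, X)) F'" using x F'(2) by (rule tendsto_mono[rotated])
    have mlo: "((\<lambda>t. mmod (fst t) m) \<longlongrightarrow> mlim m) F'"
    proof (rule vec_tendstoI)
      fix k show "((\<lambda>t. mmod (fst t) m $ k) \<longlongrightarrow> mlim m $ k) F'"
      proof (cases "k = lo")
        case True then show ?thesis using mmod_lo_limit[OF G, of m] by (simp add: mlim_def)
      next
        case False then show ?thesis by (simp add: mmod_def mlim_def)
      qed
    qed
    have mnz: "mlim m $ k \<noteq> 0" for k using m[of k] m[of sec] by (simp add: mlim_def less_le)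
    have nvl: "((\<lambda>t. nv (mmod (fst t) m) k) \<longlongrightarrow> nv (mlim m) k) F'" for k
      unfolding nv_def
      by (cases "k = lo") (simp_all, (intro tendsto_diff tendsto_axis tendsto_divide tendsto_const tendsto_vec_nth mlo mnz)+)
    define D where "D = (\<lambda>t. charv (mmod (fst t) m) a b (snd (snd t :: 'n phase)))"
    have D: "(D \<longlongrightarrow> charv (mlim m) a b X) F'"
      unfolding D_def charv_def
      using tendsto_gap[OF tendsto_snd[OF x']] by (intro tendsto_diff tendsto_scaleR nvl) simp_all
    have nd1: "i = sec \<Longrightarrow> fst (w c) = 0 \<Longrightarrow> U c (axis sec 1) \<notin> span {axis sec 1, nv m j}"
      and nd2: "j = sec \<Longrightarrow> fst (w c) = 0 \<Longrightarrow> U c (axis sec 1) \<noteq> axis sec 1"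
      using nd c unfolding nondegenerate_def by blast+
    show False
    proof (cases "a \<le> sec")
      case True
      then have "(1 + 2 * real (fst (w 0)) * \<epsilon> 0) * charv (mlim m) a b X $ lo - U 0 (charv (mlim m) a b X) $ sec \<noteq> 0"
        using X(3) e0 unfolding if_P[OF True] by blast
      from never_focus_touched[OF F'(1) x' X(1) D y amp c ij disjI1[OF this] _ nd1 nd2] foc
      show False unfolding D_def by blast
    next
      case False
      then have up: "sec < a" "sec < b" using ab by auto
      have ml: "charv (mmod e m) a b Y = charv m a b Y" for e Y
        using nv_mmod_upper[OF sec_lo up(1)] nv_mmod_upper[OF sec_lo up(2)] by (simp add: charv_def)
      have nvm: "nv (mlim m) k = nv m k" if "sec < k" for k
      proof -
        have "below k \<noteq> lo" "k \<noteq> lo" using sec_le_below[OF that] s that by (metis lo_le order_antisym, metis lo_le not_le)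
        then show ?thesis by (simp add: nv_def mlim_def)
      qed
      have mlX: "charv (mlim m) a b X = charv m a b X" using nvm up by (simp add: charv_def)
      have Dlo: "D t $ lo = 0" for t
        using nv_mmod_upper(2)[OF sec_lo up(1)] nv_mmod_upper(2)[OF sec_lo up(2)] by (simp add: D_def ml charv_def)
      have Dum: "um m (D t) = 0" for t
      proof -
        have "a \<noteq> sec" "b \<noteq> sec" using up by auto
        then show ?thesis unfolding D_def charv_def um_linear um_mmod_nv[OF m s] by simp
      qed
      have Dt: "D t = charv m a b (snd (snd t))" for t by (simp add: D_def ml)
      from X(3) False consider k where "k < c" "\<forall>Y. \<forall>k'<k. uprod (gams m) w (Suc k') (charv m a b Y) $ sec = 0"
            "uprod (gams m) w (Suc k) (charv m a b X) $ sec \<noteq> 0"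
        | "\<forall>Y. \<forall>k<c. uprod (gams m) w (Suc k) (charv m a b Y) $ sec = 0"
            "uprod (gams m) w (Suc c) (charv m a b X) \<notin> span (nv m ` ({i, j} \<inter> {sec<..}))"
        by (auto simp del: uprod.simps)
      then show False
      proof cases
        case 1
        then have "\<exists>k<c. (\<forall>t. D t $ lo = 0) \<and> (\<forall>t. \<forall>k'<k. uprod (gams m) w (Suc k') (D t) $ sec = 0) \<and>
            uprod (gams m) w (Suc k) (charv (mlim m) a b X) $ sec \<noteq> 0"
          using Dlo by (auto simp: Dt mlX simp del: uprod.simps)
        from never_focus_touched[OF F'(1) x' X(1) D y amp c ij disjI2[OF this] _ nd1 nd2] foc
        show False unfolding D_def by blast
      next
        case 2
        have 3: "uprod (gams m) w (Suc k) (D t) $ sec = 0" if "k < c" for t k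
          unfolding Dt using 2(1) that by blast
        from never_focus_untouched[OF F'(1) D ij Dlo Dum 3 2(2)[folded mlX]] foc
        show False unfolding D_def by blast
      qed
    qed
  qed
  ultimately have "\<forall>\<^sub>F t in F. 1 < fst t \<and> masses.regular (gmod (fst t) m) w \<epsilon> (snd t) c \<and> \<not> ?foc t"
  proof eventually_elim
    case (elim t)
    interpret masses "mmod (fst t) m" "gmod (fst t) m" by (rule masses_mod[OF m s elim(2)])
    show ?case using elim wok eps unfolding regular_def by auto
  qed
  then show ?thesis unfolding F_def by (rule eventually_mono) (simp add: case_prod_beta)
qed

section \<open>Orders without a collision of the lowest pair\<close>

lemma ups_inj:
  fixes m :: "'n::{finite,linorder} rvec"
  assumes m: "\<And>i. 0 < m $ i" and vs: "\<forall>i\<in>set vs. sec < i" and z: "ups (gams m) vs z = 0"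
  shows "z = 0"
proof -
  have m2: "m $ below i + m $ i \<noteq> 0" for i using m[of i] m[of "below i"] by simp
  have "ip m (ups (gams m) vs z) (ups (gams m) vs z) = ip m z z"
    by (rule ups_ip[OF vs m2]) (simp add: gams_def)
  then have "(\<Sum>k\<in>UNIV. m $ k * (z $ k)\<^sup>2) = 0" by (simp add: z ip_def power2_eq_square mult.assoc)
  then have "\<forall>k\<in>UNIV. m $ k * (z $ k)\<^sup>2 = 0"
    using m by (subst (asm) sum_nonneg_eq_0_iff) (auto simp: less_imp_le)
  then show ?thesis using m by (auto simp: vec_eq_iff less_le)
qed

text \<open>Without a bump the position part of the image lies along \<open>lo\<close>, whereas its
  velocity part has another nonzero component. The two can be proportional only with factor zero, so
  the focusing time is zero.\<close>

lemma focus_no_bump: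
  fixes m :: "'n::{finite,linorder} rvec"
  assumes m: "\<And>i. 0 < m $ i" and s: "(sec::'n) \<noteq> lo" and G: "1 < G"
    and wok: "\<And>k. \<forall>i\<in>set (snd (w k)). sec < i" and ab: "a < b" and X: "gap (snd x) a \<noteq> 0"
    and foc: "masses.focus (mmod G m) i j V t (dst (gmod G m) w \<epsilon> x (0, charv (mmod G m) a b (snd x)) 0)"
  shows "if i = lo then snd t $ lo + V = 0 else gap (fst t) i = 0 \<and> gap (fst t) j = 0"
proof -
  interpret masses "mmod G m" "gmod G m" by (rule masses_mod[OF m s G])
  let ?U = "ups (gams m) (snd (w 0))" and ?D = "charv (mmod G m) a b (snd x)"
  define d where "d = dst (gmod G m) w \<epsilon> x (0, ?D) 0"
  have neg: "- axis lo y = (axis lo (- y) :: 'n rvec)" for y :: real by (auto simp: axis_def vec_eq_iff)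
  have ax: "?U (axis lo y) = axis lo y" for y by (rule ups_axis_lo[OF wok])
  obtain y z where d: "fst d = axis lo y" "snd d = ?U (?D + axis lo z)"
    unfolding d_def dst_def dseg_def dkick_def by (auto simp: ups_gmod[OF wok] ax neg)
  have blo: "b \<noteq> lo" using ab by (metis lo_le not_le)
  have Db: "?D $ b \<noteq> 0"
  proof -
    have "nv (mmod G m) a $ b = 0"
      using ab below_less[of a] by (cases "a = lo") (auto simp: nv_def axis_def)
    moreover have "nv (mmod G m) b $ b = 1 / mmod G m $ b"
      using below_less[OF blo] blo by (auto simp: nv_def axis_def)
    ultimately show ?thesis using X M_nz[of b] by (simp add: charv_def)
  qed
  obtain k where k: "k \<noteq> lo" "snd d $ k \<noteq> 0"
  proof (rule ccontr)
    assume "\<not> thesis"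
    then have "\<And>k. k \<noteq> lo \<Longrightarrow> snd d $ k = 0" using that by blast
    then obtain e where e: "snd d = axis lo e" by (intro that[of "snd d $ lo"]) (auto simp: vec_eq_iff axis_def)
    have "?U (?D + axis lo z - axis lo e) = snd d - axis lo e"
      by (simp only: linear_diff[OF linear_ups] d(2) ax)
    then have "?U (?D + axis lo z - axis lo e) = 0" by (simp add: e)
    from ups_inj[OF m wok this] have "(?D + axis lo z - axis lo e) $ b = 0" by simp
    then show False using Db blo by (simp add: axis_def)
  qed
  from foc[folded d_def, unfolded focus_def] k obtain t0 where t0: "fst d = - t0 *\<^sub>R snd d" "i = lo \<longrightarrow> t0 = snd t $ lo + V"
    "i \<noteq> lo \<longrightarrow> gap (fst t) i = - t0 * gap (snd t) i \<and> gap (fst t) j = - t0 * gap (snd t) j"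
    by auto
  have "fst d $ k = 0" using k(1) by (simp add: d(1) axis_def)
  then have "t0 = 0" using t0(1) k(2) by simp
  then show ?thesis using t0 by simp
qed

text \<open>By \<open>focus_no_bump\<close> the final collisions would occur at time 0 for all
  points of a region. The resulting equations between root, velocity and positions are refuted by
  small moves inside the corner or, for a start on the floor, by the positive initial
  velocity.\<close>

lemma no_bump_nonvanishing:
  fixes m :: "'n::{finite,linorder} rvec"
  assumes m: "\<And>i. 0 < m $ i" and s: "(sec::'n) \<noteq> lo"
    and wok: "\<And>k. \<forall>i\<in>set (snd (w k)). sec < i" and ab: "a < b" and ij: "i < j" and nd: "nondegenerate m w 0 a b i j"
    and eps: "\<And>k. (\<epsilon> k)\<^sup>2 = (1::real)" "a = lo \<Longrightarrow> \<epsilon> 0 = 1"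
    and Q: "open Q" "Q \<inter> corner a b \<noteq> {}" "\<And>x. x \<in> Q \<Longrightarrow> 0 < snd x $ lo \<and> gap (snd x) a \<noteq> 0 \<and> 0 < rad x"
  shows "\<exists>x\<in>Q \<inter> corner a b. fin i j (broot (gmod 2 m) w \<epsilon> x 0) (bst (gmod 2 m) w \<epsilon> x 0) \<noteq> 0"
proof (rule ccontr)
  assume zero: "\<not> ?thesis"
  interpret masses "mmod 2 m" "gmod 2 m" by (rule masses_mod[OF m s]) simp
  let ?V = "\<lambda>x. broot (gmod 2 m) w \<epsilon> x 0" and ?S = "\<lambda>x. bst (gmod 2 m) w \<epsilon> x 0"
  let ?U = "ups (gams m) (snd (w 0))"
  define r where "r = real (fst (w 0))"
  have reg: "regular w \<epsilon> x 0" if "x \<in> Q" for x using Q(3)[OF that] wok eps by (auto simp: regular_def)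
  obtain Q' where Q': "open Q'" "Q' \<subseteq> Q" "Q' \<inter> corner a b \<noteq> {}"
    and foc: "\<And>x. x \<in> Q' \<inter> corner a b \<Longrightarrow> focus i j (?V x) (?S x) (dst (gmod 2 m) w \<epsilon> x (0, charv (mmod 2 m) a b (snd x)) 0)"
    using focus_region[OF Q(1,2) less_imp_neq[OF ab] ij, of w \<epsilon> 0] reg Q(3) zero by metis
  have fc: "if i = lo then snd (?S x) $ lo + ?V x = 0 else gap (fst (?S x)) i = 0 \<and> gap (fst (?S x)) j = 0"
    if "x \<in> Q' \<inter> corner a b" for x
  proof -
    have "gap (snd x) a \<noteq> 0" using that Q'(2) Q(3) by blast
    then show ?thesis by (intro focus_no_bump[OF m s _ wok ab _ foc[OF that]]) simp_all
  qed
  obtain x where x: "x \<in> Q' \<inter> corner a b" using Q'(3) by blast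
  have V2: "(?V y)\<^sup>2 = rad y" if "y \<in> Q'" for y
  proof -
    have "0 < rad y" using that Q' Q(3) by blast
    then show ?thesis using eps(1)[of 0] by (simp add: broot_def power_mult_distrib)
  qed
  have Vlo: "?V x = snd x $ lo" if "a = lo"
  proof -
    have "fst x $ lo = 0" using x that by (simp add: corner_def gap_eq)
    then have "rad x = (snd x $ lo)\<^sup>2" by (simp add: rad_def)
    moreover have "0 < snd x $ lo" using x Q' Q(3) by blast
    ultimately show ?thesis using eps(2)[OF that] by (simp add: broot_def)
  qed
  have Xpos: "0 < snd x $ lo" using x Q' Q(3) by blast
  have blo: "b \<noteq> lo" using ab by (metis lo_le not_le)
  \<comment> \<open>Lifting all particles together changes \<open>rad\<close> but no velocity and,
    if \<open>a \<noteq> lo\<close>, neither of the two gaps of the corner.\<close>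
  define up where "up = ((ev lo, 0) :: 'n phase)"
  have shift: "\<exists>t>0. x + t *\<^sub>R up \<in> Q' \<inter> corner a b \<and> x - t *\<^sub>R up \<in> Q' \<inter> corner a b" if "a \<noteq> lo"
    by (rule small_on_line[OF Q'(1) x]) (use that blo in \<open>simp_all add: up_def gap_ev\<close>)
  have rup: "rad (x + t *\<^sub>R up) = rad x + 2 * t" "snd (x + t *\<^sub>R up) = snd x"
    "rad (x - t *\<^sub>R up) = rad x - 2 * t" "snd (x - t *\<^sub>R up) = snd x" for t
    by (simp_all add: rad_def up_def ev_def)
  have ax: "?U (axis lo y) = axis lo y" for y by (rule ups_axis_lo[OF wok])
  have Sx: "snd (?S y) $ lo = snd y $ lo + 2 * r * ?V y"
    "fst (?S y) = ?U (fst y) - axis lo (2 * (r * ?V y) * (snd y $ lo + r * ?V y))" for y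
    by (simp_all add: bst_def seg_def kick_def ups_gmod[OF wok] ups_lo[OF wok] r_def linear_diff[OF linear_ups] ax)
  have jlo: "j \<noteq> lo" using ij by (metis lo_le not_le)
  show False
  proof (cases "i = lo")
    case True
    have e: "snd y $ lo = - ((1 + 2 * r) * ?V y)" if "y \<in> Q' \<inter> corner a b" for y
      using fc[OF that] True by (simp add: Sx algebra_simps)
    show False
    proof (cases "a = lo")
      case True
      have "(2 + 2 * r) * snd x $ lo = 0" using e[OF x] Vlo[OF True] by (simp add: algebra_simps)
      then show False using Xpos by (simp add: r_def)
    next
      case False
      have e2: "(snd y $ lo)\<^sup>2 = (1 + 2 * r)\<^sup>2 * rad y" if "y \<in> Q' \<inter> corner a b" for y
        using e[OF that] V2[of y] that by (simp add: power_mult_distrib)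
      obtain t where t: "0 < t" "x + t *\<^sub>R up \<in> Q' \<inter> corner a b" using shift[OF False] by blast
      have "(1 + 2 * r)\<^sup>2 * (2 * t) = 0" using e2[OF x] e2[OF t(2), unfolded rup] by (simp add: algebra_simps)
      then show False using t(1) by (simp add: r_def)
    qed
  next
    case False
    have gz: "gap (fst (?S y)) i = 0" "gap (fst (?S y)) j = 0" if "y \<in> Q' \<inter> corner a b" for y
      using fc[OF that] False by auto
    show False
    proof (cases "sec < i \<or> i = sec \<and> fst (w 0) = 0")
      case True
      then obtain q where q: "gap q a = 0" "gap q b = 0" "gap (?U q) i \<noteq> 0 \<or> gap (?U q) j \<noteq> 0"
        using nd unfolding nondegenerate_def by blast
      obtain t where t: "0 < t" "x + t *\<^sub>R (q, 0) \<in> Q' \<inter> corner a b"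
        using small_on_line[OF Q'(1) x, of "(q, 0)"] q by auto
      have gu: "gap (fst (?S y)) k = gap (?U (fst y)) k" if "k \<in> {i, j}" for k y
      proof (cases "fst (w 0) = 0")
        case True then show ?thesis by (simp add: Sx r_def) (simp add: axis_def vec_eq_iff gap_eq)
      next
        case False
        then have k: "sec < k" using True that ij by auto
        then have "below k \<noteq> lo" "k \<noteq> lo" using sec_le_below[OF k] s by (metis lo_le order_antisym, metis lo_le not_le)
        then show ?thesis by (simp add: Sx gap_eq axis_def)
      qed
      have "gap (?U q) k = 0" if k: "k \<in> {i, j}" for k
      proof -
        have "gap (?U (fst x)) k = 0" "gap (?U (fst (x + t *\<^sub>R (q, 0)))) k = 0"
          using gz[OF x] gz[OF t(2)] gu[OF k, of x] gu[OF k, of "x + t *\<^sub>R (q, 0)"] k by (auto simp del: fst_add)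
        then have "t * gap (?U q) k = 0" by (simp add: ups_linear_simps gap_linear)
        then show ?thesis using t(1) by simp
      qed
      then show False using q(3) by blast
    next
      case F: False
      then have i: "i = sec" and r: "1 \<le> r" using sec_le[OF False] by (auto simp: r_def)
      have fac: "2 * (r * q) * (X + r * v) + 2 * (r * v) * (1 + r * q) = 2 * r * (q * (X + r * v) + v * (1 + r * q))"
        for q X v :: real by (simp add: algebra_simps)
      \<comment> \<open>The derivative of the gap \<open>sec\<close> in the lowest velocity,
        multiplied by the root, is this quadratic form up to a nonzero factor.\<close>
      have quad: "(snd y $ lo)\<^sup>2 + 2 * r * snd y $ lo * ?V y + (?V y)\<^sup>2 = 0" if y: "y \<in> Q' \<inter> corner a b" for y
      proof -
        let ?\<eta> = "(0, axis lo 1) :: 'n phase"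
        have Vy: "?V y \<noteq> 0" using V2[of y] y Q' Q(3)[of y] by auto
        have "((\<lambda>t. gap (fst (?S (y + t *\<^sub>R ?\<eta>))) i) has_real_derivative
            gap (fst (dst (gmod 2 m) w \<epsilon> y ?\<eta> 0)) i) (at 0)"
          by (intro has_real_derivative_gap has_vector_derivative_fst deriv_bst)
            (use reg[of y] y Q' in \<open>auto simp: regular_def\<close>)
        moreover have "\<forall>\<^sub>F t in nhds 0. y + t *\<^sub>R ?\<eta> \<in> Q' \<inter> corner a b"
          by (rule eventually_on_line[OF Q'(1) y]) (simp_all add: gap_linear)
        then have "\<forall>\<^sub>F t in at 0. gap (fst (?S (y + t *\<^sub>R ?\<eta>))) i = 0"
          unfolding eventually_nhds_conv_at by (elim conjE eventually_mono) (rule gz(1))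
        moreover have "gap (fst (?S (y + 0 *\<^sub>R ?\<eta>))) i = 0" using gz(1)[OF y] by (simp flip: zero_prod_def)
        ultimately have "gap (fst (dst (gmod 2 m) w \<epsilon> y ?\<eta> 0)) i = 0" by (rule zero_derivative)
        moreover have "droot (?V y) y ?\<eta> = snd y $ lo / ?V y" by (simp add: droot_def axis_def)
        ultimately have "2 * (r * (snd y $ lo / ?V y)) * (snd y $ lo + r * ?V y) + 2 * (r * ?V y) * (1 + r * (snd y $ lo / ?V y)) = 0"
          (is "?C = 0")
        proof -
          assume g0: "gap (fst (dst (gmod 2 m) w \<epsilon> y ?\<eta> 0)) i = 0" and dr: "droot (?V y) y ?\<eta> = snd y $ lo / ?V y"
          have "fst (dst (gmod 2 m) w \<epsilon> y ?\<eta> 0) = - axis lo ?C"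
            unfolding dst_def dseg_def dkick_def r_def[symmetric]
            by (simp add: ups_gmod[OF wok] dr linear_neg[OF linear_ups] ups_axis_lo[OF wok] del: times_divide_eq_right times_divide_eq_left)
          then show "?C = 0" using g0 s by (simp add: i gap_eq below_sec[OF s] axis_def)
        qed
        then have "2 * r * ((snd y $ lo / ?V y) * (snd y $ lo + r * ?V y) + ?V y * (1 + r * (snd y $ lo / ?V y))) = 0"
          using fac[of "snd y $ lo / ?V y" "snd y $ lo" "?V y"] by simp
        then have "(snd y $ lo / ?V y) * (snd y $ lo + r * ?V y) + ?V y * (1 + r * (snd y $ lo / ?V y)) = 0" using r by simp
        moreover have "?V y * ((snd y $ lo / ?V y) * (snd y $ lo + r * ?V y) + ?V y * (1 + r * (snd y $ lo / ?V y)))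
            = (snd y $ lo)\<^sup>2 + 2 * r * snd y $ lo * ?V y + (?V y)\<^sup>2"
          using Vy by (simp add: field_simps power2_eq_square)
        ultimately show ?thesis by simp
      qed
      show False
      proof (cases "a = lo")
        case True
        have "0 < (snd x $ lo)\<^sup>2 + 2 * r * snd x $ lo * snd x $ lo + (snd x $ lo)\<^sup>2"
          using Xpos r by (intro add_pos_pos) auto
        then show False using quad[OF x] Vlo[OF True] by simp
      next
        case False
        define X where "X = snd x $ lo"
        \<comment> \<open>Squaring removes the root; the left side is quadratic in
          \<open>rad y\<close>, the right side linear.\<close>
        have q4: "(X\<^sup>2 + rad y)\<^sup>2 = 4 * r\<^sup>2 * X\<^sup>2 * rad y" if "y \<in> Q' \<inter> corner a b" "snd y = snd x" for y
        proof -
          have "X\<^sup>2 + rad y = - (2 * r * X * ?V y)" using quad[OF that(1)] V2[of y] that by (simp add: X_def)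
          then have "(X\<^sup>2 + rad y)\<^sup>2 = (2 * r * X * ?V y)\<^sup>2" by simp
          then show ?thesis using V2[of y] that by (simp add: power_mult_distrib)
        qed
        obtain t where t: "0 < t" "x + t *\<^sub>R up \<in> Q' \<inter> corner a b" "x - t *\<^sub>R up \<in> Q' \<inter> corner a b"
          using shift[OF False] by blast
        \<comment> \<open>A second difference along the lift isolates the quadratic term.\<close>
        have "(X\<^sup>2 + (rad x + 2 * t))\<^sup>2 + (X\<^sup>2 + (rad x - 2 * t))\<^sup>2 - 2 * (X\<^sup>2 + rad x)\<^sup>2 = 0"
          using q4[OF x refl] q4[OF t(2)] q4[OF t(3)] unfolding rup by (simp add: algebra_simps)
        moreover have "(X\<^sup>2 + (rad x + 2 * t))\<^sup>2 + (X\<^sup>2 + (rad x - 2 * t))\<^sup>2 - 2 * (X\<^sup>2 + rad x)\<^sup>2 = 8 * t\<^sup>2"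
          by (simp add: power2_eq_square algebra_simps)
        ultimately show False using t(1) by simp
      qed
    qed
  qed
qed

text \<open>For a start on the floor the first root is the initial speed, hence positive.\<close>

definition signs :: "bool \<Rightarrow> nat \<Rightarrow> (nat \<Rightarrow> real) set" where
  "signs onfl c = {\<epsilon>. (\<forall>k. \<epsilon> k \<in> {1, -1}) \<and> (\<forall>k>c. \<epsilon> k = 1) \<and> (onfl \<longrightarrow> \<epsilon> 0 = 1)}"

lemma finite_signs: "finite (signs onfl c)"
proof -
  have "signs onfl c \<subseteq> {\<epsilon>. \<forall>k. (k \<in> {..c} \<longrightarrow> \<epsilon> k \<in> {1, -1}) \<and> (k \<notin> {..c} \<longrightarrow> \<epsilon> k = 1)}"
    by (auto simp: signs_def)
  then show ?thesis by (rule finite_subset) (rule finite_set_of_finite_funs; simp)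
qed

text \<open>One coefficient and one region must serve all sign choices, so that afterwards a common
  point can be picked.\<close>

lemma good_region:
  fixes m :: "'n::{finite,linorder} rvec"
  assumes m: "\<And>i. 0 < m $ i" and s: "(sec::'n) \<noteq> lo"
    and wok: "\<And>k. \<forall>i\<in>set (snd (w k)). sec < i" and ab: "a < b" and ij: "i < j" and nd: "nondegenerate m w c a b i j"
  shows "\<exists>G Q. 1 < G \<and> open Q \<and> Q \<inter> corner a b \<noteq> {} \<and> (\<forall>x\<in>Q. 0 < snd x $ lo) \<and>
    (\<forall>\<epsilon>\<in>signs (a = lo) c. (\<forall>x\<in>Q. \<forall>k\<le>c. 0 < rad (bpre (gmod G m) w \<epsilon> x k)) \<and>
      (\<forall>Q'. open Q' \<longrightarrow> Q' \<subseteq> Q \<longrightarrow> Q' \<inter> corner a b \<noteq> {} \<longrightarrow>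
        (\<exists>x\<in>Q' \<inter> corner a b. fin i j (broot (gmod G m) w \<epsilon> x c) (bst (gmod G m) w \<epsilon> x c) \<noteq> 0)))"
proof -
  have eps: "(\<epsilon> k)\<^sup>2 = 1" if "\<epsilon> \<in> signs (a = lo) c" for \<epsilon> k
    using that unfolding signs_def by (auto simp: power2_eq_1_iff)
  have cn: "continuous_on UNIV (\<lambda>x :: 'n phase. gap (snd x) k)" "continuous_on UNIV (\<lambda>x :: 'n phase. snd x $ lo)"
    "continuous_on UNIV (rad :: 'n phase \<Rightarrow> real)" for k
    by (cases "k = lo") (auto simp: gap_eq rad_def intro!: continuous_intros)
  show ?thesis
  proof (cases "c = 0")
    case True
    have "\<exists>X. \<forall>f\<in>{\<lambda>X::'n rvec. X $ lo, \<lambda>X. gap X a}. f X \<noteq> 0"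
    proof (rule generic_point)
      fix f :: "'n rvec \<Rightarrow> real" assume "f \<in> {\<lambda>X. X $ lo, \<lambda>X. gap X a}"
      moreover have "linear (\<lambda>X::'n rvec. X $ lo) \<and> (\<exists>X::'n rvec. X $ lo \<noteq> 0)"
        by (intro conjI linear_nth exI[of _ "axis lo 1"]) (simp add: axis_def)
      moreover have "linear (\<lambda>X. gap X a) \<and> (\<exists>X. gap X a \<noteq> 0)"
        by (intro conjI linear_gap exI[of _ "axis a 1"]) (simp add: gap_axis)
      ultimately show "linear f \<and> (\<exists>X. f X \<noteq> 0)" by auto
    qed simp
    then obtain X :: "'n rvec" where X: "X $ lo \<noteq> 0" "gap X a \<noteq> 0" by auto
    define Q where "Q = {x :: 'n phase. 0 < snd x $ lo} \<inter> (\<lambda>x. gap (snd x) a) -` (- {0}) \<inter> {x. 0 < rad x}"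
    have oQ: "open Q" unfolding Q_def
      by (intro open_Int open_vimage open_Collect_less cn continuous_on_const) auto
    have ne: "(0, sgn (X $ lo) *\<^sub>R X) \<in> Q \<inter> corner a b"
      using X by (auto simp: Q_def corner_def gap_linear rad_def sgn_if)
    \<comment> \<open>With no collision of the lowest pair there is no limit to take; 2 is just a
      coefficient above 1.\<close>
    have nz: "\<exists>x\<in>Q' \<inter> corner a b. fin i j (broot (gmod 2 m) w \<epsilon> x c) (bst (gmod 2 m) w \<epsilon> x c) \<noteq> 0"
      if "\<epsilon> \<in> signs (a = lo) c" "open Q'" "Q' \<subseteq> Q" "Q' \<inter> corner a b \<noteq> {}" for \<epsilon> Q'
      unfolding True
    proof (rule no_bump_nonvanishing[OF m s wok ab ij nd[unfolded True] eps[OF that(1)] _ that(2,4)])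
      show "a = lo \<Longrightarrow> \<epsilon> 0 = 1" using that(1) by (simp add: signs_def)
      show "0 < snd x $ lo \<and> gap (snd x) a \<noteq> 0 \<and> 0 < rad x" if "x \<in> Q'" for x
        using that \<open>Q' \<subseteq> Q\<close> by (auto simp: Q_def)
    qed
    show ?thesis
    proof (intro exI[of _ 2] exI[of _ Q] conjI ballI allI impI)
      show "Q \<inter> corner a b \<noteq> {}" using ne by blast
      show "0 < snd x $ lo" if "x \<in> Q" for x using that by (simp add: Q_def)
      show "0 < rad (bpre (gmod 2 m) w \<epsilon> x k)" if "x \<in> Q" "k \<le> c" for \<epsilon> x k
        using that True by (simp add: Q_def)
    qed (use oQ nz in simp_all)
  next
    case False
    then have c: "1 \<le> c" by simp
    obtain X where X: "0 < X $ lo" "gap X a \<noteq> 0" and X': 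
      "\<forall>e\<in>{1, -1}. (1 + 2 * real (fst (w 0)) * e) * X $ lo - ups (gams m) (snd (w 0)) X $ sec \<noteq> 0"
      "if a \<le> sec then \<forall>e\<in>{1, -1}. (1 + 2 * real (fst (w 0)) * e) * charv (mlim m) a b X $ lo
         - ups (gams m) (snd (w 0)) (charv (mlim m) a b X) $ sec \<noteq> 0
       else (\<exists>k<c. (\<forall>Y. \<forall>k'<k. uprod (gams m) w (Suc k') (charv m a b Y) $ sec = 0) \<and>
            uprod (gams m) w (Suc k) (charv m a b X) $ sec \<noteq> 0) \<or>
          (\<forall>Y. \<forall>k<c. uprod (gams m) w (Suc k) (charv m a b Y) $ sec = 0) \<and>
            uprod (gams m) w (Suc c) (charv m a b X) \<notin> span (nv m ` ({i, j} \<inter> {sec<..}))"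
      using choose_velocity[OF m s wok ab c nd] by (elim exE conjE) (rule that)
    define good where "good = (\<lambda>\<epsilon> (G, x). 1 < G \<and> masses.regular (gmod G m) w \<epsilon> x c \<and>
     \<not> masses.focus (mmod G m) i j (broot (gmod G m) w \<epsilon> x c) (bst (gmod G m) w \<epsilon> x c)
       (dst (gmod G m) w \<epsilon> x (0, charv (mmod G m) a b (snd x)) c))"
    have "\<forall>\<^sub>F t in at_top \<times>\<^sub>F nhds (0, X). \<forall>\<epsilon>\<in>signs (a = lo) c. good \<epsilon> t"
    proof (intro eventually_ball_finite finite_signs ballI)
      fix \<epsilon> assume e: "\<epsilon> \<in> signs (a = lo) c"
      show "\<forall>\<^sub>F t in at_top \<times>\<^sub>F nhds (0, X). good \<epsilon> t"
        unfolding good_def by (rule no_focus_region[OF m s wok eps[OF e] ab ij c nd X(1) X'])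
    qed
    then obtain PG PQ where PG: "eventually PG at_top" and PQ: "eventually PQ (nhds (0, X))"
      and gd: "\<And>G x. PG G \<Longrightarrow> PQ x \<Longrightarrow> \<forall>\<epsilon>\<in>signs (a = lo) c. good \<epsilon> (G, x)"
      unfolding eventually_prod_filter by blast
    obtain G where G: "PG G" "1 < G"
      using eventually_happens[OF eventually_conj[OF PG eventually_gt_at_top[of 1]]] by auto
    obtain Q0 where Q0: "open Q0" "(0, X) \<in> Q0" "\<And>x. x \<in> Q0 \<Longrightarrow> PQ x"
      using PQ unfolding eventually_nhds by blast
    define Q where "Q = Q0 \<inter> {x :: 'n phase. 0 < snd x $ lo} \<inter> (\<lambda>x. gap (snd x) a) -` (- {0})"
    have oQ: "open Q" unfolding Q_def
      by (intro open_Int open_vimage open_Collect_less cn continuous_on_const Q0(1)) auto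
    \<comment> \<open>With all positions zero every collision equation holds.\<close>
    have ne: "(0, X) \<in> Q \<inter> corner a b" using X Q0(2) by (simp add: Q_def corner_def gap_linear)
    interpret masses "mmod G m" "gmod G m" by (rule masses_mod[OF m s G(2)])
    have reg: "regular w \<epsilon> x c \<and> gap (snd x) a \<noteq> 0" and
      nf: "\<not> focus i j (broot (gmod G m) w \<epsilon> x c) (bst (gmod G m) w \<epsilon> x c)
       (dst (gmod G m) w \<epsilon> x (0, charv (mmod G m) a b (snd x)) c)"
      if "x \<in> Q" "\<epsilon> \<in> signs (a = lo) c" for x \<epsilon>
      using gd[OF G(1) Q0(3), of x] that unfolding good_def Q_def by auto
    have "\<exists>x\<in>Q' \<inter> corner a b. fin i j (broot (gmod G m) w \<epsilon> x c) (bst (gmod G m) w \<epsilon> x c) \<noteq> 0"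
      if e: "\<epsilon> \<in> signs (a = lo) c" and Q': "open Q'" "Q' \<subseteq> Q" "Q' \<inter> corner a b \<noteq> {}" for \<epsilon> Q'
    proof (rule ccontr)
      assume "\<not> ?thesis"
      then have zero: "fin i j (broot (gmod G m) w \<epsilon> x c) (bst (gmod G m) w \<epsilon> x c) = 0" if "x \<in> Q' \<inter> corner a b" for x
        using that by blast
      have rq: "regular w \<epsilon> x c \<and> gap (snd x) a \<noteq> 0" if "x \<in> Q'" for x
        using reg[OF _ e, of x] Q'(2) that by blast
      have "\<exists>Q''. open Q'' \<and> Q'' \<subseteq> Q' \<and> Q'' \<inter> corner a b \<noteq> {} \<and>
        (\<forall>x\<in>Q'' \<inter> corner a b. focus i j (broot (gmod G m) w \<epsilon> x c) (bst (gmod G m) w \<epsilon> x c)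
         (dst (gmod G m) w \<epsilon> x (0, charv (mmod G m) a b (snd x)) c))"
        by (rule focus_region[OF Q'(1,3) less_imp_neq[OF ab] ij rq zero])
      then obtain x where "x \<in> Q'" "focus i j (broot (gmod G m) w \<epsilon> x c) (bst (gmod G m) w \<epsilon> x c)
         (dst (gmod G m) w \<epsilon> x (0, charv (mmod G m) a b (snd x)) c)"
        by auto
      then show False using nf[OF _ e] Q'(2) by blast
    qed
    note nz = this
    show ?thesis
    proof (intro exI[of _ G] exI[of _ Q] conjI ballI allI impI)
      show "Q \<inter> corner a b \<noteq> {}" using ne by blast
      show "0 < snd x $ lo" if "x \<in> Q" for x using that by (simp add: Q_def)
      show "0 < rad (bpre (gmod G m) w \<epsilon> x k)" if "\<epsilon> \<in> signs (a = lo) c" "x \<in> Q" "k \<le> c" for \<epsilon> x k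
        using reg[OF that(2,1)] that(3) by (simp add: regular_def)
    qed (use G(2) oQ nz in simp_all)
  qed
qed

text \<open>All solutions of the root equations up to stage \<open>c\<close> arise from finitely
  many sign choices, and the return function of each is continuous; so one point avoids all their
  zeros.\<close>

theorem generic_nonvanishing:
  fixes m :: "'n::{finite,linorder} rvec"
  assumes m: "\<And>i. 0 < m $ i" and s: "(sec::'n) \<noteq> lo"
    and wok: "\<And>k. \<forall>i\<in>set (snd (w k)). sec < i" and ab: "a < b" and ij: "i < j" and nd: "nondegenerate m w c a b i j"
  shows "\<exists>G x. 1 < G \<and> x \<in> corner a b \<and>
    (\<forall>V n. n \<le> c \<and> tower (a = lo) (gmod G m) w V x n \<longrightarrow> 0 < rad (pre (gmod G m) w V x n)) \<and>
    (\<forall>V. tower (a = lo) (gmod G m) w V x (Suc c) \<longrightarrow> fin i j (V c) (st (gmod G m) w V x c) \<noteq> 0)"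
proof -
  obtain G Q where G: "1 < G" and Q: "open Q" "Q \<inter> corner a b \<noteq> {}" "\<forall>x\<in>Q. 0 < snd x $ lo"
    and H: "\<forall>\<epsilon>\<in>signs (a = lo) c. (\<forall>x\<in>Q. \<forall>k\<le>c. 0 < rad (bpre (gmod G m) w \<epsilon> x k)) \<and>
      (\<forall>Q'. open Q' \<longrightarrow> Q' \<subseteq> Q \<longrightarrow> Q' \<inter> corner a b \<noteq> {} \<longrightarrow>
        (\<exists>x\<in>Q' \<inter> corner a b. fin i j (broot (gmod G m) w \<epsilon> x c) (bst (gmod G m) w \<epsilon> x c) \<noteq> 0))"
    using good_region[OF m s wok ab ij nd] by (elim exE conjE) (rule that)
  have pos: "0 < rad (bpre (gmod G m) w \<epsilon> x k)" if "\<epsilon> \<in> signs (a = lo) c" "x \<in> Q" "k \<le> c" for \<epsilon> x k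
    using bspec[OF H that(1)] that(2,3) by simp
  have nz: "\<exists>x\<in>Q' \<inter> corner a b. fin i j (broot (gmod G m) w \<epsilon> x c) (bst (gmod G m) w \<epsilon> x c) \<noteq> 0"
    if "\<epsilon> \<in> signs (a = lo) c" "open Q'" "Q' \<subseteq> Q" "Q' \<inter> corner a b \<noteq> {}" for \<epsilon> Q'
    using bspec[OF H that(1)] that(2-) by (elim conjE) (drule spec[of _ Q'], simp)
  have "\<exists>x\<in>Q \<inter> corner a b. \<forall>\<epsilon>\<in>signs (a = lo) c. fin i j (broot (gmod G m) w \<epsilon> x c) (bst (gmod G m) w \<epsilon> x c) \<noteq> 0"
    by (rule simultaneous_nonvanishing[OF finite_signs continuous_fin nz Q(1,2)])
  then obtain x where x: "x \<in> Q \<inter> corner a b"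
    and xnz: "\<And>\<epsilon>. \<epsilon> \<in> signs (a = lo) c \<Longrightarrow> fin i j (broot (gmod G m) w \<epsilon> x c) (bst (gmod G m) w \<epsilon> x c) \<noteq> 0"
    by auto
  have sg: "\<exists>\<epsilon>\<in>signs (a = lo) c. (\<forall>k\<le>n. pre (gmod G m) w V x k = bpre (gmod G m) w \<epsilon> x k) \<and>
      (\<forall>k<n. V k = broot (gmod G m) w \<epsilon> x k)"
    if tw: "tower (a = lo) (gmod G m) w V x n" and n: "n \<le> Suc c" for V n
  proof -
    \<comment> \<open>Signs from \<open>n\<close> on do not affect the states considered; setting
      them to 1 puts the sequence into the finite set \<open>signs\<close>.\<close>
    define \<epsilon>0 \<epsilon> where "\<epsilon>0 = (\<lambda>k. if 0 \<le> V k then 1 else - 1 :: real)" and "\<epsilon> = (\<lambda>k. if k < n then \<epsilon>0 k else 1)"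
    have b: "bpre (gmod G m) w \<epsilon>0 x k = bpre (gmod G m) w \<epsilon> x k" if "k \<le> n" for k
      by (rule bpre_cong[of n]) (use that in \<open>simp_all add: \<epsilon>_def\<close>)
    note t = tower_signs[OF tw, folded \<epsilon>0_def]
    have "V k = broot (gmod G m) w \<epsilon> x k" if "k < n" for k
      using t(2)[OF that] b[of k] that by (simp add: broot_def \<epsilon>_def)
    moreover have "\<epsilon> \<in> signs (a = lo) c"
    proof -
      have "\<epsilon> 0 = 1" if "a = lo"
      proof (cases "0 < n")
        case True
        then have "V 0 = snd x $ lo" using tw that by (simp add: tower_def)
        moreover have "0 < snd x $ lo" using Q(3) x by blast
        ultimately show ?thesis by (simp add: \<epsilon>_def \<epsilon>0_def)
      qed (simp add: \<epsilon>_def)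
      then show ?thesis using n by (auto simp: signs_def \<epsilon>_def \<epsilon>0_def)
    qed
    ultimately show ?thesis using t(1) b by auto
  qed
  have "0 < rad (pre (gmod G m) w V x n)" if "n \<le> c" "tower (a = lo) (gmod G m) w V x n" for V n
    using sg[OF that(2)] pos[of _ x n] x that(1) by fastforce
  moreover have "fin i j (V c) (st (gmod G m) w V x c) \<noteq> 0" if tw: "tower (a = lo) (gmod G m) w V x (Suc c)" for V
  proof -
    obtain \<epsilon> where e: "\<epsilon> \<in> signs (a = lo) c" "pre (gmod G m) w V x c = bpre (gmod G m) w \<epsilon> x c" "V c = broot (gmod G m) w \<epsilon> x c"
      using sg[OF tw order_refl] by auto
    show ?thesis using xnz[OF e(1)] e(2,3) by (simp add: st_def bst_def)
  qed
  ultimately show ?thesis using G x by blast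
qed

section \<open>The collision order of an orbit\<close>

lemma kick_zero: "kick 0 s = s"
  by (simp add: kick_def axis_def vec_eq_iff prod_eq_iff)

lemma kick_kick: "kick v (kick u s) = kick (u + v) s"
  by (simp add: kick_def axis_def vec_eq_iff prod_eq_iff algebra_simps)

lemma kick_map_ups:
  assumes "\<forall>i\<in>set vs. sec < i"
  shows "kick V (map_prod (ups g vs) (ups g vs) s) = map_prod (ups g vs) (ups g vs) (kick V s)"
  by (simp add: kick_def ups_lo[OF assms] ups_axis_lo[OF assms] linear_diff[OF linear_ups] linear_add[OF linear_ups])

lemma rad_seg: "\<forall>i\<in>set (snd \<sigma>). sec < i \<Longrightarrow> rad (seg g \<sigma> V s) = rad s"
  using rad_kick[of "real (fst \<sigma>) * V" s] by (simp add: rad_def seg_def ups_lo)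

lemma gap_free_flow:
  "i \<noteq> lo \<Longrightarrow> gap (fst (free_flow t s)) i = gap (fst s) i + t * gap (snd s) i"
  "gap (fst (free_flow t s)) lo = fst s $ lo + t * snd s $ lo - t\<^sup>2 / 2"
  "i \<noteq> lo \<Longrightarrow> gap (snd (free_flow t s)) i = gap (snd s) i"
  "gap (snd (free_flow t s)) lo = snd s $ lo - t"
  by (simp_all add: gap_eq free_flow_def algebra_simps)

lemma free_flow_add: "free_flow t (free_flow u s) = free_flow (u + t) s"
  by (simp add: free_flow_def vec_eq_iff power2_eq_square field_simps)

text \<open>The rows of a bump sum to 1, so it commutes with the common gravity term; and it fixes
  the positions at the collision, whose entries at \<open>i\<close> and \<open>below i\<close>
  agree.\<close>

lemma collision_flow_bump:
  assumes i: "i \<noteq> lo" and z: "gap (fst (free_flow t s)) i = 0"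
  shows "(fst (free_flow t s), collision m i (snd (free_flow t s)))
     = free_flow t (map_prod (bump (gam m i) i) (bump (gam m i) i) s)"
proof -
  have p: "fst s $ i = fst s $ below i + t * snd s $ below i - t * snd s $ i"
    using z[unfolded gap_free_flow(1)[OF i]] i by (simp add: gap_eq algebra_simps)
  have "(fst (free_flow t s) $ j = fst (free_flow t (map_prod (bump (gam m i) i) (bump (gam m i) i) s)) $ j) \<and>
      (bump (gam m i) i (snd (free_flow t s)) $ j = snd (free_flow t (map_prod (bump (gam m i) i) (bump (gam m i) i) s)) $ j)" for j
  proof -
    have "below i \<noteq> i" using below_less[OF i] by simp
    then consider "j = below i" "j \<noteq> i" | "j = i" "j \<noteq> below i" | "j \<noteq> i" "j \<noteq> below i" by auto
    then show ?thesis
      by cases (simp_all add: free_flow_def bump_def p, simp_all add: algebra_simps)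
  qed
  then show ?thesis
    by (simp add: collision_eq_bump[OF i] prod_eq_iff vec_eq_iff)
qed

lemma collision_flow_kick:
  assumes z: "gap (fst (free_flow t s)) lo = 0"
  shows "(fst (free_flow t s), collision m lo (snd (free_flow t s))) = free_flow t (kick (t - snd s $ lo) s)"
proof -
  have p: "fst s $ lo = t\<^sup>2 / 2 - t * snd s $ lo" using z by (simp add: gap_free_flow)
  show ?thesis
    by (auto simp: free_flow_def kick_def collision_def lowest_iff axis_def vec_eq_iff prod_eq_iff p power2_eq_square algebra_simps)
qed

text \<open>A particle reaches the floor moving downwards, which selects the nonnegative
  root.\<close>

lemma flow_root:
  assumes z: "gap (fst (free_flow t s)) lo = 0" and v: "gap (snd (free_flow t s)) lo \<le> 0"
  shows "sqrt (rad s) = t - snd s $ lo"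
proof -
  have "(t - snd s $ lo)\<^sup>2 = rad s"
    using z by (simp add: gap_free_flow rad_def power2_eq_square algebra_simps)
  moreover have "0 \<le> t - snd s $ lo" using v by (simp add: gap_free_flow)
  ultimately show ?thesis using real_sqrt_unique by metis
qed

lemma rad_flow_nonneg:
  assumes "fst (free_flow t s) \<in> config"
  shows "0 \<le> rad s"
proof -
  have "0 \<le> fst s $ lo + t * snd s $ lo - t\<^sup>2 / 2"
    using gap_nonneg[OF assms, of lo] by (simp add: gap_free_flow)
  moreover have "rad s = (snd s $ lo - t)\<^sup>2 + 2 * (fst s $ lo + t * snd s $ lo - t\<^sup>2 / 2)"
    by (simp add: rad_def power2_eq_square algebra_simps)
  ultimately show ?thesis by simp
qed

text \<open>Halfway to the collision every gap is positive. In free fall the gaps are affine in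
  time, except that of the floor, which is concave; so a gap that closes does so with strictly
  negative velocity.\<close>

lemma arrival_velocity:
  assumes "next_collision x y" "gap (fst y) i = 0"
  shows "gap (snd y) i < 0"
proof -
  obtain t where t: "t > 0" "y = free_flow t x"
    "\<And>s. s \<in> {0<..<t} \<Longrightarrow> fst (free_flow s x) \<in> config - config_boundary"
    using assms(1) unfolding next_collision_def by blast
  have "fst (free_flow (t / 2) x) \<in> config - config_boundary" by (rule t(3)) (use t(1) in simp)
  then have "0 < gap (fst (free_flow (t / 2) x)) i"
    using gap_nonneg[of "fst (free_flow (t / 2) x)" i] unfolding config_boundary_def by (auto simp: order_less_le)
  moreover have "free_flow (t / 2) x = free_flow (- (t / 2)) y"
    unfolding t(2) free_flow_add by simp
  ultimately have p: "0 < gap (fst (free_flow (- (t / 2)) y)) i" by simp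
  show ?thesis
  proof (cases "i = lo")
    case True
    have "0 < fst y $ lo - t / 2 * snd y $ lo - (t / 2)\<^sup>2 / 2" "fst y $ lo = 0"
      using p assms(2) True by (simp_all add: gap_free_flow(2)) (simp add: gap_eq)
    then have "t * snd y $ lo < 0" using zero_le_power2[of "t / 2"] by linarith
    then show ?thesis using t(1) True by (simp add: gap_eq mult_less_0_iff)
  next
    case False
    then have "t * gap (snd y) i < 0" using p assms(2) by (simp add: gap_free_flow(1))
    then show ?thesis using t(1) by (simp add: mult_less_0_iff)
  qed
qed

text \<open>In extrapolated coordinates the gap of the lowest pair is affine in time. Its zero is
  \<open>\<tau>\<close>, and the nonzero slope makes it the only one.\<close>

definition contact :: "'n::{finite,linorder} phase \<Rightarrow> real \<Rightarrow> bool" where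
  "contact z \<tau> \<longleftrightarrow> gap (fst z) sec + \<tau> * gap (snd z) sec = 0 \<and> gap (snd z) sec \<noteq> 0"

lemma contact_once: "contact z \<tau> \<Longrightarrow> \<tau> < t \<Longrightarrow> gap (fst z + t *\<^sub>R snd z) sec \<noteq> 0"
proof
  assume c: "contact z \<tau>" "\<tau> < t" and "gap (fst z + t *\<^sub>R snd z) sec = 0"
  then have "gap (fst z) sec + t * gap (snd z) sec - (gap (fst z) sec + \<tau> * gap (snd z) sec) = 0"
    by (simp add: contact_def gap_linear)
  then have "(t - \<tau>) * gap (snd z) sec = 0" by (simp add: algebra_simps)
  then show False using c by (simp add: contact_def)
qed

text \<open>The word fixes \<open>axis sec 1\<close> up to the normal of a closed gap, so by
  isometry the \<open>sec\<close> component of \<open>D\<close> is the same before and after it. The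
  \<open>lo\<close> component never changes, hence neither does the gap between the two.\<close>

lemma contact_before_letters:
  fixes m :: "'n::{finite,linorder} rvec"
  assumes m: "\<And>i. 0 < m $ i" and s: "(sec::'n) \<noteq> lo" and vs: "\<forall>i\<in>set vs. sec < i"
    and u: "ups (gams m) vs (axis sec 1) = axis sec 1 + \<beta> *\<^sub>R nv m j"
    and z: "gap (ups (gams m) vs D) sec = 0" "\<beta> = 0 \<or> gap (ups (gams m) vs D) j = 0"
  shows "gap D sec = 0"
proof -
  have m2: "m $ below i + m $ i \<noteq> 0" for i using m[of i] m[of "below i"] by simp
  have nz: "m $ k \<noteq> 0" for k using m[of k] by simp
  have "ip m (ups (gams m) vs (axis sec 1)) (ups (gams m) vs D) = ip m (axis sec 1) D"
    by (rule ups_ip[OF vs m2]) (simp add: gams_def)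
  then have "m $ sec * D $ sec = m $ sec * ups (gams m) vs D $ sec"
    using z(2) by (auto simp: u ip_add ip_scale ip_axis ip_nv[OF nz])
  then have "D $ sec = ups (gams m) vs D $ sec" using nz[of sec] by simp
  also have "\<dots> = D $ lo" using z(1) s by (simp add: gap_eq below_sec ups_lo[OF vs])
  finally show ?thesis using s by (simp add: gap_eq below_sec)
qed

text \<open>The roots are nonnegative here, being the speeds at the floor.\<close>

definition run where
  "run m a x w c \<tau> s \<longleftrightarrow> (\<forall>k. \<forall>i\<in>set (snd (w k)). (sec::'n::{finite,linorder}) < i) \<and> (\<forall>k>c. w k = (0, [])) \<and>
     s = bst (gams m) w (\<lambda>_. 1) x c \<and>
     (1 \<le> c \<or> a = sec \<longrightarrow> contact (bpre (gams m) w (\<lambda>_. 1) x c) \<tau>) \<and>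
     (\<forall>k<c. 1 \<le> k \<or> a = sec \<longrightarrow> fst (w k) \<noteq> 0 \<or> ups (gams m) (snd (w k)) (axis sec 1) \<noteq> axis sec 1) \<and>
     (\<forall>k\<le>c. 0 \<le> rad (bpre (gams m) w (\<lambda>_. 1) x k))"

lemma run_init: "fst x \<in> config \<Longrightarrow> gap (fst x) a = 0 \<Longrightarrow> gap (snd x) a \<noteq> 0 \<Longrightarrow> run m a x (\<lambda>_. (0, [])) 0 0 x"
  using rad_flow_nonneg[of 0 x]
  by (auto simp: free_flow_def run_def contact_def bst_def seg_def ups_def kick_zero map_prod_def)

lemma bpre_cong_word:
  assumes "\<And>k. k < n \<Longrightarrow> w k = w' k" "k \<le> n"
  shows "bpre g w \<epsilon> x k = bpre g w' \<epsilon> x k"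
  using assms(2)
proof (induction k)
  case (Suc k)
  then show ?case using assms(1)[of k] by simp
qed simp

lemma run_update:
  assumes run: "run m a x w c \<tau> s" and vs: "\<forall>i\<in>set (snd \<sigma>). sec < i"
    and s': "s' = seg (gams m) \<sigma> (broot (gams m) w (\<lambda>_. 1) x c) (bpre (gams m) w (\<lambda>_. 1) x c)"
  shows "run m a x (w(c := \<sigma>)) c \<tau> s'"
proof -
  have "bpre (gams m) (w(c := \<sigma>)) (\<lambda>_. 1) x k = bpre (gams m) w (\<lambda>_. 1) x k" if "k \<le> c" for k
    by (rule bpre_cong_word[of c]) (use that in auto)
  then show ?thesis using run vs unfolding run_def s' by (auto simp: bst_def broot_def)
qed

text \<open>Such a stage would leave the affine gap of the lowest pair with a second zero, at
  \<open>t\<close> after \<open>\<tau>\<close>, against \<open>contact_once\<close>.\<close>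

lemma stage_contact:
  fixes m :: "'n::{finite,linorder} rvec"
  assumes m: "\<And>i. 0 < m $ i" and s: "(sec::'n) \<noteq> lo" and run: "run m a x w c \<tau> s'" and \<tau>: "\<tau> < t"
    and r: "1 \<le> c \<or> a = sec" "fst (w c) = 0"
    and u: "ups (gams m) (snd (w c)) (axis sec 1) = axis sec 1 + \<beta> *\<^sub>R nv m j"
    and z: "gap (fst s' + t *\<^sub>R snd s') sec = 0" "\<beta> = 0 \<or> gap (fst s' + t *\<^sub>R snd s') j = 0"
  shows False
proof -
  define z where "z = bpre (gams m) w (\<lambda>_. 1) x c"
  have vs: "\<forall>i\<in>set (snd (w c)). sec < i" and c: "contact z \<tau>" using run r(1) by (auto simp: run_def z_def)
  have s': "s' = map_prod (ups (gams m) (snd (w c))) (ups (gams m) (snd (w c))) z"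
    using run r(2) by (simp add: run_def bst_def seg_def kick_zero z_def)
  have D: "fst s' + t *\<^sub>R snd s' = ups (gams m) (snd (w c)) (fst z + t *\<^sub>R snd z)"
    by (simp add: s' linear_add[OF linear_ups] linear_scale[OF linear_ups])
  have "gap (fst z + t *\<^sub>R snd z) sec = 0"
    by (rule contact_before_letters[OF m s vs u]) (use assms(8,9) D in simp_all)
  then show False using contact_once[OF c \<tau>] by simp
qed

text \<open>A floor hit raises the counter of the current stage, a collision above
  \<open>sec\<close> extends its word, and a collision of the lowest pair opens a new stage and
  resets \<open>\<tau>\<close> to the present time. In the last case \<open>stage_contact\<close>
  shows that the completed stage was not trivial.\<close>

lemma run_step:
  fixes m :: "'n::{finite,linorder} rvec"
  assumes m: "\<And>i. 0 < m $ i" and s: "(sec::'n) \<noteq> lo" and run: "run m a x w c \<tau> s'" and \<tau>: "\<tau> < t"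
    and cf: "fst (free_flow t s') \<in> config"
    and z: "gap (fst (free_flow t s')) i = 0" and v: "gap (snd (free_flow t s')) i < 0"
  shows "\<exists>w c \<tau> s. run m a x w c \<tau> s \<and> \<tau> \<le> t \<and>
    (fst (free_flow t s'), collision m i (snd (free_flow t s'))) = free_flow t s"
proof -
  have vs: "\<forall>i\<in>set (snd (w k)). sec < i" for k using run by (simp add: run_def)
  have s': "s' = seg (gams m) (w c) (broot (gams m) w (\<lambda>_. 1) x c) (bpre (gams m) w (\<lambda>_. 1) x c)"
    using run by (simp add: run_def bst_def)
  consider "i = lo" | "i = sec" | "sec < i" using sec_le[of i] by fastforce
  then show ?thesis
  proof cases
    case 1
    have V: "broot (gams m) w (\<lambda>_. 1) x c = t - snd s' $ lo"
      using flow_root[of t s'] z v 1 rad_seg[OF vs, of "gams m" c] by (simp add: broot_def s')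
    have "run m a x (w(c := (Suc (fst (w c)), snd (w c)))) c \<tau> (kick (t - snd s' $ lo) s')"
    proof (rule run_update[OF run])
      show "kick (t - snd s' $ lo) s' = seg (gams m) (Suc (fst (w c)), snd (w c)) (broot (gams m) w (\<lambda>_. 1) x c) (bpre (gams m) w (\<lambda>_. 1) x c)"
        unfolding V[symmetric] by (subst s') (simp add: seg_def kick_map_ups[OF vs] kick_kick algebra_simps)
    qed (use vs in simp)
    then show ?thesis
      using collision_flow_kick[of t s' m] z 1 \<tau> less_imp_le by blast
  next
    case 2
    have ze: "gap (fst s' + t *\<^sub>R snd s') sec = 0" using z 2 s by (simp add: gap_free_flow gap_linear)
    have vn: "gap (snd s') sec \<noteq> 0" using v 2 s by (simp add: gap_free_flow)
    have e: "bpre (gams m) w (\<lambda>_. 1) x (Suc c) = bump2 (gams m) s'"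
      using run by (simp only: bpre_Suc run_def)
    have g: "gap (bump (gam m sec) sec q) sec = - gap q sec" for q :: "'n rvec"
      using gap_collision[of m sec q] collision_eq_bump[OF s] by simp
    have ct: "contact (bump2 (gams m) s') t"
      using ze vn by (simp add: contact_def bump2_def gams_def g gap_linear)
    \<comment> \<open>Stages beyond the current one are empty by convention, so the new stage starts
      right at the bump.\<close>
    have "w (Suc c) = (0, [])" using run by (simp add: run_def)
    then have b: "bst (gams m) w (\<lambda>_. 1) x (Suc c) = bump2 (gams m) s'"
      unfolding bst_def e by (simp add: seg_def kick_zero ups_def map_prod_def)
    have last: "fst (w c) \<noteq> 0 \<or> ups (gams m) (snd (w c)) (axis sec 1) \<noteq> axis sec 1" if "1 \<le> c \<or> a = sec"
    proof (rule ccontr)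
      assume n: "\<not> ?thesis"
      show False by (rule stage_contact[OF m s run \<tau> that, where \<beta> = 0]) (use n ze in simp_all)
    qed
    have fl: "(fst (free_flow t s'), collision m i (snd (free_flow t s'))) = free_flow t (bump2 (gams m) s')"
      unfolding 2 bump2_def using collision_flow_bump[OF s, of t s' m] z 2 by (simp add: gams_def)
    then have "0 \<le> rad (bump2 (gams m) s')" using cf by (intro rad_flow_nonneg[of t]) (metis fst_conv)
    then have "run m a x w (Suc c) t (bump2 (gams m) s')"
      unfolding run_def b e using run last ct e unfolding run_def by (auto simp: less_Suc_eq le_Suc_eq simp del: bpre.simps)
    then show ?thesis using fl by blast
  next
    case 3
    then have i: "i \<noteq> lo" by (metis lo_le not_le)
    let ?B = "bump (gam m i) i"
    have "run m a x (w(c := (fst (w c), snd (w c) @ [i]))) c \<tau> (map_prod ?B ?B s')"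
    proof (rule run_update[OF run])
      show "map_prod ?B ?B s' = seg (gams m) (fst (w c), snd (w c) @ [i]) (broot (gams m) w (\<lambda>_. 1) x c) (bpre (gams m) w (\<lambda>_. 1) x c)"
        by (subst s') (simp add: seg_def prod_eq_iff ups_append, simp add: ups_def gams_def)
    qed (use vs 3 in simp)
    then show ?thesis using collision_flow_bump[OF i z, of m] \<tau> less_imp_le by blast
  qed
qed

lemma billiard_run:
  fixes m :: "'n::{finite,linorder} rvec"
  assumes m: "\<And>i. 0 < m $ i" and s: "(sec::'n) \<noteq> lo" and ab: "a < b"
    and x: "x \<in> corner a b" "fst x \<in> config" and T: "(billiard_map m ^^ Suc n) x y"
  shows "0 < gap (snd x) a \<and> 0 < gap (snd x) b \<and> fst y \<in> config \<and> (\<forall>i. gap (fst y) i = 0 \<longrightarrow> gap (snd y) i < 0) \<and>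
    (\<exists>w c \<tau> s t. run m a x w c \<tau> s \<and> \<tau> < t \<and> 0 < t \<and> y = free_flow t s)"
  using T
proof (induction n arbitrary: y)
  case 0
  then obtain x' where x': "identified m x x'" "next_collision x' y" by (auto simp: billiard_map_def)
  \<comment> \<open>Two equations hold at the start, so the motion leaves it with the given
    velocity.\<close>
  have "\<not> (\<exists>i. {j. gap (fst x) j = 0} = {i})"
  proof
    assume "\<exists>i. {j. gap (fst x) j = 0} = {i}"
    moreover have "a \<in> {j. gap (fst x) j = 0}" "b \<in> {j. gap (fst x) j = 0}" using x by (simp_all add: corner_def)
    ultimately have "a = b" by (metis singletonD)
    then show False using ab by simp
  qed
  then have "x' = x" using x'(1) unfolding identified_def by blast
  then have nc: "next_collision x y" using x'(2) by simp
  have pos: "0 < gap (snd x) a" "0 < gap (snd x) b"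
    using x next_collision_outgoing[OF nc] by (auto simp: corner_def)
  obtain t where t: "t > 0" "y = free_flow t x" "fst y \<in> config_boundary" using nc unfolding next_collision_def by blast
  have "run m a x (\<lambda>_. (0, [])) 0 0 x" using x pos by (intro run_init) (auto simp: corner_def)
  then show ?case using t pos arrival_velocity[OF nc] unfolding config_boundary_def by blast
next
  case (Suc n)
  then obtain z where z: "(billiard_map m ^^ Suc n) x z" "billiard_map m z y" by auto
  note IH = Suc.IH[OF z(1)]
  then obtain w c \<tau> s1 t where r: "run m a x w c \<tau> s1" "\<tau> < t" "0 < t" "z = free_flow t s1" by blast
  obtain z' where z': "identified m z z'" "next_collision z' y" "z \<in> (\<Union>i. face m i)"
    using z(2) by (auto simp: billiard_map_def)
  obtain i0 where "gap (fst z) i0 = 0" using z'(3) by (auto simp: face_def)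
  \<comment> \<open>On arrival the closed gaps shrink strictly, whereas continuing requires them to
    open; so the velocity must have been exchanged, which happens only at a simple
    collision.\<close>
  then have "z' \<noteq> z" using IH next_collision_outgoing[OF z'(2), of i0] by force
  then obtain i where i: "gap (fst z) i = 0" "z' = (fst z, collision m i (snd z))"
    using z'(1) unfolding identified_def by blast
  have "gap (snd z) i < 0" "fst z \<in> config" using IH i(1) by blast+
  with i(1) have "\<exists>w c \<tau> s. run m a x w c \<tau> s \<and> \<tau> \<le> t \<and> z' = free_flow t s"
    unfolding i(2) r(4) by (intro run_step[OF m s r(1,2)])
  then obtain w' c' \<tau>' s2 where r': "run m a x w' c' \<tau>' s2" "\<tau>' \<le> t" "z' = free_flow t s2" by blast
  obtain h where h: "h > 0" "y = free_flow h z'" "fst y \<in> config_boundary" using z'(2) unfolding next_collision_def by blast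
  have "y = free_flow (t + h) s2" using h(2) r'(3) by (simp add: free_flow_add)
  moreover have "\<tau>' < t + h" "0 < t + h" using h(1) r'(2) r(3) by simp_all
  ultimately show ?case using r'(1) IH arrival_velocity[OF z'(2)] h(3) unfolding config_boundary_def by blast
qed

section \<open>Nondegeneracy of the order of an actual orbit\<close>

lemma ups_surj:
  fixes m :: "'n::{finite,linorder} rvec"
  assumes m: "\<And>i. 0 < m $ i" and vs: "\<forall>i\<in>set vs. sec < i"
  shows "surj (ups (gams m) vs)"
  using ups_inj[OF m vs] by (intro linear_inj_imp_surj[OF linear_ups]) (simp add: linear_inj_iff_eq_0[OF linear_ups])

text \<open>Two independent functionals that vanish on a corner of codimension two span the same
  plane as its two gaps, so both gaps vanish at their common zeros.\<close>

lemma corner_functionals: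
  fixes \<phi> \<psi> :: "'n::{finite,linorder} rvec \<Rightarrow> real"
  assumes l: "linear \<phi>" "linear \<psi>" and ab: "a < b"
    and z: "\<And>q. gap q a = 0 \<Longrightarrow> gap q b = 0 \<Longrightarrow> \<phi> q = 0 \<and> \<psi> q = 0"
    and ind: "\<phi> u = 1" "\<psi> u = 0" "\<phi> v = 0" "\<psi> v = 1" and y: "\<phi> y = 0" "\<psi> y = 0"
  shows "gap y a = 0"
proof -
  define f where "f = axis b (1::real)"
  define e where "e = axis a 1 - gap (axis a 1) b *\<^sub>R f"
  have f: "gap f a = 0" "gap f b = 1" using gap_axis_below[OF ab] gap_axis[of b] by (simp_all add: f_def)
  have e: "gap e a = 1" "gap e b = 0" using f gap_axis[of a] by (simp_all add: e_def gap_linear)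
  have ex: "\<phi> q = gap q a * \<phi> e + gap q b * \<phi> f" "\<psi> q = gap q a * \<psi> e + gap q b * \<psi> f" for q
    using z[of "q - gap q a *\<^sub>R e - gap q b *\<^sub>R f"] l
    by (simp_all add: gap_linear e f linear_diff linear_scale)
  have "(gap u a * gap v b - gap u b * gap v a) * (\<phi> e * \<psi> f - \<phi> f * \<psi> e) = \<phi> u * \<psi> v - \<phi> v * \<psi> u"
    unfolding ex[of u] ex[of v] by (simp add: algebra_simps)
  then have "\<phi> e * \<psi> f - \<phi> f * \<psi> e \<noteq> 0" using ind by auto
  moreover have "gap y a * (\<phi> e * \<psi> f - \<phi> f * \<psi> e) = \<phi> y * \<psi> f - \<psi> y * \<phi> f"
    unfolding ex[of y] by (simp add: algebra_simps)
  ultimately show ?thesis using y by simp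
qed

lemma gap_pair_onto:
  assumes "i < j"
  shows "\<exists>u. gap u i = s \<and> gap u j = (t::real)"
  using gap_axis_below[OF assms] gap_axis[of j] gap_axis[of i]
  by (intro exI[of _ "s *\<^sub>R axis i 1 + (t - s * gap (axis i 1) j) *\<^sub>R axis j 1"]) (simp add: gap_linear)

text \<open>\<open>fst s' + t *\<^sub>R snd s'\<close> is the position at time \<open>t\<close> up
  to the gravity term. Its pairing with an untouched vector is conserved, since words and bumps are
  isometries and kicks act along \<open>lo\<close>.\<close>

lemma run_untouched:
  fixes m :: "'n::{finite,linorder} rvec"
  assumes m: "\<And>i. 0 < m $ i" and s: "(sec::'n) \<noteq> lo" and run: "run m a x w c \<tau> s'" and h: "h $ lo = 0"
    and un: "\<And>k. k < c \<Longrightarrow> uprod (gams m) w (Suc k) h $ sec = 0"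
  shows "ip m (uprod (gams m) w (Suc c) h) (fst s' + t *\<^sub>R snd s') = ip m h (fst x + t *\<^sub>R snd x)"
proof -
  have vs: "\<forall>i\<in>set (snd (w k)). sec < i" for k using run by (simp add: run_def)
  have m2: "m $ below i + m $ i \<noteq> 0" for i using m[of i] m[of "below i"] by simp
  let ?U = "\<lambda>k. ups (gams m) (snd (w k))"
  have iso: "ip m (?U k p) (?U k q) = ip m p q" for k p q
    by (rule ups_ip[OF vs m2]) (simp add: gams_def)
  have lo: "uprod (gams m) w k h $ lo = 0" for k using uprod_lo[OF vs] h by simp
  have kick: "ip m p (fst (kick W z) + t *\<^sub>R snd (kick W z)) = ip m p (fst z + t *\<^sub>R snd z)" if "p $ lo = 0" for p W z
    using that by (simp add: kick_def ip_diff_right ip_add_right ip_scale_right ip_axis ip_commute[of m p "axis _ _"])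
  have seg: "ip m (uprod (gams m) w (Suc k) h) (fst (seg (gams m) (w k) V z) + t *\<^sub>R snd (seg (gams m) (w k) V z))
      = ip m (uprod (gams m) w k h) (fst z + t *\<^sub>R snd z)" for k V z
    using iso kick[OF lo[of k]]
    by (simp add: seg_def linear_add[OF linear_ups, symmetric] linear_scale[OF linear_ups, symmetric])
  have pre: "ip m (uprod (gams m) w k h) (fst (bpre (gams m) w (\<lambda>_. 1) x k) + t *\<^sub>R snd (bpre (gams m) w (\<lambda>_. 1) x k))
      = ip m h (fst x + t *\<^sub>R snd x)" if "k \<le> c" for k
    using that
  proof (induction k)
    case (Suc k)
    let ?b = "bst (gams m) w (\<lambda>_. 1) x k" and ?h = "uprod (gams m) w (Suc k) h"
    let ?B = "bump (gam m sec) sec"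
    have Bh: "?B ?h = ?h"
      using un[of k] lo[of "Suc k"] Suc.prems s by (auto simp: bump_def vec_eq_iff below_sec simp del: uprod.simps)
    have "ip m ?h (?B (fst ?b + t *\<^sub>R snd ?b)) = ip m ?h (fst ?b + t *\<^sub>R snd ?b)"
      using bump_ip[OF s m2, of ?h "fst ?b + t *\<^sub>R snd ?b"] by (simp only: Bh)
    then show ?case
      using Suc seg[of k] by (simp add: bpre_Suc bump2_def gams_def linear_add[OF linear_bump] linear_scale[OF linear_bump] bst_def del: uprod.simps bpre.simps)
  qed simp
  show ?thesis using run seg[of c] pre[of c] by (simp add: run_def bst_def del: uprod.simps)
qed

text \<open>The clauses on the lowest pair are recorded in \<open>run\<close> or follow from
  \<open>stage_contact\<close>. If one of the other two failed, the closed final gaps could be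
  carried back to the initial gap \<open>a\<close>, extrapolated freely to time \<open>t\<close>,
  which is open.\<close>

lemma run_nondegenerate:
  fixes m :: "'n::{finite,linorder} rvec"
  assumes m: "\<And>i. 0 < m $ i" and s: "(sec::'n) \<noteq> lo" and run: "run m a x w c \<tau> s'" and \<tau>: "\<tau> < t" and t: "0 < t"
    and ab: "a < b" and x: "x \<in> corner a b" "0 < gap (snd x) a"
    and ij: "i < j" and z: "gap (fst (free_flow t s')) i = 0" "gap (fst (free_flow t s')) j = 0"
  shows "nondegenerate m w c a b i j"
proof -
  have vs: "\<forall>i\<in>set (snd (w k)). sec < i" for k using run by (simp add: run_def)
  have nz: "m $ k \<noteq> 0" for k using m[of k] by simp
  have m2: "m $ below i + m $ i \<noteq> 0" for i using m[of i] m[of "below i"] by simp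
  have j: "j \<noteq> lo" using ij by (metis lo_le not_le)
  define E where "E = fst s' + t *\<^sub>R snd s'"
  have E: "gap E k = 0" if "k \<in> {i, j}" "k \<noteq> lo" for k
    using z that by (auto simp: E_def gap_free_flow gap_linear)
  have xa: "gap (fst x + t *\<^sub>R snd x) a \<noteq> 0" using x t by (simp add: corner_def gap_linear)
  have mid: "fst (w k) \<noteq> 0 \<or> ups (gams m) (snd (w k)) (axis sec 1) \<noteq> axis sec 1" if "k < c" "1 \<le> k \<or> a = sec" for k
    using run that unfolding run_def by blast
  have last_i: "ups (gams m) (snd (w c)) (axis sec 1) \<notin> span {axis sec 1, nv m j}" if "1 \<le> c" "i = sec" "fst (w c) = 0"
  proof
    assume u: "ups (gams m) (snd (w c)) (axis sec 1) \<in> span {axis sec 1, nv m j}"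
    have jm: "j \<noteq> sec" using ij that(2) by simp
    obtain \<alpha> \<beta> where u: "ups (gams m) (snd (w c)) (axis sec 1) = \<alpha> *\<^sub>R axis sec 1 + \<beta> *\<^sub>R nv m j"
      using u unfolding span_pair by blast
    have "mom m (ups (gams m) (snd (w c)) (axis sec 1)) = mom m (axis sec 1)"
      by (rule ups_ip[OF vs m2]) (simp add: gams_def)
    \<comment> \<open>Words conserve momentum, and the normal \<open>nv m j\<close> has
      none.\<close>
    then have "\<alpha> = 1" using nz[of sec] j by (simp add: u mom_add mom_scale mom_axis mom_nv[OF nz])
    then show False
      using that(1,2,3) E[of j] E[of i] s j u
      by (intro stage_contact[OF m s run \<tau>, where \<beta> = \<beta> and j = j]) (simp_all add: E_def)
  qed
  have last_j: "ups (gams m) (snd (w c)) (axis sec 1) \<noteq> axis sec 1" if "1 \<le> c" "j = sec" "fst (w c) = 0"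
    using that E[of j] s by (intro notI stage_contact[OF m s run \<tau>, where \<beta> = 0]) (simp_all add: E_def)
  have touch: "\<exists>h\<in>span {nv m a, nv m b}. (\<exists>k<c. uprod (gams m) w (Suc k) h $ sec \<noteq> 0) \<or>
        uprod (gams m) w (Suc c) h \<notin> span (nv m ` ({i, j} \<inter> {sec<..}))" if a: "1 \<le> c" "sec < a"
  proof (rule ccontr)
    assume n: "\<not> ?thesis"
    have "nv m a \<in> span {nv m a, nv m b}" by (simp add: span_base)
    then have un: "\<And>k. k < c \<Longrightarrow> uprod (gams m) w (Suc k) (nv m a) $ sec = 0"
      and sp: "uprod (gams m) w (Suc c) (nv m a) \<in> span (nv m ` ({i, j} \<inter> {sec<..}))"
      using n by blast+
    have "lo < a" using a(2) by (metis lo_le le_less_trans)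
    then have alo: "a \<noteq> lo" "below a \<noteq> lo" using sec_le_below[OF a(2)] s by (auto dest: order_antisym[OF _ lo_le])
    then have "nv m a $ lo = 0" by (simp add: nv_def axis_def)
    from run_untouched[OF m s run this un, of t]
    have "ip m (uprod (gams m) w (Suc c) (nv m a)) E = gap (fst x + t *\<^sub>R snd x) a"
      by (simp add: ip_nv[OF nz] E_def)
    moreover have "ip m (uprod (gams m) w (Suc c) (nv m a)) E = 0"
      using sp
    proof (induction rule: span_induct)
      case base
      show ?case by (auto simp: subspace_def ip_add ip_scale) (simp add: ip_def)
    next
      case (step v)
      then obtain k where k: "k \<in> {i, j}" "sec < k" "v = nv m k" by auto
      then have "k \<noteq> lo" by (metis lo_le not_le)
      then show ?case using E[OF k(1)] by (simp add: k(3) ip_nv[OF nz])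
    qed
    ultimately show False using xa by simp
  qed
  have zero: "\<exists>q. gap q a = 0 \<and> gap q b = 0 \<and>
      (gap (ups (gams m) (snd (w 0)) q) i \<noteq> 0 \<or> gap (ups (gams m) (snd (w 0)) q) j \<noteq> 0)"
    if c: "c = 0" and i: "sec < i \<or> i = sec \<and> fst (w 0) = 0"
  proof (rule ccontr)
    assume n: "\<not> ?thesis"
    let ?U = "ups (gams m) (snd (w 0))"
    have ilo: "i \<noteq> lo" using i s by (metis lo_le not_le)
    have lin: "linear (\<lambda>q. gap (?U q) k)" for k
      using linear_compose[OF linear_ups linear_gap] by (simp add: comp_def)
    have onto: "\<exists>u. gap (?U u) i = p \<and> gap (?U u) j = q" for p q
      using gap_pair_onto[OF ij, of p q] ups_surj[OF m vs] by (metis surjD)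
    obtain u v where uv: "gap (?U u) i = 1" "gap (?U u) j = 0" "gap (?U v) i = 0" "gap (?U v) j = 1"
      using onto by metis
    obtain W where s': "s' = map_prod ?U ?U (kick (real (fst (w 0)) * W) x)"
      using run c by (simp add: run_def bst_def seg_def)
    have kick: "gap (?U (fst (kick (real (fst (w 0)) * W) x) + t *\<^sub>R snd (kick (real (fst (w 0)) * W) x))) k
        = gap (?U (fst x + t *\<^sub>R snd x)) k" if "sec < k \<or> k = sec \<and> fst (w 0) = 0" for k
    proof (cases "sec < k")
      case True
      then have "k \<noteq> lo" "below k \<noteq> lo" using sec_le_below[OF True] s by (metis lo_le not_le order_antisym)+
      then have "gap (axis lo d) k = 0" for d by (simp add: gap_eq axis_def)
      then show ?thesis
        by (simp add: kick_def linear_add[OF linear_ups] linear_diff[OF linear_ups] linear_scale[OF linear_ups]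
            ups_axis_lo[OF vs] gap_linear)
    next
      case False
      then show ?thesis using that by (simp add: kick_zero)
    qed
    have "gap (?U (fst x + t *\<^sub>R snd x)) k = gap E k" if "k \<in> {i, j}" for k
      unfolding E_def s' using kick[of k] i ij that
      by (simp only: linear_add[OF linear_ups] linear_scale[OF linear_ups] fst_map_prod snd_map_prod) (auto dest: less_trans)
    then have "gap (?U (fst x + t *\<^sub>R snd x)) i = 0" "gap (?U (fst x + t *\<^sub>R snd x)) j = 0"
      using E ilo j by simp_all
    then have "gap (fst x + t *\<^sub>R snd x) a = 0"
      using n by (intro corner_functionals[OF lin lin ab _ uv]) blast+
    then show False using xa by simp
  qed
  show ?thesis
    unfolding nondegenerate_def
  proof (intro conjI allI impI; (elim conjE)?)
    show "fst (w k) \<noteq> 0 \<or> ups (gams m) (snd (w k)) (axis sec 1) \<noteq> axis sec 1" if "1 \<le> k" "k < c" for k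
      using mid that by simp
    show "fst (w 0) \<noteq> 0 \<or> ups (gams m) (snd (w 0)) (axis sec 1) \<noteq> axis sec 1" if "1 \<le> c" "a = sec"
      using mid[of 0] that by simp
  qed (fact last_i last_j touch zero)+
qed

lemma run_tower:
  fixes m :: "'n::{finite,linorder} rvec"
  assumes s: "(sec::'n) \<noteq> lo" and run: "run m a x w c \<tau> s'"
    and ab: "a < b" and x: "x \<in> corner a b" "0 < gap (snd x) a" "fst x \<in> config"
    and ij: "i < j" and y: "y = free_flow t s'" "fst y \<in> config" "\<forall>i. gap (fst y) i = 0 \<longrightarrow> gap (snd y) i < 0"
      "gap (fst y) i = 0" "gap (fst y) j = 0"
  shows "\<exists>V. tower (a = lo) (gams m) w V x (Suc c) \<and> fin i j (V c) (st (gams m) w V x c) = 0"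
proof (intro exI conjI)
  let ?V = "broot (gams m) w (\<lambda>_. 1) x"
  have vs: "\<forall>i\<in>set (snd (w k)). sec < i" for k using run by (simp add: run_def)
  have st: "st (gams m) w ?V x c = s'" using run by (simp add: st_broot run_def)
  have rp: "0 \<le> rad (bpre (gams m) w (\<lambda>_. 1) x k)" if "k \<le> c" for k using run that by (simp add: run_def)
  show "tower (a = lo) (gams m) w ?V x (Suc c)"
    unfolding tower_def pre_broot
  proof (intro conjI allI impI)
    show "(?V k)\<^sup>2 = rad (bpre (gams m) w (\<lambda>_. 1) x k)" if "k < Suc c" for k
      using rp that by (simp add: broot_def)
    show "?V 0 = snd x $ lo" if "a = lo"
      using x that by (simp add: broot_def rad_def corner_def gap_eq)
  qed
  have j: "j \<noteq> lo" using ij by (metis lo_le not_le)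
  have zj: "gap (fst s') j = - (t * gap (snd s') j)" using y(1,5) j by (simp add: gap_free_flow)
  show "fin i j (?V c) (st (gams m) w ?V x c) = 0"
  proof (cases "i = lo")
    case True
    have "sqrt (rad s') = t - snd s' $ lo"
      by (rule flow_root) (use y(1,3,4) True in force)+
    moreover have "rad s' = rad (bpre (gams m) w (\<lambda>_. 1) x c)"
      using run rad_seg[OF vs] by (simp add: run_def bst_def)
    ultimately have "?V c = t - snd s' $ lo" by (simp add: broot_def)
    then show ?thesis unfolding st using True zj by (simp add: fin_def)
  next
    case False
    then have "gap (fst s') i = - (t * gap (snd s') i)" using y(1,4) by (simp add: gap_free_flow)
    then show ?thesis unfolding st using False zj by (simp add: fin_def)
  qed
qed

section \<open>Null sets of Hausdorff measures\<close>

lemma hausdorff_null_iff: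
  "hausdorff_measure d A = 0 \<longleftrightarrow> (\<forall>\<delta>>0. \<forall>e>0. \<exists>C. A \<subseteq> (\<Union>k::nat. C k) \<and>
     (\<forall>k. bounded (C k) \<and> diameter (C k) \<le> \<delta>) \<and> (\<Sum>k. ennreal (diameter (C k) ^ d)) < e)"
proof -
  have inf: "(INF x\<in>S. f x) = 0 \<longleftrightarrow> (\<forall>e>0. \<exists>x\<in>S. f x < e)" for S :: "(nat \<Rightarrow> 'a set) set" and f :: "_ \<Rightarrow> ennreal"
    unfolding INF_less_iff[symmetric] by (metis not_less_iff_gr_or_eq not_less_zero)
  have "hausdorff_measure d A = 0 \<longleftrightarrow> (\<forall>\<delta>\<in>{0<..}. (INF C\<in>{C :: nat \<Rightarrow> 'a set. A \<subseteq> (\<Union>k. C k) \<and>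
      (\<forall>k. bounded (C k) \<and> diameter (C k) \<le> \<delta>)}. \<Sum>k. ennreal (diameter (C k) ^ d)) = 0)"
    unfolding hausdorff_measure_def bot_ennreal[symmetric] SUP_bot_conv ..
  then show ?thesis unfolding inf by (simp add: Ball_def Bex_def conj_assoc)
qed

lemma hausdorff_null_subset:
  assumes "hausdorff_measure d B = 0" "A \<subseteq> B" shows "hausdorff_measure d A = 0"
  using assms unfolding hausdorff_null_iff by (meson order_trans)

lemma ennreal_small:
  assumes e: "0 < (e :: ennreal)" and K: "0 < K"
  obtains r where "0 < r" "ennreal K * ennreal r < e"
proof (cases e)
  case (real s)
  then have "ennreal (s / 2) < e" "0 < s / 2" using e by (auto simp: ennreal_less_iff)
  moreover have "ennreal K * ennreal (s / 2 / K) = ennreal (s / 2)"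
    using K real by (simp add: ennreal_mult[symmetric])
  ultimately show ?thesis using K by (intro that[of "s / 2 / K"]) auto
next
  case top
  then show ?thesis using that[of 1] by (simp add: ennreal_mult_less_top)
qed

lemma hausdorff_null_UN:
  assumes "\<And>n :: nat. hausdorff_measure d (A n) = 0"
  shows "hausdorff_measure d (\<Union>n. A n) = 0"
  unfolding hausdorff_null_iff
proof (intro allI impI)
  fix \<delta> :: real and e :: ennreal
  assume d: "0 < \<delta>" and e: "0 < e"
  obtain e' :: "nat \<Rightarrow> ennreal" where e': "\<And>n. 0 < e' n" "(\<Sum>n. e' n) < e"
  proof -
    obtain r where r: "0 < r" "ennreal r < e" using ennreal_small[OF e zero_less_one] by auto
    have "(\<lambda>n. r * (1/2) ^ Suc n) sums (r * 1)"
      by (intro sums_mult power_half_series)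
    then have "(\<Sum>n. ennreal (r * (1/2) ^ Suc n)) = ennreal r"
      using r(1) by (subst suminf_ennreal_eq[of _ r]) simp_all
    then show ?thesis using r by (intro that[of "\<lambda>n. ennreal (r * (1/2) ^ Suc n)"]) auto
  qed
  have "\<forall>n. \<exists>C. A n \<subseteq> (\<Union>k::nat. C k) \<and> (\<forall>k. bounded (C k) \<and> diameter (C k) \<le> \<delta>) \<and>
      (\<Sum>k. ennreal (diameter (C k) ^ d)) < e' n"
    using assms d e'(1) unfolding hausdorff_null_iff by blast
  then obtain C where C: "\<And>n. A n \<subseteq> (\<Union>k::nat. C n k)" "\<And>n k. bounded (C n k) \<and> diameter (C n k) \<le> \<delta>"
    "\<And>n. (\<Sum>k. ennreal (diameter (C n k) ^ d)) < e' n" by metis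
  define D where "D = (\<lambda>i. case prod_decode i of (n, k) \<Rightarrow> C n k)"
  have "(\<Sum>i. ennreal (diameter (D i) ^ d)) = (\<Sum>i. (\<lambda>(n, k). ennreal (diameter (C n k) ^ d)) (prod_decode i))"
    by (simp add: D_def split_beta)
  also have "\<dots> = (\<Sum>n. \<Sum>k. ennreal (diameter (C n k) ^ d))"
    by (rule suminf_ennreal_2dimen) simp
  also have "\<dots> \<le> (\<Sum>n. e' n)" using C(3) by (intro suminf_le) (auto intro: less_imp_le)
  also have "\<dots> < e" by (rule e'(2))
  finally have "(\<Sum>i. ennreal (diameter (D i) ^ d)) < e" .
  moreover have "(\<Union>n. A n) \<subseteq> (\<Union>i. D i)"
  proof
    fix x assume "x \<in> (\<Union>n. A n)"
    then obtain n k where "x \<in> C n k" using C(1) by blast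
    then have "x \<in> D (prod_encode (n, k))" by (simp add: D_def)
    then show "x \<in> (\<Union>i. D i)" by blast
  qed
  moreover have "bounded (D i) \<and> diameter (D i) \<le> \<delta>" for i using C(2) by (simp add: D_def split_beta)
  ultimately show "\<exists>C. (\<Union>n. A n) \<subseteq> (\<Union>k. C k) \<and> (\<forall>k. bounded (C k) \<and> diameter (C k) \<le> \<delta>) \<and>
      (\<Sum>k. ennreal (diameter (C k) ^ d)) < e" by blast
qed

lemma hausdorff_null_countable_UN:
  fixes A :: "'i \<Rightarrow> 'a::metric_space set"
  assumes "countable I" "0 < d" "\<And>i. i \<in> I \<Longrightarrow> hausdorff_measure d (A i) = 0"
  shows "hausdorff_measure d (\<Union>i\<in>I. A i) = 0"
proof (cases "I = {}")
  case True
  have "hausdorff_measure d ({} :: 'a set) = 0"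
    unfolding hausdorff_null_iff using assms(2) by (auto simp: zero_power intro!: exI[of _ "\<lambda>_. {}"])
  then show ?thesis using True by simp
next
  case False
  then have "(\<Union>i\<in>I. A i) = (\<Union>n. A (from_nat_into I n))"
    using range_from_nat_into[OF False assms(1)] by (metis image_image)
  moreover have "hausdorff_measure d (\<Union>n. A (from_nat_into I n)) = 0"
    by (rule hausdorff_null_UN) (rule assms(3)[OF from_nat_into[OF False]])
  ultimately show ?thesis by simp
qed

lemma diameter_image_le:
  assumes S: "bounded S" and L: "0 \<le> L" "\<And>x y. x \<in> S \<Longrightarrow> y \<in> S \<Longrightarrow> dist (f x) (f y) \<le> L * dist x y"
  shows "bounded (f ` S)" "diameter (f ` S) \<le> L * diameter S"
proof -
  have le: "dist (f x) (f y) \<le> L * diameter S" if "x \<in> S" "y \<in> S" for x y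
    using L(2)[OF that] mult_left_mono[OF diameter_bounded_bound[OF S that] L(1)] by linarith
  show "bounded (f ` S)"
    unfolding bounded_two_points using le by (intro exI[of _ "L * diameter S"]) auto
  show "diameter (f ` S) \<le> L * diameter S"
  proof (cases "S = {}")
    case False
    then have "(SUP (x, y)\<in>f ` S \<times> f ` S. dist x y) \<le> L * diameter S"
      using le by (intro cSUP_least) auto
    then show ?thesis using False by (simp add: diameter_def[of "f ` S"])
  qed simp
qed

text \<open>An open set of small measure around \<open>A\<close> contains a cover of
  \<open>A\<close> by nonoverlapping cubes, and for a cube the power of the diameter is at most a
  fixed multiple of the volume.\<close>

lemma negligible_hausdorff_null:
  fixes A :: "'a::euclidean_space set"
  assumes neg: "negligible A" and bd: "bounded A"
  shows "hausdorff_measure DIM('a) A = 0"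
  unfolding hausdorff_null_iff
proof (intro allI impI)
  fix \<delta> :: real and e :: ennreal
  assume d: "0 < \<delta>" and e: "0 < e"
  let ?D = "real DIM('a)"
  obtain e' where e': "0 < e'" "ennreal (?D ^ DIM('a)) * ennreal e' < e"
    by (rule ennreal_small[OF e, of "?D ^ DIM('a)"]) simp
  obtain T where T: "open T" "A \<subseteq> T" "emeasure lebesgue (T - A) < ennreal e'"
    by (rule sets_lebesgue_outer_open[OF negligible_imp_sets[OF neg] e'(1)])
  have "emeasure lebesgue A = 0"
    using neg by (simp add: negligible_iff_null_sets null_setsD1)
  then have "emeasure lebesgue T \<le> emeasure lebesgue (T - A)"
    using emeasure_subadditive[of "T - A" lebesgue A] T(1,2) negligible_imp_sets[OF neg]
    by (simp add: Un_absorb2 sets_completionI_sets sets.Diff del: emeasure_completion)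
  then have mT: "emeasure lborel T < ennreal e'" using T by simp
  obtain B where B: "0 < B" "\<And>x. x \<in> A \<Longrightarrow> norm x \<le> B" using bd by (meson bounded_pos)
  have sub: "A \<subseteq> cbox (- (B *\<^sub>R One)) (B *\<^sub>R One)"
  proof
    fix x assume "x \<in> A"
    then have "\<bar>x \<bullet> i\<bar> \<le> B" if "i \<in> Basis" for i
      using B(2) Basis_le_norm[OF that, of x] by force
    then show "x \<in> cbox (- (B *\<^sub>R One)) (B *\<^sub>R One)" by (auto simp: mem_box abs_le_iff minus_le_iff)
  qed
  have ne: "box (- (B *\<^sub>R One)) (B *\<^sub>R One :: 'a) \<noteq> {}" using B(1) by (simp add: box_ne_empty)
  \<comment> \<open>The gauge keeps each cube inside \<open>T\<close> and inside a ball of diameter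
    \<open>\<delta>\<close>.\<close>
  define g where "g = (\<lambda>x. (if x \<in> T then T else UNIV) \<inter> ball x (\<delta> / 2))"
  have "gauge g" using T(1) d by (auto simp: gauge_def g_def)
  from covering_lemma[OF sub ne this]
  obtain \<D> where D: "countable \<D>"
      "\<And>K. K \<in> \<D> \<Longrightarrow> interior K \<noteq> {} \<and> (\<exists>c d. K = cbox c d)"
      "pairwise (\<lambda>A B. interior A \<inter> interior B = {}) \<D>"
      "\<And>K. K \<in> \<D> \<Longrightarrow> \<exists>x\<in>A \<inter> K. K \<subseteq> g x"
      "\<And>u v. cbox u v \<in> \<D> \<Longrightarrow> \<exists>n. \<forall>i\<in>Basis. v \<bullet> i - u \<bullet> i = (B *\<^sub>R One \<bullet> i - - (B *\<^sub>R One) \<bullet> i) / 2 ^ n"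
      "A \<subseteq> \<Union> \<D>"
    by metis
  have K: "K \<subseteq> T \<and> bounded K \<and> diameter K \<le> \<delta> \<and>
      ennreal (diameter K ^ DIM('a)) \<le> ennreal (?D ^ DIM('a)) * emeasure lborel (interior K)" if KD: "K \<in> \<D>" for K
  proof -
    obtain u v where uv: "K = cbox u v" "box u v \<noteq> {}" using D(2)[OF KD] interior_cbox by metis
    obtain x where x: "x \<in> A" "K \<subseteq> g x" using D(4)[OF KD] by blast
    then have KT: "K \<subseteq> T" "K \<subseteq> ball x (\<delta> / 2)" using subsetD[OF T(2) x(1)] by (simp_all add: g_def)
    have bK: "bounded K" using uv by simp
    have "diameter K \<le> diameter (ball x (\<delta> / 2))" by (rule diameter_subset[OF KT(2)]) simp
    then have dK: "diameter K \<le> \<delta>" using d by (simp add: diameter_ball)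
    obtain l where l: "\<And>i. i \<in> Basis \<Longrightarrow> v \<bullet> i - u \<bullet> i = l" using D(5) KD uv(1) B(1) by (force simp: inner_minus_left)
    obtain i0 :: 'a where "i0 \<in> Basis" using nonempty_Basis by blast
    then have l0: "0 < l" using l uv(2) by (force simp: box_ne_empty)
    have le: "\<And>i. i \<in> Basis \<Longrightarrow> u \<bullet> i \<le> v \<bullet> i" using l l0 by force
    have "norm (x - y) \<le> ?D * l" if "x \<in> K" "y \<in> K" for x y
    proof -
      have "norm (x - y) \<le> (\<Sum>i\<in>Basis. \<bar>(x - y) \<bullet> i\<bar>)" by (rule norm_le_l1)
      also have "\<dots> \<le> (\<Sum>i\<in>(Basis :: 'a set). l)"
      proof (rule sum_mono)
        fix i :: 'a assume i: "i \<in> Basis"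
        then have "u \<bullet> i \<le> x \<bullet> i" "x \<bullet> i \<le> v \<bullet> i" "u \<bullet> i \<le> y \<bullet> i" "y \<bullet> i \<le> v \<bullet> i"
          using that uv(1) by (auto simp: mem_box)
        then show "\<bar>(x - y) \<bullet> i\<bar> \<le> l" using l[OF i] by (simp add: inner_diff_left)
      qed
      finally show ?thesis by simp
    qed
    then have "diameter K \<le> ?D * l" using l0 by (intro diameter_le) auto
    then have "diameter K ^ DIM('a) \<le> (?D * l) ^ DIM('a)"
      using diameter_ge_0[OF bK] by (intro power_mono)
    moreover have "emeasure lborel (interior K) = ennreal (l ^ DIM('a))"
      unfolding uv(1) interior_cbox by (subst emeasure_lborel_box) (simp_all add: le l inner_diff_left)
    ultimately have "ennreal (diameter K ^ DIM('a)) \<le> ennreal (?D ^ DIM('a)) * emeasure lborel (interior K)"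
      using l0 by (simp add: ennreal_mult[symmetric] power_mult_distrib[symmetric])
    then show ?thesis using KT bK dK by blast
  qed
  define C where "C = (\<lambda>k. if k \<in> to_nat_on \<D> ` \<D> then from_nat_into \<D> k else {})"
  have Ck: "C k \<in> \<D> \<or> C k = {}" for k
    by (auto simp: C_def D(1))
  have Cle: "ennreal (diameter (C k) ^ DIM('a)) \<le> ennreal (?D ^ DIM('a)) * emeasure lborel (interior (C k))" for k
    using Ck[of k] K[of "C k"] by auto
  have disj: "disjoint_family (\<lambda>k. interior (C k))"
    unfolding disjoint_family_on_def
  proof (intro ballI impI)
    fix p q :: nat assume pq: "p \<noteq> q"
    show "interior (C p) \<inter> interior (C q) = {}"
    proof (cases "p \<in> to_nat_on \<D> ` \<D> \<and> q \<in> to_nat_on \<D> ` \<D>")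
      case True
      then have "C p \<noteq> C q" using pq from_nat_into_inj[OF D(1)] by (simp add: C_def)
      moreover have "C p \<in> \<D>" "C q \<in> \<D>" using True by (auto simp: C_def D(1))
      ultimately show ?thesis using D(3) by (simp add: pairwise_def)
    qed (auto simp: C_def)
  qed
  have "(\<Sum>k. ennreal (diameter (C k) ^ DIM('a))) \<le> (\<Sum>k. ennreal (?D ^ DIM('a)) * emeasure lborel (interior (C k)))"
    by (intro suminf_le Cle) auto
  also have "\<dots> = ennreal (?D ^ DIM('a)) * emeasure lborel (\<Union>k. interior (C k))"
    using disj by (simp add: ennreal_suminf_cmult suminf_emeasure image_subset_iff)
  also have "\<dots> \<le> ennreal (?D ^ DIM('a)) * emeasure lborel T"
  proof (intro mult_left_mono emeasure_mono)
    have "C k \<subseteq> T" for k using Ck[of k] K by auto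
    then show "(\<Union>k. interior (C k)) \<subseteq> T" using interior_subset by blast
  qed (use T(1) in auto)
  also have "\<dots> \<le> ennreal (?D ^ DIM('a)) * ennreal e'" using mT by (intro mult_left_mono less_imp_le) auto
  also have "\<dots> < e" by (rule e'(2))
  finally have "(\<Sum>k. ennreal (diameter (C k) ^ DIM('a))) < e" .
  moreover have "A \<subseteq> (\<Union>k. C k)"
  proof
    fix x assume "x \<in> A"
    then obtain K where "K \<in> \<D>" "x \<in> K" using D(6) by blast
    then have "x \<in> C (to_nat_on \<D> K)" using D(1) by (simp add: C_def)
    then show "x \<in> (\<Union>k. C k)" by blast
  qed
  moreover have "bounded (C k) \<and> diameter (C k) \<le> \<delta>" for k using Ck[of k] K[of "C k"] d by auto
  ultimately show "\<exists>C. A \<subseteq> (\<Union>k. C k) \<and> (\<forall>k. bounded (C k) \<and> diameter (C k) \<le> \<delta>) \<and>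
      (\<Sum>k. ennreal (diameter (C k) ^ DIM('a))) < e" by blast
qed

text \<open>From a cover of \<open>Y\<close> each slice \<open>\<sigma> = s\<close> yields a cover
  of \<open>Z\<close>. Averaged over \<open>s\<close> in the unit cube, the sums of these covers are
  bounded by a constant times the sum for \<open>Y\<close>, so some slice has a small sum.\<close>

lemma hausdorff_null_slice:
  fixes \<rho> :: "'a::metric_space \<Rightarrow> 'b::metric_space" and \<sigma> :: "'a \<Rightarrow> 'c::euclidean_space"
  assumes Y: "hausdorff_measure (d + DIM('c)) Y = 0" and d: "0 < d"
    and L: "0 < L" "\<And>y y'. y \<in> Y \<Longrightarrow> y' \<in> Y \<Longrightarrow> dist (\<rho> y) (\<rho> y') \<le> L * dist y y'"
      "\<And>y y'. y \<in> Y \<Longrightarrow> y' \<in> Y \<Longrightarrow> dist (\<sigma> y) (\<sigma> y') \<le> L * dist y y'"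
    and cov: "\<And>z s. z \<in> Z \<Longrightarrow> s \<in> cbox 0 One \<Longrightarrow> \<exists>y\<in>Y. \<rho> y = z \<and> \<sigma> y = s"
  shows "hausdorff_measure d Z = 0"
  unfolding hausdorff_null_iff
proof (intro allI impI)
  fix \<delta> :: real and e :: ennreal
  assume \<delta>: "0 < \<delta>" and e: "0 < e"
  define K where "K = 2 ^ DIM('c) * L ^ (d + DIM('c))"
  have K: "0 < K" using L(1) by (simp add: K_def)
  obtain e' where e': "0 < e'" "ennreal K * ennreal e' < e" by (rule ennreal_small[OF e K])
  have "\<exists>C. Y \<subseteq> (\<Union>k::nat. C k) \<and> (\<forall>k. bounded (C k) \<and> diameter (C k) \<le> \<delta> / L) \<and>
      (\<Sum>k. ennreal (diameter (C k) ^ (d + DIM('c)))) < ennreal e'"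
    using Y \<delta> L(1) e'(1) unfolding hausdorff_null_iff by simp
  then obtain C where C: "Y \<subseteq> (\<Union>k::nat. C k)" "\<And>k. bounded (C k) \<and> diameter (C k) \<le> \<delta> / L"
    "(\<Sum>k. ennreal (diameter (C k) ^ (d + DIM('c)))) < ennreal e'"
    by blast
  define S where "S = (\<lambda>k. C k \<inter> Y)"
  define r where "r = (\<lambda>k. L * diameter (S k))"
  have bS: "bounded (S k)" for k using C(2)[of k] by (auto simp: S_def intro: bounded_subset)
  have dS: "diameter (S k) \<le> diameter (C k)" for k
    using C(2)[of k] by (intro diameter_subset) (auto simp: S_def)
  have r0: "0 \<le> r k" for k using L(1) diameter_ge_0[OF bS] by (simp add: r_def)
  define p where "p = (\<lambda>k. \<sigma> (SOME y. y \<in> S k))"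
  define Q where "Q = (\<lambda>k. if S k = {} then {} else cbox (p k - r k *\<^sub>R One) (p k + r k *\<^sub>R One))"
  have Qin: "\<sigma> y \<in> Q k" if y: "y \<in> S k" for y k
  proof -
    have "(SOME y. y \<in> S k) \<in> S k" using y by (rule someI)
    then have "dist (\<sigma> y) (p k) \<le> r k"
      using diameter_bounded_bound[OF bS y, of "SOME y. y \<in> S k"] L(3)[of y "SOME y. y \<in> S k"] y L(1)
      unfolding r_def p_def S_def by (smt (verit) IntD2 mult_left_mono)
    then have "\<bar>(\<sigma> y - p k) \<bullet> i\<bar> \<le> r k" if "i \<in> Basis" for i
      using Basis_le_norm[OF that, of "\<sigma> y - p k"] by (simp add: dist_norm)
    then have "\<forall>i\<in>Basis. (p k - r k *\<^sub>R One) \<bullet> i \<le> \<sigma> y \<bullet> i \<and> \<sigma> y \<bullet> i \<le> (p k + r k *\<^sub>R One) \<bullet> i"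
      by (simp add: inner_diff_left inner_add_left abs_le_iff) (smt (verit))
    then show ?thesis using y by (auto simp: Q_def mem_box)
  qed
  have mQ: "emeasure lborel (Q k) \<le> ennreal ((2 * r k) ^ DIM('c))" for k
  proof (cases "S k = {}")
    case False
    have "emeasure lborel (cbox (p k - r k *\<^sub>R One) (p k + r k *\<^sub>R One)) = ennreal ((2 * r k) ^ DIM('c))"
      using r0[of k] by (subst emeasure_lborel_cbox) (simp_all add: inner_diff_left inner_add_left)
    then show ?thesis using False by (simp add: Q_def)
  qed (simp add: Q_def)
  have sQ: "Q k \<in> sets lborel" for k by (simp add: Q_def)
  \<comment> \<open>\<open>F s\<close> bounds the sum of the slice \<open>s\<close>: a piece
    contributes only if the box around its image under \<open>\<sigma>\<close> contains
    \<open>s\<close>.\<close>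
  define F where "F = (\<lambda>s. \<Sum>k. ennreal (r k ^ d) * indicator (Q k) s)"
  have "(\<integral>\<^sup>+s. F s \<partial>lborel) = (\<Sum>k. ennreal (r k ^ d) * emeasure lborel (Q k))"
    unfolding F_def using sQ by (subst nn_integral_suminf) (auto simp: nn_integral_cmult)
  also have "\<dots> \<le> (\<Sum>k. ennreal K * ennreal (diameter (C k) ^ (d + DIM('c))))"
  proof (rule suminf_le)
    fix k
    have "ennreal (r k ^ d) * emeasure lborel (Q k) \<le> ennreal (r k ^ d) * ennreal ((2 * r k) ^ DIM('c))"
      by (intro mult_left_mono mQ) simp
    also have "\<dots> = ennreal (K * diameter (S k) ^ (d + DIM('c)))"
      using zero_le_power[OF r0] by (subst ennreal_mult[symmetric], simp, simp add: r0)
        (simp add: r_def K_def power_mult_distrib power_add mult_ac)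
    also have "\<dots> \<le> ennreal (K * diameter (C k) ^ (d + DIM('c)))"
      using K dS diameter_ge_0[OF bS] by (intro ennreal_leI mult_left_mono power_mono) auto
    finally show "ennreal (r k ^ d) * emeasure lborel (Q k) \<le> ennreal K * ennreal (diameter (C k) ^ (d + DIM('c)))"
      using K diameter_ge_0[of "C k"] C(2)[of k] by (subst ennreal_mult[symmetric]) auto
  qed auto
  also have "\<dots> = ennreal K * (\<Sum>k. ennreal (diameter (C k) ^ (d + DIM('c))))" by (simp add: ennreal_suminf_cmult)
  also have "\<dots> \<le> ennreal K * ennreal e'" using C(3) by (intro mult_left_mono) (auto intro: less_imp_le)
  also have "\<dots> < e" by (rule e'(2))
  finally have int: "(\<integral>\<^sup>+s. F s \<partial>lborel) < e" .
  have "\<exists>s\<in>cbox 0 One. F s < e"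
  proof (rule ccontr)
    assume "\<not> ?thesis"
    then have "e * indicator (cbox 0 One) s \<le> F s" for s by (auto simp: not_less split: split_indicator)
    then have "(\<integral>\<^sup>+s. e * indicator (cbox 0 (One :: 'c)) s \<partial>lborel) \<le> (\<integral>\<^sup>+s. F s \<partial>lborel)"
      by (intro nn_integral_mono)
    then have "e \<le> (\<integral>\<^sup>+s. F s \<partial>lborel)" by (simp add: nn_integral_cmult)
    then show False using int by simp
  qed
  then obtain s where s: "s \<in> cbox 0 One" "F s < e" by blast
  define D where "D = (\<lambda>k. \<rho> ` {y \<in> S k. \<sigma> y = s})"
  have D: "bounded (D k) \<and> diameter (D k) \<le> r k" for k
  proof -
    have sub: "{y \<in> S k. \<sigma> y = s} \<subseteq> S k" by blast
    have b: "bounded {y \<in> S k. \<sigma> y = s}" by (rule bounded_subset[OF bS sub])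
    have "dist (\<rho> y) (\<rho> y') \<le> L * dist y y'" if "y \<in> {y \<in> S k. \<sigma> y = s}" "y' \<in> {y \<in> S k. \<sigma> y = s}" for y y'
      using L(2) that by (auto simp: S_def)
    note di = diameter_image_le[OF b less_imp_le[OF L(1)] this]
    have "L * diameter {y \<in> S k. \<sigma> y = s} \<le> r k"
      unfolding r_def using L(1) by (intro mult_left_mono diameter_subset[OF sub bS]) simp
    then show ?thesis using di unfolding D_def by (meson order_trans)
  qed
  have "(\<Sum>k. ennreal (diameter (D k) ^ d)) \<le> F s"
    unfolding F_def
  proof (rule suminf_le)
    fix k
    show "ennreal (diameter (D k) ^ d) \<le> ennreal (r k ^ d) * indicator (Q k) s"
    proof (cases "s \<in> Q k")
      case True
      then show ?thesis using D[of k] diameter_ge_0 by (auto intro!: ennreal_leI power_mono)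
    next
      case False
      then have "D k = {}" using Qin by (auto simp: D_def)
      then show ?thesis using d by (simp add: zero_power)
    qed
  qed auto
  then have "(\<Sum>k. ennreal (diameter (D k) ^ d)) < e" using s(2) by simp
  moreover have "Z \<subseteq> (\<Union>k. D k)"
  proof
    fix z assume "z \<in> Z"
    then obtain y where y: "y \<in> Y" "\<rho> y = z" "\<sigma> y = s" using cov s(1) by blast
    then obtain k where "y \<in> C k" using C(1) by blast
    then have "z \<in> D k" using y by (auto simp: D_def S_def)
    then show "z \<in> (\<Union>k. D k)" by blast
  qed
  moreover have "bounded (D k) \<and> diameter (D k) \<le> \<delta>" for k
  proof -
    have "r k \<le> L * (\<delta> / L)"
      unfolding r_def using L(1) dS[of k] C(2)[of k] by (intro mult_left_mono) auto
    then show ?thesis using D[of k] L(1) by simp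
  qed
  ultimately show "\<exists>C. Z \<subseteq> (\<Union>k. C k) \<and> (\<forall>k. bounded (C k) \<and> diameter (C k) \<le> \<delta>) \<and>
      (\<Sum>k. ennreal (diameter (C k) ^ d)) < e" by blast
qed

section \<open>Zero sets of polynomials\<close>

text \<open>Polynomials enter the null set argument only through continuity and their restrictions
  to lines, for masses and phase points alike.\<close>

definition linepoly :: "('a::real_normed_vector \<Rightarrow> real) \<Rightarrow> bool" where
  "linepoly f \<longleftrightarrow> continuous_on UNIV f \<and> (\<forall>u v. \<exists>p. \<forall>t. f (u + t *\<^sub>R v) = poly p t)"

lemma linepoly_const: "linepoly (\<lambda>_. c)"
  unfolding linepoly_def by (auto intro!: exI[of _ "[:c:]"])

lemma linepoly_linear:
  fixes f :: "'a::euclidean_space \<Rightarrow> real"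
  assumes "linear f" shows "linepoly f"
  unfolding linepoly_def using linear_continuous_on[OF assms[unfolded linear_conv_bounded_linear]]
  by (auto simp: linear_add[OF assms] linear_scale[OF assms] intro!: exI[of _ "[:f _, f _:]"])

lemma linepoly_add:
  assumes "linepoly f" "linepoly h" shows "linepoly (\<lambda>x. f x + h x)"
  unfolding linepoly_def
proof (intro conjI allI)
  show "continuous_on UNIV (\<lambda>x. f x + h x)" using assms unfolding linepoly_def by (auto intro: continuous_on_add)
  fix u v
  obtain p q where "\<And>t. f (u + t *\<^sub>R v) = poly p t" "\<And>t. h (u + t *\<^sub>R v) = poly q t"
    using assms unfolding linepoly_def by metis
  then show "\<exists>p. \<forall>t. f (u + t *\<^sub>R v) + h (u + t *\<^sub>R v) = poly p t" by (intro exI[of _ "p + q"]) simp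
qed

lemma linepoly_mult:
  assumes "linepoly f" "linepoly h" shows "linepoly (\<lambda>x. f x * h x)"
  unfolding linepoly_def
proof (intro conjI allI)
  show "continuous_on UNIV (\<lambda>x. f x * h x)" using assms unfolding linepoly_def by (auto intro: continuous_on_mult)
  fix u v
  obtain p q where "\<And>t. f (u + t *\<^sub>R v) = poly p t" "\<And>t. h (u + t *\<^sub>R v) = poly q t"
    using assms unfolding linepoly_def by metis
  then show "\<exists>p. \<forall>t. f (u + t *\<^sub>R v) * h (u + t *\<^sub>R v) = poly p t" by (intro exI[of _ "p * q"]) simp
qed

lemma linepoly_compose:
  fixes h :: "'a::euclidean_space \<Rightarrow> 'b::real_normed_vector"
  assumes f: "linepoly f" and h: "linear h"
  shows "linepoly (\<lambda>x. f (h x))"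
  unfolding linepoly_def
proof (intro conjI allI)
  show "continuous_on UNIV (\<lambda>x. f (h x))"
    using f linear_continuous_on[OF h[unfolded linear_conv_bounded_linear], of UNIV]
    unfolding linepoly_def by (auto intro: continuous_on_compose2)
  show "\<exists>p. \<forall>t. f (h (u + t *\<^sub>R v)) = poly p t" for u v
    using f unfolding linepoly_def by (simp add: linear_add[OF h] linear_scale[OF h])
qed

lemma linepoly_prod: "finite I \<Longrightarrow> (\<And>i. i \<in> I \<Longrightarrow> linepoly (f i)) \<Longrightarrow> linepoly (\<lambda>x. \<Prod>i\<in>I. f i x)"
  by (induction I rule: finite_induct) (simp_all add: linepoly_const linepoly_mult)

lemma linepoly_power: "linepoly f \<Longrightarrow> linepoly (\<lambda>x. f x ^ k)"
  by (induction k) (simp_all add: linepoly_const linepoly_mult)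

text \<open>On each ray from \<open>z\<close> there are finitely many zeros, so by Fubini almost every homothety with centre
  \<open>z\<close> maps almost no point into the zero set.\<close>

lemma negligible_linepoly:
  fixes f :: "'a::euclidean_space \<Rightarrow> real"
  assumes f: "linepoly f" and z: "f z \<noteq> 0"
  shows "negligible {x. f x = 0}"
proof -
  have cf: "continuous_on UNIV f" using f by (simp add: linepoly_def)
  have "open {y :: real \<times> 'a. f (z + fst y *\<^sub>R snd y) \<noteq> 0}"
    by (intro open_Collect_neq continuous_on_compose2[OF cf] continuous_intros) auto
  then have meas: "{y \<in> space (lborel \<Otimes>\<^sub>M lborel). f (z + fst y *\<^sub>R snd (y :: real \<times> 'a)) \<noteq> 0} \<in> sets (lborel \<Otimes>\<^sub>M lborel)"
    by (simp only: lborel_prod space_lborel sets_lborel) (simp add: borel_open)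
  have "AE t in lborel. f (z + t *\<^sub>R x) \<noteq> 0" for x
  proof -
    obtain p where p: "\<And>t. f (z + t *\<^sub>R x) = poly p t" using f unfolding linepoly_def by metis
    have "poly p 0 \<noteq> 0" using p[of 0] z by simp
    then have "finite {t. poly p t = 0}" by (intro poly_roots_finite) auto
    then show ?thesis using finite_imp_null_set_lborel by (intro AE_I'[of "{t. poly p t = 0}"]) (auto simp: p)
  qed
  then have "AE t in lborel. AE x in (lborel :: 'a measure). f (z + t *\<^sub>R x) \<noteq> 0"
    unfolding lborel_pair.AE_commute[OF meas] by simp
  moreover have "AE t in lborel. t \<noteq> (0::real)" by (rule AE_lborel_singleton)
  ultimately have "AE t in lborel. t \<noteq> 0 \<and> (AE x in (lborel :: 'a measure). f (z + t *\<^sub>R x) \<noteq> 0)" by eventually_elim simp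
  then have "\<exists>t. t \<noteq> 0 \<and> (AE x in (lborel :: 'a measure). f (z + t *\<^sub>R x) \<noteq> 0)"
    by (rule eventually_happens'[rotated]) (simp add: ae_filter_eq_bot_iff)
  then obtain t where t: "t \<noteq> 0" and ae: "AE x in (lborel :: 'a measure). f (z + t *\<^sub>R x) \<noteq> 0" by blast
  have "closed {x. f (z + t *\<^sub>R x) = 0}"
    by (intro closed_Collect_eq continuous_on_compose2[OF cf] continuous_intros) auto
  then have "{x. f (z + t *\<^sub>R x) = 0} \<in> null_sets lborel"
    using ae by (subst (asm) AE_iff_null) auto
  then have n: "negligible {x. f (z + t *\<^sub>R x) = 0}"
    by (simp add: negligible_iff_null_sets null_sets_completionI)
  have "negligible ((\<lambda>x. z + t *\<^sub>R x) ` {x. f (z + t *\<^sub>R x) = 0})"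
    by (rule negligible_differentiable_image_negligible[OF order_refl n]) (auto intro!: derivative_intros simp: differentiable_on_def)
  moreover have "{x. f x = 0} \<subseteq> (\<lambda>x. z + t *\<^sub>R x) ` {x. f (z + t *\<^sub>R x) = 0}"
  proof
    fix x assume "x \<in> {x. f x = 0}"
    moreover have "x = z + t *\<^sub>R ((x - z) /\<^sub>R t)" using t by simp
    ultimately show "x \<in> (\<lambda>x. z + t *\<^sub>R x) ` {x. f (z + t *\<^sub>R x) = 0}" by (intro image_eqI[of _ _ "(x - z) /\<^sub>R t"]) simp_all
  qed
  ultimately show ?thesis by (rule negligible_subset)
qed

lemma linepoly_pol: "P \<in> pol 0 \<Longrightarrow> linepoly (\<lambda>x :: 'n::{finite,linorder} phase. P g x (\<lambda>_. 0))"
proof (induction rule: pol.induct)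
  case (pos i)
  show ?case by (rule linepoly_linear) (rule linearI; simp)
next
  case (vel i)
  show ?case by (rule linepoly_linear) (rule linearI; simp)
qed (simp_all add: linepoly_const linepoly_add linepoly_mult)

text \<open>The coefficient of the floor plays no role; \<open>\<kappa>\<close> is its arbitrary value.\<close>

definition gfix :: "real \<Rightarrow> 'n::{finite,linorder} rvec \<Rightarrow> 'n rvec" where
  "gfix \<kappa> m = (\<chi> i. if i = lo then \<kappa> else gam m i)"

definition msums :: "'n::{finite,linorder} rvec \<Rightarrow> real" where
  "msums m = (\<Prod>i\<in>UNIV - {lo}. m $ below i + m $ i)"

lemma linepoly_nth: "linepoly (\<lambda>m :: 'n::finite rvec. m $ i)"
  by (rule linepoly_linear) (rule linearI; simp)

lemma linepoly_msums: "linepoly msums"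
  unfolding msums_def by (intro linepoly_prod linepoly_add linepoly_nth) simp

text \<open>At a fixed phase point a polynomial in the collision coefficients is a rational function
  of the masses whose denominator divides a power of \<open>msums\<close>.\<close>

lemma linepoly_clear_denominators:
  "P \<in> pol 0 \<Longrightarrow> \<exists>k h. linepoly h \<and>
    (\<forall>m :: 'n::{finite,linorder} rvec. msums m \<noteq> 0 \<longrightarrow> h m = P (gfix \<kappa> m) x (\<lambda>_. 0) * msums m ^ k)"
proof (induction rule: pol.induct)
  case (const c)
  show ?case by (rule exI[of _ 0], rule exI[of _ "\<lambda>_. c"]) (simp add: linepoly_const)
next
  case (coef i)
  show ?case
  proof (cases "i = lo")
    case True
    then show ?thesis by (intro exI[of _ 0] exI[of _ "\<lambda>_. \<kappa>"]) (simp add: linepoly_const gfix_def)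
  next
    case False
    let ?h = "\<lambda>m :: 'n rvec. (m $ below i + (- 1) * m $ i) * (\<Prod>j\<in>UNIV - {lo} - {i}. m $ below j + m $ j)"
    have "linepoly ?h"
      by (intro linepoly_mult linepoly_add linepoly_prod linepoly_nth linepoly_const) simp
    moreover have "?h m = gfix \<kappa> m $ i * msums m ^ 1" if "msums m \<noteq> 0" for m
    proof -
      have e: "msums m = (m $ below i + m $ i) * (\<Prod>j\<in>UNIV - {lo} - {i}. m $ below j + m $ j)"
        unfolding msums_def using False by (subst prod.remove[of _ i]) auto
      then show ?thesis using that False by (simp add: gfix_def gam_def)
    qed
    ultimately show ?thesis by blast
  qed
next
  case (pos i)
  show ?case by (rule exI[of _ 0], rule exI[of _ "\<lambda>_. fst x $ i"]) (simp add: linepoly_const)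
next
  case (vel i)
  show ?case by (rule exI[of _ 0], rule exI[of _ "\<lambda>_. snd x $ i"]) (simp add: linepoly_const)
next
  case (root k) then show ?case by simp
next
  case (add P Q)
  then obtain k h k' h' where "linepoly h" "linepoly h'"
    "\<forall>m :: 'n rvec. msums m \<noteq> 0 \<longrightarrow> h m = P (gfix \<kappa> m) x (\<lambda>_. 0) * msums m ^ k"
    "\<forall>m :: 'n rvec. msums m \<noteq> 0 \<longrightarrow> h' m = Q (gfix \<kappa> m) x (\<lambda>_. 0) * msums m ^ k'" by blast
  then show ?case
    by (intro exI[of _ "k + k'"] exI[of _ "\<lambda>m. h m * msums m ^ k' + h' m * msums m ^ k"])
      (simp add: linepoly_add linepoly_mult linepoly_power linepoly_msums power_add algebra_simps)
next
  case (mult P Q)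
  then obtain k h k' h' where "linepoly h" "linepoly h'"
    "\<forall>m :: 'n rvec. msums m \<noteq> 0 \<longrightarrow> h m = P (gfix \<kappa> m) x (\<lambda>_. 0) * msums m ^ k"
    "\<forall>m :: 'n rvec. msums m \<noteq> 0 \<longrightarrow> h' m = Q (gfix \<kappa> m) x (\<lambda>_. 0) * msums m ^ k'" by blast
  then show ?case
    by (intro exI[of _ "k + k'"] exI[of _ "\<lambda>m. h m * h' m"]) (simp add: linepoly_mult power_add)
qed

text \<open>The witness \<open>M\<close> may have masses of either sign: the numerator is not
  identically zero, so its zeros are null also among the positive masses.\<close>

lemma null_masses:
  fixes M :: "'n::{finite,linorder} rvec"
  assumes P: "P \<in> pol 0" and M: "msums M \<noteq> 0" "P (gfix \<kappa> M) x (\<lambda>_. 0) \<noteq> 0"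
  shows "AE m in lebesgue. (\<forall>i. 0 < m $ i) \<longrightarrow> P (gfix \<kappa> m) x (\<lambda>_. 0) \<noteq> 0"
proof -
  obtain k h where h: "linepoly h" "\<And>m. msums m \<noteq> 0 \<Longrightarrow> h m = P (gfix \<kappa> m) x (\<lambda>_. 0) * msums m ^ k"
    using linepoly_clear_denominators[OF P] by blast
  have "negligible {m. h m = 0}" using M by (intro negligible_linepoly[OF h(1), of M]) (simp add: h(2))
  then have "{m. h m = 0} \<in> null_sets lebesgue" by (simp add: negligible_iff_null_sets)
  moreover have "h m = 0" if "\<forall>i. 0 < m $ i" "P (gfix \<kappa> m) x (\<lambda>_. 0) = 0" for m
  proof -
    have "0 < msums m" unfolding msums_def using that(1) by (intro prod_pos) (simp add: add_pos_pos)
    then show ?thesis using that(2) by (simp add: h(2))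
  qed
  ultimately show ?thesis by (intro AE_I'[of "{m. h m = 0}"]) auto
qed

lemma gfix_gmod:
  assumes m: "\<And>i. 0 < m $ i" and s: "(sec::'n::{finite,linorder}) \<noteq> lo" and G: "1 < G"
  shows "gfix (gmod G m $ lo) (mmod G m) = gmod G (m :: 'n rvec)" "msums (mmod G m) \<noteq> 0"
proof -
  interpret masses "mmod G m" "gmod G m" by (rule masses_mod[OF m s G])
  show "gfix (gmod G m $ lo) (mmod G m) = gmod G m"
    using g_eq by (auto simp: gfix_def vec_eq_iff)
  show "msums (mmod G m) \<noteq> 0" unfolding msums_def using M_sum by simp
qed

lemma pre_gfix:
  assumes wok: "\<And>k. \<forall>i\<in>set (snd (w k)). (sec::'n::{finite,linorder}) < i" and s: "(sec::'n) \<noteq> lo"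
  shows "pre (gfix \<kappa> m) w V x k = pre (gams m) w V x k" "st (gfix \<kappa> m) w V x k = st (gams m) w V x k"
proof -
  have u: "ups (gfix \<kappa> m) (snd (w k)) v = ups (gams m) (snd (w k)) v" for k v
  proof (intro ups_cong ballI)
    show "gfix \<kappa> m $ i = gams m $ i" if "i \<in> set (snd (w k))" for i
    proof -
      have "sec < i" using wok[of k] that by blast
      then have "i \<noteq> lo" by (metis lo_le not_le)
      then show ?thesis by (simp add: gfix_def gams_def)
    qed
  qed
  have sg: "seg (gfix \<kappa> m) (w k) W y = seg (gams m) (w k) W y" for k W y
    by (simp add: seg_def u prod_eq_iff)
  have p: "pre (gfix \<kappa> m) w V x k = pre (gams m) w V x k" for k
  proof (induction k)
    case (Suc k)
    have "gfix \<kappa> m $ sec = gams m $ sec" using s by (simp add: gfix_def gams_def)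
    then show ?case by (simp add: sg bump2_def Suc)
  qed simp
  then show "pre (gfix \<kappa> m) w V x k = pre (gams m) w V x k" "st (gfix \<kappa> m) w V x k = st (gams m) w V x k"
    by (simp_all add: st_def sg)
qed

lemma scale_tower:
  assumes "tower onfl g w V x n" "c \<noteq> 0"
  shows "tower onfl g w (\<lambda>k. c * V k) (scale c x) n"
  using assms unfolding tower_def by (simp add: scale_pre[symmetric] rad_scale power_mult_distrib) (simp add: scale_def)

lemma scale_fin: "fin i j (c * V) (scale c s) = c ^ (if i = lo then 2 else 3) * fin i j V s"
  by (simp add: fin_def scale_def gap_linear power2_eq_square power3_eq_cube algebra_simps)

lemma scale_st: "scale c (st g w V x k) = st g w (\<lambda>k. c * V k) (scale c x) k"
  by (simp add: st_def scale_seg scale_pre)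

section \<open>Null sets of returning points\<close>

abbreviation "lips Y f \<equiv> \<exists>L. L-lipschitz_on Y f"

lemma lips_bound:
  assumes "lips Y f" "bounded Y"
  obtains L B where "0 \<le> L" "0 \<le> B" "\<And>x y. x \<in> Y \<Longrightarrow> y \<in> Y \<Longrightarrow> dist (f x) (f y) \<le> L * dist x y"
    "\<And>x. x \<in> Y \<Longrightarrow> norm (f x :: 'b::real_normed_vector) \<le> B"
proof -
  obtain L where L: "L-lipschitz_on Y f" using assms by blast
  note nn = lipschitz_on_nonneg[OF L] and d = lipschitz_onD[OF L]
  obtain B where "0 < B" "\<And>z. z \<in> f ` Y \<Longrightarrow> norm z \<le> B"
    using diameter_image_le(1)[OF assms(2) nn d] by (meson bounded_pos)
  then show ?thesis using that[OF nn _ d, of B] by simp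
qed

lemma lips_const: "lips Y (\<lambda>_. c)"
  using lipschitz_on_constant by blast

lemma lips_add: "lips Y f \<Longrightarrow> lips Y h \<Longrightarrow> lips Y (\<lambda>x. f x + h x :: 'b::real_normed_vector)"
  using lipschitz_on_add by blast

lemma lips_Pair: "lips Y f \<Longrightarrow> lips Y h \<Longrightarrow> lips Y (\<lambda>x. (f x, h x))"
  using lipschitz_on_Pair by blast

lemma lips_scaleR:
  assumes Y: "bounded Y" and f: "lips Y f" and h: "lips Y (h :: _ \<Rightarrow> 'b::real_normed_vector)"
  shows "lips Y (\<lambda>x. f x *\<^sub>R h x)"
proof -
  obtain L B where L: "0 \<le> L" "0 \<le> B" "\<And>x y. x \<in> Y \<Longrightarrow> y \<in> Y \<Longrightarrow> dist (f x) (f y) \<le> L * dist x y"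
    "\<And>x. x \<in> Y \<Longrightarrow> norm (f x) \<le> B" by (rule lips_bound[OF f Y], rule that)
  obtain M A where M: "0 \<le> M" "0 \<le> A" "\<And>x y. x \<in> Y \<Longrightarrow> y \<in> Y \<Longrightarrow> dist (h x) (h y) \<le> M * dist x y"
    "\<And>x. x \<in> Y \<Longrightarrow> norm (h x) \<le> A" by (rule lips_bound[OF h Y], rule that)
  have "(B * M + L * A)-lipschitz_on Y (\<lambda>x. f x *\<^sub>R h x)"
  proof (rule lipschitz_onI)
    fix x y assume xy: "x \<in> Y" "y \<in> Y"
    have "f x *\<^sub>R h x - f y *\<^sub>R h y = f x *\<^sub>R (h x - h y) + (f x - f y) *\<^sub>R h y" by (simp add: algebra_simps)
    then have "dist (f x *\<^sub>R h x) (f y *\<^sub>R h y) \<le> \<bar>f x\<bar> * dist (h x) (h y) + dist (f x) (f y) * norm (h y)"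
      using norm_triangle_ineq[of "f x *\<^sub>R (h x - h y)" "(f x - f y) *\<^sub>R h y"] by (simp add: dist_norm)
    also have "\<dots> \<le> B * (M * dist x y) + (L * dist x y) * A"
      using L(4)[OF xy(1)] M(4)[OF xy(2)] L(3)[OF xy] M(3)[OF xy] L(1,2) by (intro add_mono mult_mono) auto
    finally show "dist (f x *\<^sub>R h x) (f y *\<^sub>R h y) \<le> (B * M + L * A) * dist x y" by (simp add: algebra_simps)
  qed (use L M in simp)
  then show ?thesis by blast
qed

lemma lips_sum: "(\<And>i. i \<in> I \<Longrightarrow> lips Y (f i :: _ \<Rightarrow> 'b::real_normed_vector)) \<Longrightarrow> lips Y (\<lambda>x. \<Sum>i\<in>I. f i x)"
  by (induction I rule: infinite_finite_induct) (simp_all add: lips_const lips_add)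

lemma lips_linear:
  assumes "linear (f :: 'a::euclidean_space \<Rightarrow> 'b::real_normed_vector)" shows "lips Y f"
proof -
  interpret bounded_linear f using assms by (simp add: linear_conv_bounded_linear)
  show ?thesis using lipschitz_boundE by blast
qed

lemma lips_contract:
  assumes f: "lips Y f" and c: "\<And>x y. x \<in> Y \<Longrightarrow> y \<in> Y \<Longrightarrow> dist (h (f x)) (h (f y)) \<le> dist (f x) (f y)"
  shows "lips Y (\<lambda>x. h (f x))"
proof -
  obtain L where L: "L-lipschitz_on Y f" using f by blast
  have "L-lipschitz_on Y (\<lambda>x. h (f x))"
    using order_trans[OF c lipschitz_onD[OF L]] lipschitz_on_nonneg[OF L] by (intro lipschitz_onI)
  then show ?thesis by blast
qed

lemma sqrt_contract: "1 \<le> x \<Longrightarrow> 1 \<le> y \<Longrightarrow> dist (sqrt x) (sqrt y) \<le> dist x y"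
proof -
  assume xy: "1 \<le> x" "1 \<le> y"
  then have s: "1 \<le> sqrt x" "1 \<le> sqrt y" by simp_all
  have "dist x y = \<bar>(sqrt x - sqrt y) * (sqrt x + sqrt y)\<bar>"
    using xy by (simp add: dist_real_def algebra_simps)
  also have "\<dots> = dist (sqrt x) (sqrt y) * (sqrt x + sqrt y)" using s by (simp add: abs_mult dist_real_def)
  also have "\<dots> \<ge> dist (sqrt x) (sqrt y) * 1" using s by (intro mult_left_mono zero_le_dist) linarith
  finally show ?thesis by simp
qed

lemma inverse_contract: "1 \<le> x \<Longrightarrow> 1 \<le> y \<Longrightarrow> dist (1 / x) (1 / y) \<le> dist x (y::real)"
proof -
  assume xy: "1 \<le> x" "1 \<le> y"
  then have "1 * 1 \<le> x * y" by (intro mult_mono) auto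
  then have p: "1 \<le> x * y" by simp
  have "dist (1 / x) (1 / y) = dist x y / (x * y)"
    using xy by (simp add: dist_real_def abs_minus_commute diff_frac_eq abs_divide abs_mult)
  also have "\<dots> \<le> dist x y / 1" using p by (intro divide_left_mono) auto
  finally show ?thesis by simp
qed

section \<open>Thickening by the energy and two gaps\<close>

lemma bounded_phase_space:
  fixes m :: "'n::{finite,linorder} rvec"
  assumes m: "\<And>i. 0 < m $ i" shows "bounded (phase_space m)"
proof -
  have "norm x \<le> (\<Sum>i\<in>UNIV. 1 / m $ i) + (\<Sum>i\<in>UNIV. 1 + 2 / m $ i)" if x: "x \<in> phase_space m" for x
  proof -
    have q: "0 \<le> fst x $ i" for i using x by (simp add: phase_space_def config_def)
    have t: "m $ i * fst x $ i + m $ i * (snd x $ i)\<^sup>2 / 2 \<le> 1" for i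
    proof -
      have "m $ i * fst x $ i + m $ i * (snd x $ i)\<^sup>2 / 2 \<le> energy m x"
        unfolding energy_def using m q by (intro member_le_sum) (auto simp: less_imp_le)
      then show ?thesis using x by (simp add: phase_space_def)
    qed
    have "\<bar>fst x $ i\<bar> \<le> 1 / m $ i" for i
    proof -
      have "0 \<le> m $ i * (snd x $ i)\<^sup>2 / 2" using m[of i] by simp
      then have "m $ i * fst x $ i \<le> 1" using t[of i] by linarith
      then show ?thesis using m[of i] q[of i] by (simp add: field_simps)
    qed
    then have 1: "norm (fst x) \<le> (\<Sum>i\<in>UNIV. 1 / m $ i)"
      by (intro order_trans[OF norm_le_l1_cart] sum_mono)
    have "\<bar>snd x $ i\<bar> \<le> 1 + 2 / m $ i" for i
    proof -
      have "0 \<le> m $ i * fst x $ i" using m[of i] q[of i] by simp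
      then have "m $ i * (snd x $ i)\<^sup>2 \<le> 2" using t[of i] by linarith
      then have "(snd x $ i)\<^sup>2 \<le> 2 / m $ i" using m[of i] by (simp add: field_simps)
      moreover have "\<bar>snd x $ i\<bar> \<le> 1 + (snd x $ i)\<^sup>2"
        using zero_le_power2[of "\<bar>snd x $ i\<bar> - 1"] zero_le_power2[of "snd x $ i"] by (simp add: power2_diff) 
      ultimately show ?thesis by linarith
    qed
    then have "norm (snd x) \<le> (\<Sum>i\<in>UNIV. 1 + 2 / m $ i)"
      by (intro order_trans[OF norm_le_l1_cart] sum_mono)
    with 1 show ?thesis using norm_Pair_le[of "fst x" "snd x"] by simp
  qed
  then show ?thesis unfolding bounded_iff by blast
qed

text \<open>The projection of the positions to the corner \<open>a\<close>, \<open>b\<close> along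
  \<open>e\<close> and \<open>f\<close>, which are used with gaps \<open>(1, 0)\<close> and
  \<open>(0, 1)\<close>.\<close>

definition proj where
  "proj a b e f y = (fst y - gap (fst y) a *\<^sub>R e - gap (fst y) b *\<^sub>R f, snd (y :: 'n::{finite,linorder} phase))"

lemma linear_proj: "linear (proj a b e f)"
  by (rule linearI) (simp_all add: proj_def gap_linear algebra_simps)

lemma energy_scale: "energy m (scale c x) = c\<^sup>2 * energy m x"
  by (simp add: energy_def scale_def sum_distrib_left power_mult_distrib algebra_simps)

text \<open>The energy and the two gaps add three dimensions to a set of phase points with two collisions.\<close>

lemma cone_null:
  fixes m :: "'n::{finite,linorder} rvec"
  assumes m: "\<And>i. 0 < m $ i" and n: "2 \<le> CARD('n)"
    and e: "gap e a = 1" "gap e b = 0" and f: "gap f a = 0" "gap f b = 1"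
    and Z: "Z \<subseteq> phase_space m \<inter> corner a b" and N: "negligible N"
    and thick: "\<And>x c y. x \<in> Z \<Longrightarrow> 1 \<le> c \<Longrightarrow> proj a b e f y = scale c x \<Longrightarrow> y \<in> N"
  shows "hausdorff_measure (2 * CARD('n) - 3) Z = 0"
proof -
  let ?p = "proj a b e f"
  \<comment> \<open>The scaling factor starts at 1, so that the energy of the projected point is at
    least 1 on \<open>Y\<close>; there square root and reciprocal do not expand distances.\<close>
  define Y where "Y = {y. \<exists>x\<in>Z. \<exists>c\<in>{1..2}. ?p y = scale c x \<and> gap (fst y) a \<in> {0..1} \<and> gap (fst y) b \<in> {0..1}}"
  obtain R where R: "\<And>x. x \<in> Z \<Longrightarrow> norm x \<le> R"
    using bounded_subset[OF bounded_phase_space[OF m]] Z by (metis bounded_iff le_inf_iff)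
  have bY: "bounded Y"
    unfolding bounded_iff
  proof (intro exI ballI)
    fix y assume "y \<in> Y"
    then obtain x c where x: "x \<in> Z" and c: "1 \<le> c" "c \<le> 2" and y: "?p y = scale c x"
      and g: "gap (fst y) a \<in> {0..1}" "gap (fst y) b \<in> {0..1}" by (auto simp: Y_def)
    have nx: "norm (fst x) \<le> R" "norm (snd x) \<le> R" "0 \<le> R"
      using R[OF x] norm_fst_le[of "fst x" "snd x"] norm_snd_le[of "snd x" "fst x"] norm_ge_zero[of x]
      unfolding prod.collapse by linarith+
    have "fst y = c\<^sup>2 *\<^sub>R fst x + gap (fst y) a *\<^sub>R e + gap (fst y) b *\<^sub>R f" "snd y = c *\<^sub>R snd x"
      using y by (auto simp: proj_def scale_def algebra_simps)
    then have "norm (fst y) \<le> c\<^sup>2 * norm (fst x) + gap (fst y) a * norm e + gap (fst y) b * norm f" "norm (snd y) \<le> c * norm (snd x)"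
      using g c(1) norm_triangle_ineq[of "c\<^sup>2 *\<^sub>R fst x + gap (fst y) a *\<^sub>R e" "gap (fst y) b *\<^sub>R f"]
        norm_triangle_ineq[of "c\<^sup>2 *\<^sub>R fst x" "gap (fst y) a *\<^sub>R e"] by auto
    moreover have "c\<^sup>2 * norm (fst x) \<le> 2\<^sup>2 * R" "c * norm (snd x) \<le> 2 * R"
      using c nx by (intro mult_mono power_mono; simp)+
    moreover have "gap (fst y) a * norm e \<le> 1 * norm e" "gap (fst y) b * norm f \<le> 1 * norm f"
      using g by (intro mult_right_mono; simp)+
    ultimately show "norm y \<le> 6 * R + norm e + norm f" using norm_Pair_le[of "fst y" "snd y"] by simp
  qed
  \<comment> \<open>The energy is 1 on \<open>Z\<close>, so \<open>E\<close> recovers the square of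
    the scaling factor.\<close>
  define E where "E = (\<lambda>y. energy m (?p y))"
  have E: "E y = c\<^sup>2" if "x \<in> Z" "?p y = scale c x" for x y c
    using that Z by (auto simp: E_def energy_scale phase_space_def)
  have E1: "1 \<le> E y" if y: "y \<in> Y" for y
  proof -
    obtain x c where "x \<in> Z" "1 \<le> c" "?p y = scale c x" using y by (auto simp: Y_def)
    then show ?thesis using E[of x y c] by simp
  qed
  have lp: "lips Y (\<lambda>y. fst (?p y))" "lips Y (\<lambda>y. snd (?p y))" "lips Y (\<lambda>y. fst (?p y) $ k)" "lips Y (\<lambda>y. snd (?p y) $ k)" for k
    by (rule lips_linear, rule linearI, simp_all add: linear_add[OF linear_proj] linear_scale[OF linear_proj])+
  have "lips Y E"
  proof -
    have e: "E = (\<lambda>y. \<Sum>i\<in>UNIV. m $ i *\<^sub>R fst (?p y) $ i + (m $ i / 2) *\<^sub>R (snd (?p y) $ i *\<^sub>R snd (?p y) $ i))"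
      by (simp add: E_def energy_def power2_eq_square)
    show ?thesis unfolding e by (intro lips_sum lips_add lips_scaleR bY lips_const lp)
  qed
  then have ls: "lips Y (\<lambda>y. sqrt (E y))" by (rule lips_contract) (use sqrt_contract E1 in blast)
  then have li: "lips Y (\<lambda>y. 1 / sqrt (E y))" by (rule lips_contract) (use inverse_contract E1 in simp)
  \<comment> \<open>\<open>\<rho>\<close> undoes projection and scaling, and \<open>\<sigma>\<close>
    reads the three added coordinates, shifted to the unit cube.\<close>
  define \<rho> where "\<rho> = (\<lambda>y. ((1 / sqrt (E y)) *\<^sub>R ((1 / sqrt (E y)) *\<^sub>R fst (?p y)), (1 / sqrt (E y)) *\<^sub>R snd (?p y)))"
  define \<sigma> where "\<sigma> = (\<lambda>y :: 'n phase. (sqrt (E y) + - 1, gap (fst y) a, gap (fst y) b))"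
  have "lips Y \<rho>" unfolding \<rho>_def by (intro lips_Pair lips_scaleR bY lp li)
  then obtain L where L: "L-lipschitz_on Y \<rho>" by blast
  have lg: "lips Y (\<lambda>y. gap (fst y) k)" for k
    by (rule lips_linear, rule linearI) (simp_all add: gap_linear)
  have "lips Y \<sigma>" unfolding \<sigma>_def by (intro lips_Pair lips_add lips_const ls lg)
  then obtain L' where L': "L'-lipschitz_on Y \<sigma>" by blast
  have "Y \<subseteq> N" using thick by (auto simp: Y_def)
  then have "hausdorff_measure DIM('n phase) Y = 0"
    by (intro negligible_hausdorff_null[OF negligible_subset[OF N] bY])
  moreover have "DIM('n phase) = 2 * CARD('n) - 3 + DIM(real \<times> real \<times> real)" using n by simp
  ultimately have "hausdorff_measure (2 * CARD('n) - 3 + DIM(real \<times> real \<times> real)) Y = 0" by simp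
  then show ?thesis
  proof (rule hausdorff_null_slice)
    show "0 < 2 * CARD('n) - 3" using n by simp
    show "0 < max L L' + 1" using lipschitz_on_nonneg[OF L] by simp
    fix y y' assume yy: "y \<in> Y" "y' \<in> Y"
    show "dist (\<rho> y) (\<rho> y') \<le> (max L L' + 1) * dist y y'"
      using lipschitz_onD[OF L yy] by (rule order_trans) (intro mult_right_mono; simp)
    show "dist (\<sigma> y) (\<sigma> y') \<le> (max L L' + 1) * dist y y'"
      using lipschitz_onD[OF L' yy] by (rule order_trans) (intro mult_right_mono; simp)
  next
    fix z and s :: "real \<times> real \<times> real"
    assume z: "z \<in> Z" and s: "s \<in> cbox 0 One"
    obtain s1 s2 s3 where s3: "s = (s1, s2, s3)" by (cases s)
    have b: "0 \<le> s1" "s1 \<le> 1" "s2 \<in> {0..1}" "s3 \<in> {0..1}"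
      using s unfolding s3 by (auto simp: mem_box Basis_prod_def)
    define c where "c = 1 + s1"
    define y where "y = (c\<^sup>2 *\<^sub>R fst z + s2 *\<^sub>R e + s3 *\<^sub>R f, c *\<^sub>R snd z)"
    have c0: "gap (fst z) a = 0" "gap (fst z) b = 0" using z Z by (auto simp: corner_def)
    have g: "gap (fst y) a = s2" "gap (fst y) b = s3" by (simp_all add: y_def gap_linear c0 e f)
    have p: "?p y = scale c z" unfolding proj_def g by (simp add: y_def scale_def)
    have c1: "1 \<le> c" "c \<le> 2" using b by (simp_all add: c_def)
    have "y \<in> Y" unfolding Y_def using c1 g b by (intro CollectI bexI[OF _ z] bexI[of _ c] conjI p) auto
    moreover have "sqrt (E y) = c" using E[OF z p] c1 by simp
    then have "\<rho> y = ((1 / c) *\<^sub>R ((1 / c) *\<^sub>R fst (scale c z)), (1 / c) *\<^sub>R snd (scale c z))" "\<sigma> y = s"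
      unfolding \<rho>_def \<sigma>_def p g s3 by (simp_all add: c_def)
    moreover have "((1 / c) *\<^sub>R ((1 / c) *\<^sub>R fst (scale c z)), (1 / c) *\<^sub>R snd (scale c z)) = z"
      using c1 by (simp add: scale_def prod_eq_iff power2_eq_square)
    ultimately show "\<exists>y\<in>Y. \<rho> y = z \<and> \<sigma> y = s" by auto
  qed
qed

section \<open>Returning points for a fixed order of collisions\<close>

definition bad where
  "bad m w c a b i j = {x \<in> phase_space m \<inter> corner a b. nondegenerate m w c a b i j \<and>
     (\<exists>V. tower (a = lo) (gams m) w V x (Suc c) \<and> fin i j (V c) (st (gams m) w V x c) = 0)}"

text \<open>The polynomial is nonzero at one point for one choice of coefficients, hence at that
  same point for almost all masses; for each of these its zeros on the corner are negligible. The
  return equation is homogeneous under \<open>scale\<close>, so \<open>cone_null\<close> passes to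
  the energy surface.\<close>

lemma bad_null:
  assumes n: "2 \<le> CARD('n)" and s: "(sec::'n::{finite,linorder}) \<noteq> lo" and wok: "\<And>k. \<forall>i\<in>set (snd (w k)). (sec::'n) < i"
    and ab: "a < (b::'n)" and ij: "i < (j::'n)"
  shows "AE m in lebesgue. (\<forall>i. 0 < m $ i) \<longrightarrow> hausdorff_measure (2 * CARD('n) - 3) (bad m w c a b i j) = 0"
proof (cases "\<exists>m :: 'n rvec. (\<forall>i. 0 < m $ i) \<and> nondegenerate m w c a b i j")
  case False
  have "bad m w c a b i j = {}" if "\<forall>i. 0 < m $ i" for m :: "'n rvec"
    using False that by (auto simp: bad_def)
  moreover have "hausdorff_measure (2 * CARD('n) - 3) ({} :: 'n phase set) = 0"
    using hausdorff_null_countable_UN[of "{} :: nat set" "2 * CARD('n) - 3"] n by simp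
  ultimately show ?thesis by simp
next
  case True
  then obtain m0 :: "'n rvec" where m0: "\<And>i. 0 < m0 $ i" and nd: "nondegenerate m0 w c a b i j" by blast
  have "\<exists>G x. 1 < G \<and> x \<in> corner a b \<and>
    (\<forall>V n. n \<le> c \<and> tower (a = lo) (gmod G m0) w V x n \<longrightarrow> 0 < rad (pre (gmod G m0) w V x n)) \<and>
    (\<forall>V. tower (a = lo) (gmod G m0) w V x (Suc c) \<longrightarrow> fin i j (V c) (st (gmod G m0) w V x c) \<noteq> 0)"
    by (rule generic_nonvanishing[OF m0 s wok ab ij nd])
  then obtain G x where G: "1 < G" and x: "x \<in> corner a b"
    and pos: "\<forall>V n. n \<le> c \<and> tower (a = lo) (gmod G m0) w V x n \<longrightarrow> 0 < rad (pre (gmod G m0) w V x n)"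
    and nz: "\<forall>V. tower (a = lo) (gmod G m0) w V x (Suc c) \<longrightarrow> fin i j (V c) (st (gmod G m0) w V x c) \<noteq> 0"
    by (elim exE conjE) (rule that)
  from final_polynomial[of "a = lo" w c i j] obtain P where P: "P \<in> pol 0"
    and P1: "\<forall>g x V. tower (a = lo) g w V x (Suc c) \<and> fin i j (V c) (st g w V x c) = 0 \<longrightarrow> P g x (\<lambda>_. 0) = 0"
    and P2: "\<forall>g x. (a = lo \<longrightarrow> fst x $ lo = 0) \<and>
       (\<forall>V n. n \<le> c \<and> tower (a = lo) g w V x n \<longrightarrow> 0 < rad (pre g w V x n)) \<and>
       (\<forall>V. tower (a = lo) g w V x (Suc c) \<longrightarrow> fin i j (V c) (st g w V x c) \<noteq> 0)
      \<longrightarrow> P g x (\<lambda>_. 0) \<noteq> 0"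
    by (elim bexE conjE) (rule that)
  have "P (gmod G m0) x (\<lambda>_. 0) \<noteq> 0"
    using pos nz x by (intro P2[rule_format]) (auto simp: corner_def gap_eq)
  note gm = gfix_gmod[OF m0 s G]
  \<comment> \<open>The entry of \<open>gmod G m0\<close> at \<open>lo\<close> is a formal value;
    taking it for \<open>\<kappa>\<close> makes \<open>gfix\<close> agree with \<open>gmod\<close>
    there too.\<close>
  define \<kappa> where "\<kappa> = gmod G m0 $ lo"
  have "AE m in lebesgue. (\<forall>i. 0 < m $ i) \<longrightarrow> P (gfix \<kappa> m) x (\<lambda>_. 0) \<noteq> 0"
    using gm(2) by (rule null_masses[OF P]) (simp add: \<kappa>_def gm(1) \<open>P (gmod G m0) x (\<lambda>_. 0) \<noteq> 0\<close>)
  then show ?thesis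
  proof (rule AE_mp, intro AE_I2 impI)
    fix m :: "'n rvec"
    assume Pm: "(\<forall>i. 0 < m $ i) \<longrightarrow> P (gfix \<kappa> m) x (\<lambda>_. 0) \<noteq> 0" and m: "\<forall>i. 0 < m $ i"
    obtain e f :: "'n rvec" where ef: "gap e a = 1" "gap e b = 0" "gap f a = 0" "gap f b = 1"
      using gap_pair_onto[OF ab, of 1 0] gap_pair_onto[OF ab, of 0 1] by blast
    define N where "N = {y. P (gfix \<kappa> m) (proj a b e f y) (\<lambda>_. 0) = 0}"
    have "proj a b e f x = x" using x by (simp add: proj_def corner_def)
    moreover have "linepoly (\<lambda>y. P (gfix \<kappa> m) (proj a b e f y) (\<lambda>_. 0))"
      by (rule linepoly_compose[OF linepoly_pol[OF P] linear_proj])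
    ultimately have N: "negligible N" unfolding N_def using Pm m by (intro negligible_linepoly[of _ x]) auto
    show "hausdorff_measure (2 * CARD('n) - 3) (bad m w c a b i j) = 0"
    proof (rule cone_null[OF _ n ef _ N])
      show "bad m w c a b i j \<subseteq> phase_space m \<inter> corner a b" by (auto simp: bad_def)
      fix x' l y assume x': "x' \<in> bad m w c a b i j" and l: "1 \<le> l" and y: "proj a b e f y = scale l x'"
      obtain V where V: "tower (a = lo) (gams m) w V x' (Suc c)" "fin i j (V c) (st (gams m) w V x' c) = 0"
        using x' by (auto simp: bad_def)
      have "tower (a = lo) (gams m) w (\<lambda>k. l * V k) (scale l x') (Suc c)" using V(1) l by (intro scale_tower) auto
      moreover have "fin i j (l * V c) (st (gams m) w (\<lambda>k. l * V k) (scale l x') c) = 0"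
        using V(2) by (simp add: scale_st[symmetric] scale_fin)
      ultimately have "P (gfix \<kappa> m) (scale l x') (\<lambda>_. 0) = 0"
        by (intro P1[rule_format, of _ "\<lambda>k. l * V k"]) (simp add: tower_def pre_gfix[OF wok s])
      then show "y \<in> N" by (simp add: N_def y)
    qed (use m in simp)
  qed
qed

text \<open>All but finitely many stages of a run are empty; coding the others by a list makes the
  orders of collisions countable.\<close>

definition word :: "'n stage list \<Rightarrow> nat \<Rightarrow> 'n stage" where
  "word ws k = (if k < length ws then ws ! k else (0, []))"

lemma return_bad:
  fixes m :: "'n::{finite,linorder} rvec"
  assumes m: "\<And>i. 0 < m $ i" and s: "(sec::'n) \<noteq> lo" and k: "0 < k"
    and x: "x \<in> singular_set m" and T: "(billiard_map m ^^ k) x y" and y: "y \<in> singular_set m"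
  shows "\<exists>ws c a b i j. (\<forall>k. \<forall>i\<in>set (snd (word ws k)). sec < i) \<and> a < b \<and> i < j \<and> x \<in> bad m (word ws) c a b i j"
proof -
  have pair: "\<exists>a b. a < b \<and> z \<in> phase_space m \<and> z \<in> corner a b" if z: "z \<in> singular_set m" for z
  proof -
    obtain a b where "a \<noteq> b" "z \<in> phase_space m" "gap (fst z) a = 0" "gap (fst z) b = 0"
      using z by (auto simp: singular_set_def singular_piece_def face_def)
    then show ?thesis unfolding corner_def by (cases "a < b") (auto simp: not_less order_le_less)
  qed
  obtain a b where ab: "a < b" and xp: "x \<in> phase_space m" "x \<in> corner a b" using pair[OF x] by blast
  obtain i j where ij: "i < j" and yp: "y \<in> corner i j" using pair[OF y] by blast
  obtain n where n: "k = Suc n" using k by (cases k) auto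
  have cf: "fst x \<in> config" using xp by (simp add: phase_space_def)
  have B: "0 < gap (snd x) a \<and> 0 < gap (snd x) b \<and> fst y \<in> config \<and> (\<forall>i. gap (fst y) i = 0 \<longrightarrow> gap (snd y) i < 0) \<and>
    (\<exists>w c \<tau> s. \<exists>t. run m a x w c \<tau> s \<and> \<tau> < t \<and> 0 < t \<and> y = free_flow t s)"
    by (rule billiard_run[OF m s ab xp(2) cf T[unfolded n]])
  then obtain w c \<tau> s' t where r: "run m a x w c \<tau> s'" "\<tau> < t" "0 < t" "y = free_flow t s'" by blast
  have z: "gap (fst y) i = 0" "gap (fst y) j = 0" using yp by (simp_all add: corner_def)
  have nd: "nondegenerate m w c a b i j"
    using B z unfolding r(4) by (intro run_nondegenerate[OF m s r(1-3) ab xp(2) _ ij]) auto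
  have tw: "\<exists>V. tower (a = lo) (gams m) w V x (Suc c) \<and> fin i j (V c) (st (gams m) w V x c) = 0"
    using B z by (intro run_tower[OF s r(1) ab xp(2) _ cf ij r(4)]) auto
  have w: "w = word (map w [0..<Suc c])"
    using r(1) unfolding run_def word_def by (auto simp: fun_eq_iff simp del: upt_Suc)
  have "\<forall>k. \<forall>i\<in>set (snd (word (map w [0..<Suc c]) k)). sec < i"
    unfolding w[symmetric] using r(1) by (simp add: run_def)
  moreover have "x \<in> bad m (word (map w [0..<Suc c])) c a b i j"
    unfolding w[symmetric] bad_def using nd tw xp by simp
  ultimately show ?thesis using ab ij by blast
qed

theorem corollary3p16:
  assumes "CARD('n::{finite,linorder}) \<ge> 2"
  shows "AE m in (lebesgue :: (real^'n::{finite,linorder}) measure).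
    (\<forall>i j. i < j \<longrightarrow> m $ j < m $ i) \<and> (\<forall>i. 0 < m $ i) \<longrightarrow>
    (\<forall>k::nat. 0 < k \<longrightarrow>
      hausdorff_measure (2 * CARD('n) - 3)
        {x0 \<in> singular_set m. outgoing x0 \<and>
           \<not> (\<forall>xk. (billiard_map m ^^ k) x0 xk \<and> xk \<in> singular_set m \<longrightarrow>
                 transversal_image m k x0 xk)} = 0)"
proof -
  have "\<exists>i. i \<noteq> (lo :: 'n)"
  proof (rule ccontr)
    assume "\<not> ?thesis"
    then have "UNIV = {lo :: 'n}" by auto
    then have "CARD('n) = card {lo :: 'n}" by (rule arg_cong)
    then show False using assms by simp
  qed
  then have s: "(sec :: 'n) \<noteq> lo" using sec_neq_lo by blast
  define W where "W = {(ws :: 'n stage list, c :: nat, a :: 'n, b :: 'n, i :: 'n, j :: 'n).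
    (\<forall>k. \<forall>i\<in>set (snd (word ws k)). sec < i) \<and> a < b \<and> i < j}"
  have c: "countable (UNIV :: 'n set)" "countable (UNIV :: ('n \<times> 'n \<times> 'n \<times> 'n) set)"
    by (rule countable_finite, simp)+
  have "countable (lists ((UNIV :: nat set) \<times> lists (UNIV :: 'n set)))"
    by (intro countable_lists countable_SIGMA c countableI_type)
  then have "countable (lists ((UNIV :: nat set) \<times> lists (UNIV :: 'n set)) \<times> (UNIV :: nat set) \<times> (UNIV :: ('n \<times> 'n \<times> 'n \<times> 'n) set))"
    by (intro countable_SIGMA c(2) countableI_type)
  then have W: "countable W" by (rule countable_subset[rotated]) (auto simp: lists_UNIV)
  \<comment> \<open>The orders do not mention the number of iterates, so one null set of masses
    serves for all of them and for every \<open>k\<close>.\<close>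
  have "AE m in lebesgue. \<forall>(ws, c, a, b, i, j)\<in>W. (\<forall>i. 0 < m $ i) \<longrightarrow>
      hausdorff_measure (2 * CARD('n) - 3) (bad m (word ws) c a b i j) = 0"
    unfolding AE_ball_countable[OF W] by (auto simp: W_def intro!: bad_null[OF assms s])
  then show ?thesis
  proof (rule AE_mp, intro AE_I2 impI allI; elim conjE)
    fix m :: "'n rvec" and k :: nat
    assume null: "\<forall>(ws, c, a, b, i, j)\<in>W. (\<forall>i. 0 < m $ i) \<longrightarrow>
        hausdorff_measure (2 * CARD('n) - 3) (bad m (word ws) c a b i j) = 0"
      and m: "\<forall>i. 0 < m $ i" and k: "0 < k"
    have "hausdorff_measure (2 * CARD('n) - 3) (\<Union>(ws, c, a, b, i, j)\<in>W. bad m (word ws) c a b i j) = 0"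
      using null m assms by (intro hausdorff_null_countable_UN[OF W]) auto
    then show "hausdorff_measure (2 * CARD('n) - 3)
        {x0 \<in> singular_set m. outgoing x0 \<and>
           \<not> (\<forall>xk. (billiard_map m ^^ k) x0 xk \<and> xk \<in> singular_set m \<longrightarrow> transversal_image m k x0 xk)} = 0"
    proof (rule hausdorff_null_subset, intro subsetI)
      fix x assume "x \<in> {x0 \<in> singular_set m. outgoing x0 \<and>
           \<not> (\<forall>xk. (billiard_map m ^^ k) x0 xk \<and> xk \<in> singular_set m \<longrightarrow> transversal_image m k x0 xk)}"
      then obtain y where "x \<in> singular_set m" "(billiard_map m ^^ k) x y" "y \<in> singular_set m" by blast
      then have "\<exists>ws c a b i j. (\<forall>k. \<forall>i\<in>set (snd (word ws k)). sec < i) \<and> a < b \<and> i < j \<and> x \<in> bad m (word ws) c a b i j"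
        using m by (intro return_bad[OF _ s k, of m x y]) auto
      then show "x \<in> (\<Union>(ws, c, a, b, i, j)\<in>W. bad m (word ws) c a b i j)" by (force simp: W_def)
    qed
  qed
qed

end
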